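(* Let $\mathbb{F}$ be a field, $G$ a finite group and $1\le m\le n$. The assignment $$g\mapsto g,\quad s_l\mapsto s_l,\quad \varepsilon_k\mapsto\varepsilon_k,\quad u_k\mapsto u_{k|n}\qquad(g\in G^m,\ 1\le l\le m-1,\ 1\le k\le m)$$ defines an algebra homomorphism $\overline{\Psi}:\overline{\mathcal{H}}_m(G)\to\overline{\mathcal{Z}}_{m,n}$. Moreover, the algebra $\overline{\mathcal{Z}}_{m,n}$ is generated by the image of $\overline{\Psi}$ and the center of the subalgebra $\mathbb{F}\overline{G}'_{n-m}$.
   Context: For $n\ge 1$, $\overline{G}_n$ is the semigroup of $n\times n$ matrices with entries in $G\cup\{0\}$ having at most one nonzero entry in each row and column, under matrix multiplication with $g0=0g=0$, $g+0=0+g=g$ (0 an extra symbol); $\overline{G}_0=\{1\}$. $\mathbb{F}\overline{G}_n$ is the semigroup algebra with basis $\overline{G}_n$ (the zero matrix is one of the basis elements). A permutation $\sigma\in S_n$ is identified with the matrix having $1$ in position $(i,j)$ iff $\sigma(j)=i$, and $g=(g_1,\dots,g_n)\in G^n$ with the diagonal matrix with entries $g_i$; $s_i=(i,i+1)$; $h^{(i)}\in G^n$ has $h$ in position $i$ and $1$ elsewhere; $\varepsilon_i$ is the diagonal matrix with $(i,i)$ entry $0$ and other diagonal entries $1$; $t_{kl}=\sum_{h\in G}h^{(k)}(h^{-1})^{(l)}$. For $m\le n$, $\overline{G}_m$ is embedded in $\overline{G}_n$ by $\gamma\mapsto \mathrm{diag}(\gamma,1,\dots,1)$. $\overline{G}'_{n-m}\subseteq\overline{G}_n$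 is the subsemigroup of matrices whose first $m$ diagonal entries equal $1$; $\overline{\mathcal{Z}}_{m,n}$ is the centralizer of $\overline{G}'_{n-m}$ in $\mathbb{F}\overline{G}_n$. For $\gamma\in\overline{G}_n$, $\deg(\gamma)=|\{k:\gamma_{kk}\ne 1\}|$, extended to linear combinations as the maximum over elements with nonzero coefficient. $\theta_n:\mathbb{F}\overline{G}_n\to\mathbb{F}\overline{G}_{n-1}$ is the linear map sending $\gamma\in\overline{G}_n$ to its upper left corner of order $n-1$. $\overline{\mathcal{Z}}_m$ is the algebra of sequences $(\alpha_n)_{n\ge m}$ with $\alpha_n\in\overline{\mathcal{Z}}_{m,n}$, $\theta_n(\alpha_n)=\alpha_{n-1}$ for $n>m$, $\sup_n\deg(\alpha_n)<\infty$, with componentwise operations; $\mathbb{F}\overline{G}_m$ embeds in it as constant sequences. Put $u_{k|n}=\sum_{i=k+1}^n t_{ki}(k\,i)(1-\varepsilon_k)(1-\varepsilon_i)\in\overline{\mathcal{Z}}_{m,n}$, where $(k\,i)$ is the transposition, and $u_k=(u_{k|n})_{n\ge m}\in\overline{\mathcal{Z}}_m$ for $1\le k\le m$. $\overline{\mathcal{H}}_m(G)$ is the subalgebra of $\overline{\mathcal{Z}}_m$ generated by $\mathbb{F}\overline{G}_m$ (itself generated by $G^m$, the $s_l$ and the $\varepsilon_k$) and $u_1,\dots,u_m$. *)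

theory Defs
  imports "HOL-Algebra.Module" "HOL-Library.Poly_Mapping" "HOL-Combinatorics.Transposition"
begin

section \<open>Algebras over a field given as records\<close>

text \<open>
  The scalars are a type of class \<^class>\<open>field\<close>; an algebra over them is a record of type
  \<^typ>\<open>('f, 'a) module\<close>.  Subalgebras and homomorphisms are unital.
\<close>

definition alg_hom :: "('f, 'a) module \<Rightarrow> ('f, 'b) module \<Rightarrow> ('a \<Rightarrow> 'b) set" where
  "alg_hom A B = {h \<in> ring_hom A B. \<forall>c. \<forall>x \<in> carrier A. h (c \<odot>\<^bsub>A\<^esub> x) = c \<odot>\<^bsub>B\<^esub> h x}"

inductive_set alg_generated :: "('f, 'a) module \<Rightarrow> 'a set \<Rightarrow> 'a set"
  for A :: "('f, 'a) module" and S :: "'a set" where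
  one: "\<one>\<^bsub>A\<^esub> \<in> alg_generated A S"
| incl: "x \<in> S \<Longrightarrow> x \<in> alg_generated A S"
| add: "x \<in> alg_generated A S \<Longrightarrow> y \<in> alg_generated A S \<Longrightarrow> x \<oplus>\<^bsub>A\<^esub> y \<in> alg_generated A S"
| mult: "x \<in> alg_generated A S \<Longrightarrow> y \<in> alg_generated A S \<Longrightarrow> x \<otimes>\<^bsub>A\<^esub> y \<in> alg_generated A S"
| smult: "x \<in> alg_generated A S \<Longrightarrow> c \<odot>\<^bsub>A\<^esub> x \<in> alg_generated A S"

definition alg_center :: "('f, 'a) module \<Rightarrow> 'a set" where
  "alg_center A = {z \<in> carrier A. \<forall>x \<in> carrier A. z \<otimes>\<^bsub>A\<^esub> x = x \<otimes>\<^bsub>A\<^esub> z}"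


section \<open>The semigroup of monomial matrices with zeros\<close>

text \<open>
  Matrix entries lie in $G \cup \{0\}$, the extra symbol $0$ being \<^const>\<open>None\<close>.  A matrix of
  order $n$ is indexed by $1, \dots, n$ and is padded with \<^const>\<open>None\<close> outside this range, so
  that the product does not depend on $n$.
\<close>

type_synonym 'g gmat = "nat \<Rightarrow> nat \<Rightarrow> 'g option"

definition Gbar :: "('g, 'x) monoid_scheme \<Rightarrow> nat \<Rightarrow> 'g gmat set" where
  "Gbar G n = {\<gamma>.
     (\<forall>i j. \<gamma> i j \<noteq> None \<longrightarrow> i \<in> {1..n} \<and> j \<in> {1..n} \<and> the (\<gamma> i j) \<in> carrier G) \<and>
     (\<forall>i j k. \<gamma> i j \<noteq> None \<and> \<gamma> i k \<noteq> None \<longrightarrow> j = k) \<and>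
     (\<forall>i j k. \<gamma> i k \<noteq> None \<and> \<gamma> j k \<noteq> None \<longrightarrow> i = j)}"

fun entry_mult :: "('g, 'x) monoid_scheme \<Rightarrow> 'g option \<Rightarrow> 'g option \<Rightarrow> 'g option" where
  "entry_mult G (Some g) (Some h) = Some (g \<otimes>\<^bsub>G\<^esub> h)"
| "entry_mult G _ _ = None"

text \<open>
  Addition on $G \cup \{0\}$ is only defined when at most one summand is nonzero, and this is the
  only case that occurs in products of elements of \<^const>\<open>Gbar\<close>.
\<close>

definition entry_sum :: "(nat \<Rightarrow> 'g option) \<Rightarrow> 'g option" where
  "entry_sum f = (if \<exists>k. f k \<noteq> None then f (THE k. f k \<noteq> None) else None)"

definition gmat_mult :: "('g, 'x) monoid_scheme \<Rightarrow> 'g gmat \<Rightarrow> 'g gmat \<Rightarrow> 'g gmat" where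
  "gmat_mult G \<gamma> \<delta> = (\<lambda>i j. entry_sum (\<lambda>k. entry_mult G (\<gamma> i k) (\<delta> k j)))"

definition diag_gmat :: "nat \<Rightarrow> (nat \<Rightarrow> 'g) \<Rightarrow> 'g gmat" where
  "diag_gmat n g = (\<lambda>i j. if i = j \<and> i \<in> {1..n} then Some (g i) else None)"

definition one_gmat :: "('g, 'x) monoid_scheme \<Rightarrow> nat \<Rightarrow> 'g gmat" where
  "one_gmat G n = diag_gmat n (\<lambda>i. \<one>\<^bsub>G\<^esub>)"

definition perm_gmat :: "('g, 'x) monoid_scheme \<Rightarrow> nat \<Rightarrow> (nat \<Rightarrow> nat) \<Rightarrow> 'g gmat" where
  "perm_gmat G n \<sigma> =
     (\<lambda>i j. if i \<in> {1..n} \<and> j \<in> {1..n} \<and> \<sigma> j = i then Some \<one>\<^bsub>G\<^esub> else None)"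

text \<open>\<open>pos_gmat G n k h\<close> is $h^{(k)}$.\<close>

definition pos_gmat :: "('g, 'x) monoid_scheme \<Rightarrow> nat \<Rightarrow> nat \<Rightarrow> 'g \<Rightarrow> 'g gmat" where
  "pos_gmat G n k h = diag_gmat n (\<lambda>i. if i = k then h else \<one>\<^bsub>G\<^esub>)"

definition eps_gmat :: "('g, 'x) monoid_scheme \<Rightarrow> nat \<Rightarrow> nat \<Rightarrow> 'g gmat" where
  "eps_gmat G n k = (\<lambda>i j. if i = j \<and> i \<in> {1..n} \<and> i \<noteq> k then Some \<one>\<^bsub>G\<^esub> else None)"

text \<open>The embedding $\gamma \mapsto \mathrm{diag}(\gamma, 1, \dots, 1)$ of order $m$ into order $n$.\<close>

definition embed_gmat :: "('g, 'x) monoid_scheme \<Rightarrow> nat \<Rightarrow> nat \<Rightarrow> 'g gmat \<Rightarrow> 'g gmat" where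
  "embed_gmat G m n \<gamma> = (\<lambda>i j. if i = j \<and> i \<in> {m+1..n} then Some \<one>\<^bsub>G\<^esub> else \<gamma> i j)"

definition corner :: "nat \<Rightarrow> 'g gmat \<Rightarrow> 'g gmat" where
  "corner k \<gamma> = (\<lambda>i j. if i \<in> {1..k} \<and> j \<in> {1..k} then \<gamma> i j else None)"

text \<open>\<open>Gbar' G m n\<close> is the subsemigroup $\overline{G}'_{n-m}$ of $\overline{G}_n$.\<close>

definition Gbar' :: "('g, 'x) monoid_scheme \<Rightarrow> nat \<Rightarrow> nat \<Rightarrow> 'g gmat set" where
  "Gbar' G m n = {\<gamma> \<in> Gbar G n. \<forall>k \<in> {1..m}. \<gamma> k k = Some \<one>\<^bsub>G\<^esub>}"

definition gmat_deg :: "('g, 'x) monoid_scheme \<Rightarrow> nat \<Rightarrow> 'g gmat \<Rightarrow> nat" where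
  "gmat_deg G n \<gamma> = card {k \<in> {1..n}. \<gamma> k k \<noteq> Some \<one>\<^bsub>G\<^esub>}"


section \<open>The semigroup algebra and the centralizer\<close>

abbreviation basis :: "'g gmat \<Rightarrow> 'g gmat \<Rightarrow>\<^sub>0 'f::field" where
  "basis \<gamma> \<equiv> Poly_Mapping.single \<gamma> 1"

definition lin_ext :: "('g gmat \<Rightarrow> 'g gmat) \<Rightarrow> ('g gmat \<Rightarrow>\<^sub>0 'f::field) \<Rightarrow> 'g gmat \<Rightarrow>\<^sub>0 'f" where
  "lin_ext f \<alpha> = (\<Sum>\<gamma> \<in> Poly_Mapping.keys \<alpha>. Poly_Mapping.single (f \<gamma>) (Poly_Mapping.lookup \<alpha> \<gamma>))"

definition conv :: "('g, 'x) monoid_scheme \<Rightarrow> ('g gmat \<Rightarrow>\<^sub>0 'f::field) \<Rightarrow> ('g gmat \<Rightarrow>\<^sub>0 'f) \<Rightarrow> 'g gmat \<Rightarrow>\<^sub>0 'f" where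
  "conv G \<alpha> \<beta> = (\<Sum>\<gamma> \<in> Poly_Mapping.keys \<alpha>. \<Sum>\<delta> \<in> Poly_Mapping.keys \<beta>.
     Poly_Mapping.single (gmat_mult G \<gamma> \<delta>) (Poly_Mapping.lookup \<alpha> \<gamma> * Poly_Mapping.lookup \<beta> \<delta>))"

definition FGbar :: "('g, 'x) monoid_scheme \<Rightarrow> nat \<Rightarrow> ('f::field, 'g gmat \<Rightarrow>\<^sub>0 'f) module" where
  "FGbar G n =
     \<lparr>carrier = {\<alpha>. Poly_Mapping.keys \<alpha> \<subseteq> Gbar G n},
      mult = conv G, one = basis (one_gmat G n), zero = 0, add = (+),
      smult = (\<lambda>c. Poly_Mapping.map ((*) c))\<rparr>"

definition FGbar' :: "('g, 'x) monoid_scheme \<Rightarrow> nat \<Rightarrow> nat \<Rightarrow> ('f::field, 'g gmat \<Rightarrow>\<^sub>0 'f) module" where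
  "FGbar' G m n = FGbar G n\<lparr>carrier := {\<alpha>. Poly_Mapping.keys \<alpha> \<subseteq> Gbar' G m n}\<rparr>"

definition Zbar :: "('g, 'x) monoid_scheme \<Rightarrow> nat \<Rightarrow> nat \<Rightarrow> ('f::field, 'g gmat \<Rightarrow>\<^sub>0 'f) module" where
  "Zbar G m n = FGbar G n\<lparr>carrier :=
     {\<alpha> \<in> carrier (FGbar G n). \<forall>\<gamma> \<in> Gbar' G m n. conv G \<alpha> (basis \<gamma>) = conv G (basis \<gamma>) \<alpha>}\<rparr>"

text \<open>The degree of $0$ is taken to be $0$.\<close>

definition alg_deg :: "('g, 'x) monoid_scheme \<Rightarrow> nat \<Rightarrow> ('g gmat \<Rightarrow>\<^sub>0 'f::field) \<Rightarrow> nat" where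
  "alg_deg G n \<alpha> = Max (insert 0 (gmat_deg G n ` Poly_Mapping.keys \<alpha>))"

definition theta :: "nat \<Rightarrow> ('g gmat \<Rightarrow>\<^sub>0 'f::field) \<Rightarrow> 'g gmat \<Rightarrow>\<^sub>0 'f" where
  "theta n = lin_ext (corner (n - 1))"

definition t_elem :: "('g, 'x) monoid_scheme \<Rightarrow> nat \<Rightarrow> nat \<Rightarrow> nat \<Rightarrow> 'g gmat \<Rightarrow>\<^sub>0 'f::field" where
  "t_elem G n k l =
     (\<Sum>h \<in> carrier G. conv G (basis (pos_gmat G n k h)) (basis (pos_gmat G n l (inv\<^bsub>G\<^esub> h))))"

definition u_elem :: "('g, 'x) monoid_scheme \<Rightarrow> nat \<Rightarrow> nat \<Rightarrow> 'g gmat \<Rightarrow>\<^sub>0 'f::field" where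
  "u_elem G n k =
     (\<Sum>i = k+1..n.
        conv G (conv G (conv G (t_elem G n k i) (basis (perm_gmat G n (transpose k i))))
          (basis (one_gmat G n) - basis (eps_gmat G n k)))
          (basis (one_gmat G n) - basis (eps_gmat G n i)))"


section \<open>The algebra of stable sequences\<close>

text \<open>
  A sequence $(\alpha_n)_{n \ge m}$ is a function that is \<^const>\<open>undefined\<close> below $m$.
\<close>

definition Zbar_lim :: "('g, 'x) monoid_scheme \<Rightarrow> nat \<Rightarrow> ('f::field, nat \<Rightarrow> 'g gmat \<Rightarrow>\<^sub>0 'f) module" where
  "Zbar_lim G m =
     \<lparr>carrier = {\<alpha> \<in> (\<Pi>\<^sub>E n \<in> {m..}. carrier (Zbar G m n)).
        (\<forall>n > m. theta n (\<alpha> n) = \<alpha> (n - 1)) \<and> bdd_above ((\<lambda>n. alg_deg G n (\<alpha> n)) ` {m..})},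
      mult = (\<lambda>\<alpha> \<beta>. \<lambda>n \<in> {m..}. \<alpha> n \<otimes>\<^bsub>Zbar G m n\<^esub> \<beta> n),
      one = (\<lambda>n \<in> {m..}. \<one>\<^bsub>Zbar G m n\<^esub>),
      zero = (\<lambda>n \<in> {m..}. \<zero>\<^bsub>Zbar G m n\<^esub>),
      add = (\<lambda>\<alpha> \<beta>. \<lambda>n \<in> {m..}. \<alpha> n \<oplus>\<^bsub>Zbar G m n\<^esub> \<beta> n),
      smult = (\<lambda>c \<alpha>. \<lambda>n \<in> {m..}. c \<odot>\<^bsub>Zbar G m n\<^esub> \<alpha> n)\<rparr>"

definition const_seq :: "('g, 'x) monoid_scheme \<Rightarrow> nat \<Rightarrow> ('g gmat \<Rightarrow>\<^sub>0 'f::field) \<Rightarrow> nat \<Rightarrow> 'g gmat \<Rightarrow>\<^sub>0 'f" where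
  "const_seq G m \<alpha> = (\<lambda>n \<in> {m..}. lin_ext (embed_gmat G m n) \<alpha>)"

definition u_seq :: "('g, 'x) monoid_scheme \<Rightarrow> nat \<Rightarrow> nat \<Rightarrow> nat \<Rightarrow> 'g gmat \<Rightarrow>\<^sub>0 'f::field" where
  "u_seq G m k = (\<lambda>n \<in> {m..}. u_elem G n k)"

definition Hbar :: "('g, 'x) monoid_scheme \<Rightarrow> nat \<Rightarrow> ('f::field, nat \<Rightarrow> 'g gmat \<Rightarrow>\<^sub>0 'f) module" where
  "Hbar G m = Zbar_lim G m\<lparr>carrier :=
     alg_generated (Zbar_lim G m) (const_seq G m ` carrier (FGbar G m) \<union> u_seq G m ` {1..m})\<rparr>"

definition Psi_assignment ::
  "('g, 'x) monoid_scheme \<Rightarrow> nat \<Rightarrow> nat \<Rightarrow> ((nat \<Rightarrow> 'g gmat \<Rightarrow>\<^sub>0 'f::field) \<Rightarrow> 'g gmat \<Rightarrow>\<^sub>0 'f) \<Rightarrow> bool" where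
  "Psi_assignment G m n \<Psi> \<longleftrightarrow>
     (\<forall>g \<in> {1..m} \<rightarrow> carrier G.
        \<Psi> (const_seq G m (basis (diag_gmat m g))) = basis (embed_gmat G m n (diag_gmat m g))) \<and>
     (\<forall>l \<in> {1..<m}.
        \<Psi> (const_seq G m (basis (perm_gmat G m (transpose l (l + 1))))) =
          basis (embed_gmat G m n (perm_gmat G m (transpose l (l + 1))))) \<and>
     (\<forall>k \<in> {1..m}.
        \<Psi> (const_seq G m (basis (eps_gmat G m k))) = basis (embed_gmat G m n (eps_gmat G m k))) \<and>
     (\<forall>k \<in> {1..m}. \<Psi> (u_seq G m k) = u_elem G n k)"

end

theory Submission
  imports Defs
begin

text \<open>
  Evaluation at \<open>n\<close> is multiplicative, so it is the required homomorphism as soon as the generators of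
  \<open>Hbar G m\<close> are sent to \<open>Zbar G m n\<close>; stability and bounded degree play no role.

  For the generation statement, \<open>hat \<alpha> \<gamma>\<close>, the sum of the coefficients of \<open>\<alpha>\<close> at all matrices
  extending \<open>\<gamma>\<close>, is the coordinate of \<open>\<alpha>\<close> at \<open>\<gamma>\<close> in the groupoid basis of the algebra of the inverse
  semigroup. In these coordinates the elements of \<open>Zbar G m n\<close> are functions that are invariant under
  conjugation and vanish unless the nonzero rows and columns of \<open>\<gamma>\<close> beyond \<open>m\<close> have the same indices.
  Indicators of orbits are generated, modulo terms with fewer moved indices beyond \<open>m\<close>, by induction on
  the number of these: if \<open>\<gamma>\<close> maps no index beyond \<open>m\<close> into \<open>{1..m}\<close>, then it is block diagonal and its
  orbit sum is a product of an element of \<open>FGbar G m\<close> and a central element of \<open>FGbar' G m n\<close>;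
  otherwise it arises from a \<open>\<gamma>'\<close> with one more fixed index by multiplication with some \<open>u_l\<close>.
\<close>

section \<open>Monomial matrices as an inverse semigroup\<close>

text \<open>Groupoid coordinates provide them. Multiplication by a matrix becomes a translation of
  coordinates, cut off where supports do not fit, and each factor 1 - \<epsilon>_i of u_k becomes
  the restriction to matrices with a nonzero row i. If X has the indicator of an orbit as
  coordinates, the coordinate of u_l X at \<tau> therefore counts the pairs (i, h) for which
  exchanging rows l and i with label h carries \<tau> into that orbit. When \<tau> has at least one
  moved index more than the orbit, the exchange must turn i into a fixed point beyond m. This forces
  h to be the entry of \<tau> in row l and column i, so at most one pair is left and the count is 0
  or 1. For smaller \<tau> several pairs may contribute, among them pairs with i at most m. The
  count is not controlled there, which is why orbit sums are only reached up to terms with fewer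
  moved indices.\<close>

definition ent :: "'g gmat \<Rightarrow> nat \<Rightarrow> nat \<Rightarrow> 'g \<Rightarrow> bool" where
  "ent \<gamma> i j x \<longleftrightarrow> \<gamma> i j = Some x"

text \<open>The natural partial order of the inverse semigroup: \<delta> extends \<gamma>.\<close>

definition sub :: "'g gmat \<Rightarrow> 'g gmat \<Rightarrow> bool" where
  "sub \<gamma> \<delta> \<longleftrightarrow> (\<forall>i j x. ent \<gamma> i j x \<longrightarrow> ent \<delta> i j x)"

text \<open>A matrix is read as a partial injection from column indices to row indices that carries
  labels in G; columns form its domain and rows its range.\<close>

definition dm :: "'g gmat \<Rightarrow> nat set" where
  "dm \<gamma> = {j. \<exists>i x. ent \<gamma> i j x}"

definition rn :: "'g gmat \<Rightarrow> nat set" where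
  "rn \<gamma> = {i. \<exists>j x. ent \<gamma> i j x}"

lemma ent_fun: "ent \<gamma> i j x \<Longrightarrow> ent \<gamma> i j y \<Longrightarrow> x = y"
  by (simp add: ent_def)

lemma gmat_eqI:
  assumes "\<And>i j x. ent \<gamma> i j x \<longleftrightarrow> ent \<delta> i j x"
  shows "\<gamma> = \<delta>"
proof (intro ext)
  fix i j
  show "\<gamma> i j = \<delta> i j"
    using assms[of i j] unfolding ent_def by (metis option.exhaust)
qed

lemma sub_refl [simp]: "sub \<gamma> \<gamma>"
  by (simp add: sub_def)

lemma dmI: "ent \<gamma> i j x \<Longrightarrow> j \<in> dm \<gamma>"
  unfolding dm_def by blast

lemma rnI: "ent \<gamma> i j x \<Longrightarrow> i \<in> rn \<gamma>"
  unfolding rn_def by blast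

lemma dmE: "j \<in> dm \<gamma> \<Longrightarrow> (\<And>i x. ent \<gamma> i j x \<Longrightarrow> P) \<Longrightarrow> P"
  unfolding dm_def by blast

lemma rnE: "i \<in> rn \<gamma> \<Longrightarrow> (\<And>j x. ent \<gamma> i j x \<Longrightarrow> P) \<Longrightarrow> P"
  unfolding rn_def by blast

lemma GbarI:
  assumes "\<And>i j x. ent \<gamma> i j x \<Longrightarrow> i \<in> {1..n} \<and> j \<in> {1..n} \<and> x \<in> carrier G"
    and "\<And>i j k x y. ent \<gamma> i j x \<Longrightarrow> ent \<gamma> i k y \<Longrightarrow> j = k"
    and "\<And>i j k x y. ent \<gamma> i k x \<Longrightarrow> ent \<gamma> j k y \<Longrightarrow> i = j"
  shows "\<gamma> \<in> Gbar G n"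
  unfolding Gbar_def mem_Collect_eq
proof (intro conjI allI impI)
  fix i j assume "\<gamma> i j \<noteq> None"
  then obtain x where "\<gamma> i j = Some x" by auto
  thus "i \<in> {1..n}" "j \<in> {1..n}" "the (\<gamma> i j) \<in> carrier G"
    using assms(1)[of i j x] by (auto simp: ent_def)
next
  fix i j k assume "\<gamma> i j \<noteq> None \<and> \<gamma> i k \<noteq> None"
  then obtain x y where "ent \<gamma> i j x" "ent \<gamma> i k y" unfolding ent_def by blast
  thus "j = k" by (rule assms(2))
next
  fix i j k assume "\<gamma> i k \<noteq> None \<and> \<gamma> j k \<noteq> None"
  then obtain x y where "ent \<gamma> i k x" "ent \<gamma> j k y" unfolding ent_def by blast
  thus "i = j" by (rule assms(3))
qed

lemma Gbar_row:
  assumes "\<gamma> \<in> Gbar G n" "ent \<gamma> i j x" "ent \<gamma> i k y"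
  shows "j = k"
proof -
  have "\<forall>i j k. \<gamma> i j \<noteq> None \<and> \<gamma> i k \<noteq> None \<longrightarrow> j = k"
    using assms(1) unfolding Gbar_def mem_Collect_eq by (elim conjE)
  from this[rule_format, of i j k] show ?thesis using assms(2,3) by (simp add: ent_def)
qed

lemma Gbar_col:
  assumes "\<gamma> \<in> Gbar G n" "ent \<gamma> i k x" "ent \<gamma> j k y"
  shows "i = j"
proof -
  have "\<forall>i j k. \<gamma> i k \<noteq> None \<and> \<gamma> j k \<noteq> None \<longrightarrow> i = j"
    using assms(1) unfolding Gbar_def mem_Collect_eq by (elim conjE)
  from this[rule_format, of i k j] show ?thesis using assms(2,3) by (simp add: ent_def)
qed

lemma Gbar_entry:
  assumes "\<gamma> \<in> Gbar G n" "ent \<gamma> i j x"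
  shows "i \<in> {1..n}" "j \<in> {1..n}" "x \<in> carrier G"
proof -
  have "\<forall>i j. \<gamma> i j \<noteq> None \<longrightarrow> i \<in> {1..n} \<and> j \<in> {1..n} \<and> the (\<gamma> i j) \<in> carrier G"
    using assms(1) unfolding Gbar_def mem_Collect_eq by (elim conjE)
  from this[rule_format, of i j] show "i \<in> {1..n}" "j \<in> {1..n}" "x \<in> carrier G"
    using assms(2) by (auto simp: ent_def)
qed

lemma dm_Gbar: "\<gamma> \<in> Gbar G n \<Longrightarrow> dm \<gamma> \<subseteq> {1..n}"
  by (rule subsetI, erule dmE, rule Gbar_entry(2))

lemma rn_Gbar: "\<gamma> \<in> Gbar G n \<Longrightarrow> rn \<gamma> \<subseteq> {1..n}"
  by (rule subsetI, erule rnE, rule Gbar_entry(1))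

lemma Gbar_mono:
  assumes "m \<le> n"
  shows "Gbar G m \<subseteq> Gbar G n"
proof
  fix \<gamma> assume g: "\<gamma> \<in> Gbar G m"
  show "\<gamma> \<in> Gbar G n"
  proof (rule GbarI)
    fix i j x assume "ent \<gamma> i j x"
    from Gbar_entry[OF g this] show "i \<in> {1..n} \<and> j \<in> {1..n} \<and> x \<in> carrier G"
      using assms by simp
  qed (use Gbar_row[OF g] Gbar_col[OF g] in blast)+
qed

lemma finite_Gbar:
  assumes "finite (carrier G)"
  shows "finite (Gbar G n)"
proof -
  define K where "K = {f :: nat \<times> nat \<Rightarrow> 'a option. \<forall>p. (p \<in> {1..n} \<times> {1..n} \<longrightarrow> f p \<in> insert None
      (Some ` carrier G)) \<and> (p \<notin> {1..n} \<times> {1..n} \<longrightarrow> f p = None)}"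
  have "finite K"
    unfolding K_def by (rule finite_set_of_finite_funs) (use assms in auto)
  moreover have "Gbar G n \<subseteq> curry ` K"
  proof
    fix \<gamma> assume g: "\<gamma> \<in> Gbar G n"
    have "\<gamma> i j \<in> insert None (Some ` carrier G)" for i j
      using Gbar_entry(3)[OF g, of i j] by (cases "\<gamma> i j") (auto simp: ent_def)
    moreover have "\<gamma> i j = None" if "(i, j) \<notin> {1..n} \<times> {1..n}" for i j
      using Gbar_entry(1,2)[OF g, of i j] that by (cases "\<gamma> i j") (auto simp: ent_def)
    ultimately have "case_prod \<gamma> \<in> K"
      unfolding K_def by auto
    thus "\<gamma> \<in> curry ` K"
      by (intro image_eqI[of _ _ "case_prod \<gamma>"]) auto
  qed
  ultimately show ?thesis
    by (meson finite_imageI finite_subset)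
qed

text \<open>Row \<open>i\<close> of \<gamma> has at most one nonzero entry, so at most one summand
  of \<open>entry_sum\<close> differs from \<open>None\<close> and the definite description in it
  has a value. Products thereby become compositions of labelled relations.\<close>

lemma ent_gmat_mult:
  assumes "\<gamma> \<in> Gbar G n"
  shows "ent (gmat_mult G \<gamma> \<delta>) i j x \<longleftrightarrow>
    (\<exists>k g h. ent \<gamma> i k g \<and> ent \<delta> k j h \<and> x = g \<otimes>\<^bsub>G\<^esub> h)"
proof -
  let ?f = "\<lambda>k. entry_mult G (\<gamma> i k) (\<delta> k j)"
  have f: "?f k = Some y \<longleftrightarrow> (\<exists>g h. ent \<gamma> i k g \<and> ent \<delta> k j h \<and> y = g \<otimes>\<^bsub>G\<^esub> h)" for k y
    unfolding ent_def by (cases "\<gamma> i k"; cases "\<delta> k j") auto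
  show ?thesis
  proof (cases "\<exists>k. ?f k \<noteq> None")
    case True
    then obtain k where k: "?f k \<noteq> None" by blast
    have u: "k' = k" if "?f k' \<noteq> None" for k'
      using that k f Gbar_row[OF assms] by (metis not_None_eq)
    have "(THE k. ?f k \<noteq> None) = k"
      using k u by blast
    hence e: "gmat_mult G \<gamma> \<delta> i j = ?f k"
      using True by (simp add: gmat_mult_def entry_sum_def)
    show ?thesis
      unfolding ent_def[of "gmat_mult G \<gamma> \<delta>"] e using f u by (metis option.distinct(1))
  next
    case False
    hence "gmat_mult G \<gamma> \<delta> i j = None"
      by (simp add: gmat_mult_def entry_sum_def)
    thus ?thesis
      unfolding ent_def[of "gmat_mult G \<gamma> \<delta>"] using f False by (metis option.distinct(1))
  qed
qed

section \<open>Composition, inverses and idempotents of labelled partial bijections\<close>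

locale monomial = group G for G :: "('g, 'x) monoid_scheme" (structure) +
  fixes n :: nat
  assumes finite_G: "finite (carrier G)"
begin

abbreviation mm (infixl "\<cdot>" 70) where "a \<cdot> b \<equiv> gmat_mult G a b"

abbreviation Mon where "Mon \<equiv> Gbar G n"

definition star :: "'g gmat \<Rightarrow> 'g gmat" where
  "star \<gamma> = (\<lambda>i j. map_option (m_inv G) (\<gamma> j i))"

text \<open>These are the idempotents of the semigroup; the identity and all \<epsilon>_k are
  instances.\<close>

definition idm :: "nat set \<Rightarrow> 'g gmat" where
  "idm S = (\<lambda>i j. if i = j \<and> i \<in> S then Some \<one> else None)"

lemmas ent_mult = ent_gmat_mult[of _ G n]

lemma ent_multI:
  "a \<in> Mon \<Longrightarrow> ent a i k g \<Longrightarrow> ent b k j h \<Longrightarrow> x = g \<otimes> h \<Longrightarrow> ent (a \<cdot> b) i j x"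
  by (auto simp: ent_mult)

lemma ent_multE:
  assumes "ent (a \<cdot> b) i j x" "a \<in> Mon"
  obtains k g h where "ent a i k g" "ent b k j h" "x = g \<otimes> h"
  using assms by (auto simp: ent_mult)

lemma ent_star: "ent (star \<gamma>) i j x \<longleftrightarrow> (\<exists>y. ent \<gamma> j i y \<and> x = inv y)"
  by (auto simp: star_def ent_def)

lemma ent_starI: "ent \<gamma> j i y \<Longrightarrow> x = inv y \<Longrightarrow> ent (star \<gamma>) i j x"
  by (auto simp: ent_star)

lemma ent_idm: "ent (idm S) i j x \<longleftrightarrow> i = j \<and> i \<in> S \<and> x = \<one>"
  by (auto simp: idm_def ent_def)

lemma mult_closed [simp, intro]:
  assumes "a \<in> Mon" "b \<in> Mon"
  shows "a \<cdot> b \<in> Mon"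
proof (rule GbarI)
  fix i j k x y
  assume x: "ent (a \<cdot> b) i j x"
  show "i \<in> {1..n} \<and> j \<in> {1..n} \<and> x \<in> carrier G"
    using x assms by (elim ent_multE) (auto dest: Gbar_entry)
  show "j = k" if "ent (a \<cdot> b) i k y"
    using x that assms by (elim ent_multE) (metis Gbar_row)+
next
  fix i j k x y
  assume "ent (a \<cdot> b) i k x" "ent (a \<cdot> b) j k y"
  thus "i = j"
    using assms by (elim ent_multE) (metis Gbar_col)+
qed

lemma star_closed [simp, intro]: "a \<in> Mon \<Longrightarrow> star a \<in> Mon"
  by (rule GbarI) (auto simp: ent_star dest: Gbar_entry Gbar_row Gbar_col)

lemma idm_closed [simp, intro]: "S \<subseteq> {1..n} \<Longrightarrow> idm S \<in> Mon"
  by (rule GbarI) (auto simp: ent_idm)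

lemma mult_assoc:
  assumes "a \<in> Mon" "b \<in> Mon" "c \<in> Mon"
  shows "a \<cdot> b \<cdot> c = a \<cdot> (b \<cdot> c)"
proof (rule gmat_eqI)
  fix i j x
  note ab = mult_closed[OF assms(1,2)]
  show "ent (a \<cdot> b \<cdot> c) i j x \<longleftrightarrow> ent (a \<cdot> (b \<cdot> c)) i j x"
  proof
    assume "ent (a \<cdot> b \<cdot> c) i j x"
    then obtain k l p q r where *: "ent a i k p" "ent b k l q" "ent c l j r" "x = p \<otimes> q \<otimes> r"
      using assms ab by (elim ent_multE) blast+
    hence "x = p \<otimes> (q \<otimes> r)"
      using assms by (simp add: Gbar_entry(3) m_assoc)
    thus "ent (a \<cdot> (b \<cdot> c)) i j x"
      using * assms by (blast intro: ent_multI)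
  next
    assume "ent (a \<cdot> (b \<cdot> c)) i j x"
    then obtain k l p q r where *: "ent a i k p" "ent b k l q" "ent c l j r" "x = p \<otimes> (q \<otimes> r)"
      using assms by (elim ent_multE) blast+
    hence "x = p \<otimes> q \<otimes> r"
      using assms by (simp add: Gbar_entry(3) m_assoc)
    thus "ent (a \<cdot> b \<cdot> c) i j x"
      using * assms ab by (blast intro: ent_multI)
  qed
qed

lemma star_star [simp]: "a \<in> Mon \<Longrightarrow> star (star a) = a"
  by (rule gmat_eqI) (auto simp: ent_star Gbar_entry(3))

lemma star_mult:
  assumes "a \<in> Mon" "b \<in> Mon"
  shows "star (a \<cdot> b) = star b \<cdot> star a"
proof (rule gmat_eqI)
  fix i j x
  note sb = star_closed[OF assms(2)]
  show "ent (star (a \<cdot> b)) i j x \<longleftrightarrow> ent (star b \<cdot> star a) i j x"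
  proof
    assume "ent (star (a \<cdot> b)) i j x"
    then obtain k y z where *: "ent a j k y" "ent b k i z" "x = inv (y \<otimes> z)"
      using assms by (auto simp: ent_mult ent_star)
    hence "x = inv z \<otimes> inv y"
      using assms by (simp add: Gbar_entry(3) inv_mult_group)
    thus "ent (star b \<cdot> star a) i j x"
      using * sb by (blast intro: ent_multI ent_starI)
  next
    assume "ent (star b \<cdot> star a) i j x"
    then obtain k y z where *: "ent a j k y" "ent b k i z" "x = inv z \<otimes> inv y"
      using sb by (auto simp: ent_mult ent_star)
    hence "x = inv (y \<otimes> z)"
      using assms by (simp add: Gbar_entry(3) inv_mult_group)
    thus "ent (star (a \<cdot> b)) i j x"
      using * assms by (blast intro: ent_multI ent_starI)
  qed
qed

lemma dm_star [simp]: "dm (star a) = rn a"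
  by (auto simp: dm_def rn_def ent_star)

lemma rn_star [simp]: "rn (star a) = dm a"
  by (auto simp: dm_def rn_def ent_star)

lemma dm_idm [simp]: "dm (idm S) = S" and rn_idm [simp]: "rn (idm S) = S"
  by (auto simp: dm_def rn_def ent_idm)

lemma star_idm [simp]: "star (idm S) = idm S"
  by (rule gmat_eqI) (auto simp: ent_star ent_idm)

lemma mult_star:
  assumes "a \<in> Mon"
  shows "a \<cdot> star a = idm (rn a)"
proof (rule gmat_eqI)
  fix i j x
  show "ent (a \<cdot> star a) i j x \<longleftrightarrow> ent (idm (rn a)) i j x"
  proof
    assume "ent (a \<cdot> star a) i j x"
    then obtain k g h where *: "ent a i k g" "ent a j k h" "x = g \<otimes> inv h"
      using assms by (auto simp: ent_mult ent_star)
    moreover from * have "i = j" using Gbar_col assms by metis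
    moreover from * this have "g = h" using ent_fun by metis
    ultimately show "ent (idm (rn a)) i j x"
      using assms by (auto simp: ent_idm dest: Gbar_entry(3) intro: rnI)
  next
    assume "ent (idm (rn a)) i j x"
    then obtain k g where *: "ent a i k g" "i = j" "x = \<one>"
      by (auto simp: ent_idm elim: rnE)
    hence "x = g \<otimes> inv g" using assms by (auto dest: Gbar_entry(3))
    thus "ent (a \<cdot> star a) i j x"
      using * assms by (blast intro: ent_multI ent_starI)
  qed
qed

lemma star_mult_self: "a \<in> Mon \<Longrightarrow> star a \<cdot> a = idm (dm a)"
  using mult_star[of "star a"] by simp

lemma ent_idm_mult: "S \<subseteq> {1..n} \<Longrightarrow> a \<in> Mon \<Longrightarrow> ent (idm S \<cdot> a) i j x \<longleftrightarrow> i \<in> S \<and> ent a i j x"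
  by (auto simp: ent_mult ent_idm Gbar_entry(3))

lemma ent_mult_idm: "a \<in> Mon \<Longrightarrow> ent (a \<cdot> idm S) i j x \<longleftrightarrow> j \<in> S \<and> ent a i j x"
  by (auto simp: ent_mult ent_idm Gbar_entry(3))

lemma idm_mult: "S \<subseteq> {1..n} \<Longrightarrow> a \<in> Mon \<Longrightarrow> rn a \<subseteq> S \<Longrightarrow> idm S \<cdot> a = a"
  by (rule gmat_eqI) (auto simp: ent_idm_mult rn_def)

lemma mult_idm: "a \<in> Mon \<Longrightarrow> dm a \<subseteq> S \<Longrightarrow> a \<cdot> idm S = a"
  by (rule gmat_eqI) (auto simp: ent_mult_idm dm_def)

lemma idm_full_mult [simp]: "a \<in> Mon \<Longrightarrow> idm {Suc 0..n} \<cdot> a = a"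
  using rn_Gbar[of a G n] by (intro idm_mult) auto

lemma mult_idm_full [simp]: "a \<in> Mon \<Longrightarrow> a \<cdot> idm {Suc 0..n} = a"
  using dm_Gbar[of a G n] by (intro mult_idm) auto

lemma one_gmat_idm: "one_gmat G n = idm {1..n}"
  by (auto simp: one_gmat_def diag_gmat_def idm_def)

lemma eps_gmat_idm: "eps_gmat G n k = idm ({1..n} - {k})"
  by (auto simp: eps_gmat_def idm_def fun_eq_iff)

lemma dm_mult: "a \<in> Mon \<Longrightarrow> dm (a \<cdot> b) \<subseteq> dm b"
  by (auto simp: dm_def ent_mult)

lemma rn_mult: "a \<in> Mon \<Longrightarrow> rn (a \<cdot> b) \<subseteq> rn a"
  by (auto simp: rn_def ent_mult)

lemma dm_mult_eq: "a \<in> Mon \<Longrightarrow> rn b \<subseteq> dm a \<Longrightarrow> dm (a \<cdot> b) = dm b"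
  by (intro equalityI dm_mult subsetI) (blast intro: dmI rnI ent_multI elim!: dmE)+

text \<open>\<open>star a \<cdot> a\<close> is idempotent, so \<tau> below
  \<open>a \<cdot> \<delta>\<close> gives \<open>star a \<cdot> \<tau>\<close> below \<delta>.
  Conversely \<open>a \<cdot> star a\<close> is the identity on the rows in \<open>rn a\<close>,
  hence fixes \<tau>. This adjunction is what turns multiplication into translation of
  coordinates.\<close>

lemma sub_mult_left:
  assumes "a \<in> Mon" "\<delta> \<in> Mon" "\<tau> \<in> Mon"
  shows "sub \<tau> (a \<cdot> \<delta>) \<longleftrightarrow> rn \<tau> \<subseteq> rn a \<and> sub (star a \<cdot> \<tau>) \<delta>"
proof (intro iffI conjI; (elim conjE)?)
  note sa = star_closed[OF assms(1)]
  assume s: "sub \<tau> (a \<cdot> \<delta>)"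
  show "rn \<tau> \<subseteq> rn a"
    using s assms(1) unfolding sub_def by (blast elim!: rnE elim: ent_multE intro: rnI)
  show "sub (star a \<cdot> \<tau>) \<delta>"
    unfolding sub_def
  proof (intro allI impI)
    fix i j x
    assume "ent (star a \<cdot> \<tau>) i j x"
    then obtain k y z where 1: "ent a k i y" "ent \<tau> k j z" "x = inv y \<otimes> z"
      using sa by (auto simp: ent_mult ent_star)
    then obtain i' y' z' where 2: "ent a k i' y'" "ent \<delta> i' j z'" "z = y' \<otimes> z'"
      using s assms(1) unfolding sub_def by (blast elim: ent_multE)
    have "i' = i" using Gbar_row[OF assms(1) 2(1) 1(1)] .
    moreover from this have "y' = y" using 1 2 ent_fun by metis
    moreover have "y \<in> carrier G" "z' \<in> carrier G"
      using 1 2 assms by (auto dest: Gbar_entry(3))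
    ultimately show "ent \<delta> i j x" using 1 2 by (simp add: m_assoc[symmetric])
  qed
next
  note sa = star_closed[OF assms(1)]
  assume r: "rn \<tau> \<subseteq> rn a" and s: "sub (star a \<cdot> \<tau>) \<delta>"
  show "sub \<tau> (a \<cdot> \<delta>)"
    unfolding sub_def
  proof (intro allI impI)
    fix i j x
    assume t: "ent \<tau> i j x"
    then obtain k y where a: "ent a i k y" using r by (blast intro: rnI elim: rnE)
    have "ent (star a \<cdot> \<tau>) k j (inv y \<otimes> x)"
      using a sa t by (blast intro: ent_multI ent_starI)
    hence d: "ent \<delta> k j (inv y \<otimes> x)" using s unfolding sub_def by blast
    have "x = y \<otimes> (inv y \<otimes> x)"
      using Gbar_entry(3)[OF assms(1) a] Gbar_entry(3)[OF assms(3) t] by (simp add: m_assoc[symmetric])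
    thus "ent (a \<cdot> \<delta>) i j x"
      using a d assms(1) by (blast intro: ent_multI)
  qed
qed

lemma sub_star:
  assumes "a \<in> Mon" "b \<in> Mon"
  shows "sub (star a) (star b) \<longleftrightarrow> sub a b"
proof -
  have *: "sub (star c) (star d)" if "sub c d" for c d
    using that by (auto simp: sub_def ent_star)
  show ?thesis
    using *[of a b] *[of "star a" "star b"] assms by auto
qed

lemma sub_mult_right:
  assumes "a \<in> Mon" "\<delta> \<in> Mon" "\<tau> \<in> Mon"
  shows "sub \<tau> (\<delta> \<cdot> a) \<longleftrightarrow> dm \<tau> \<subseteq> dm a \<and> sub (\<tau> \<cdot> star a) \<delta>"
proof -
  have "sub \<tau> (\<delta> \<cdot> a) \<longleftrightarrow> sub (star \<tau>) (star a \<cdot> star \<delta>)"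
    using assms by (simp add: sub_star flip: star_mult)
  also have "\<dots> \<longleftrightarrow> dm \<tau> \<subseteq> dm a \<and> sub (star (\<tau> \<cdot> star a)) (star \<delta>)"
    using assms by (simp add: sub_mult_left star_mult)
  finally show ?thesis
    using assms by (simp add: sub_star)
qed

end

section \<open>The semigroup algebra and its coordinates\<close>

text \<open>For a bijection that is easier to give as a relation than by a formula in each
  direction.\<close>

lemma card_eq_of_relation:
  assumes "\<And>a. a \<in> A \<Longrightarrow> \<exists>b \<in> B. R a b" "\<And>b. b \<in> B \<Longrightarrow> \<exists>a \<in> A. R a b"
    and "\<And>a b b'. R a b \<Longrightarrow> R a b' \<Longrightarrow> b = b'" "\<And>a a' b. R a b \<Longrightarrow> R a' b \<Longrightarrow> a = a'"
  shows "card A = card B"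
proof -
  obtain f where f: "\<And>a. a \<in> A \<Longrightarrow> f a \<in> B \<and> R a (f a)"
    using assms(1) by metis
  have "bij_betw f A B"
  proof (rule bij_betwI')
    show "f x = f y \<longleftrightarrow> x = y" if "x \<in> A" "y \<in> A" for x y
      using f[OF that(1)] f[OF that(2)] assms(4) by metis
    show "f x \<in> B" if "x \<in> A" for x using f[OF that] by simp
    show "\<exists>x\<in>A. y = f x" if "y \<in> B" for y
      using assms(2)[OF that] f assms(3) by metis
  qed
  thus ?thesis by (rule bij_betw_same_card)
qed

lemma sum_sum_indicator:
  assumes "finite I" "finite H"
  shows "(\<Sum>i\<in>I. \<Sum>h\<in>H. if P i h then 1 else 0 :: 'f::semiring_1) = of_nat (card {p \<in> I \<times> H. P (fst
      p) (snd p)})"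
proof -
  have "(\<Sum>i\<in>I. \<Sum>h\<in>H. if P i h then 1 else 0 :: 'f) = (\<Sum>p \<in> I \<times> H. if P (fst p) (snd p) then 1 else 0)"
    by (simp add: sum.cartesian_product case_prod_beta)
  also have "\<dots> = (\<Sum>p \<in> {p \<in> I \<times> H. P (fst p) (snd p)}. 1)"
    using assms by (intro sum.inter_filter[symmetric]) auto
  finally show ?thesis by simp
qed

lemma lookup_map_times [simp]:
  "Poly_Mapping.lookup (Poly_Mapping.map ((*) c) \<alpha>) \<gamma> = c * Poly_Mapping.lookup (\<alpha> :: 'a \<Rightarrow>\<^sub>0
      'f::field) \<gamma>"
  by (simp add: map.rep_eq when_def)

lemma map_times_single: "Poly_Mapping.map ((*) c) (Poly_Mapping.single \<gamma> d) = Poly_Mapping.single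
    \<gamma> (c * d :: 'f::field)"
  by (rule poly_mapping_eqI) (simp add: lookup_single when_def)

lemma map_times_add: "Poly_Mapping.map ((*) c) (\<alpha> + \<beta>) = Poly_Mapping.map ((*) c) \<alpha> +
    Poly_Mapping.map ((*) (c :: 'f::field)) \<beta>"
  by (rule poly_mapping_eqI) (simp add: lookup_add algebra_simps)

lemma map_times_zero [simp]: "Poly_Mapping.map ((*) (c :: 'f::field)) 0 = 0"
  by (rule poly_mapping_eqI) simp

lemma map_zero_times [simp]: "Poly_Mapping.map ((*) (0 :: 'f::field)) \<alpha> = 0"
  by (rule poly_mapping_eqI) simp

lemma keys_map_times: "Poly_Mapping.keys (Poly_Mapping.map ((*) (c :: 'f::field)) \<alpha>) \<subseteq>
    Poly_Mapping.keys \<alpha>"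
  by (auto simp: in_keys_iff)

text \<open>Peeling off one key at a time reduces linear identities to single basis elements, which
  are known to lie in \<open>X\<close>.\<close>

lemma keys_subset_induct [consumes 1, case_names zero add]:
  fixes \<alpha> :: "'a \<Rightarrow>\<^sub>0 'f::field"
  assumes "Poly_Mapping.keys \<alpha> \<subseteq> X"
    and "P 0"
    and "\<And>\<gamma> c \<alpha>. \<gamma> \<in> X \<Longrightarrow> Poly_Mapping.keys \<alpha> \<subseteq> X \<Longrightarrow> P \<alpha> \<Longrightarrow> P (Poly_Mapping.single \<gamma> c + \<alpha>)"
  shows "P \<alpha>"
proof -
  have "finite (Poly_Mapping.keys \<alpha>)" by simp
  thus ?thesis
    using assms(1)
  proof (induction "Poly_Mapping.keys \<alpha>" arbitrary: \<alpha> rule: finite_psubset_induct)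
    case psubset
    show ?case
    proof (cases "\<alpha> = 0")
      case False
      then obtain \<gamma> where g: "\<gamma> \<in> Poly_Mapping.keys \<alpha>" by (auto simp flip: keys_eq_empty)
      define \<beta> where "\<beta> = \<alpha> - Poly_Mapping.single \<gamma> (Poly_Mapping.lookup \<alpha> \<gamma>)"
      have "Poly_Mapping.keys \<beta> = Poly_Mapping.keys \<alpha> - {\<gamma>}"
        by (auto simp: \<beta>_def in_keys_iff lookup_minus lookup_single when_def split: if_splits)
      moreover from this have "P \<beta>"
        using psubset g by (intro psubset(2)) auto
      ultimately have "P (Poly_Mapping.single \<gamma> (Poly_Mapping.lookup \<alpha> \<gamma>) + \<beta>)"
        using psubset g by (intro assms(3)) auto
      thus ?thesis by (simp add: \<beta>_def)
    qed (simp add: assms(2))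
  qed
qed

lemmas poly_mapping_single_induct = keys_subset_induct[where X = UNIV, OF subset_UNIV, case_names
    zero add]

text \<open>
  The coordinates of an element in the Moebius basis of the semigroup algebra, in which the algebra
  becomes the algebra of the groupoid of partial \<open>G\<close>-bijections of \<open>{1..n}\<close>.
\<close>

definition hat :: "('g gmat \<Rightarrow>\<^sub>0 'f::field) \<Rightarrow> 'g gmat \<Rightarrow> 'f" where
  "hat \<alpha> \<gamma> = (\<Sum>\<delta> \<in> Poly_Mapping.keys \<alpha>. if sub \<gamma> \<delta> then Poly_Mapping.lookup \<alpha> \<delta> else 0)"

lemma sum_keys_superset:
  assumes "finite K" "Poly_Mapping.keys \<alpha> \<subseteq> K" "\<And>\<delta>. f \<delta> 0 = 0"
  shows "(\<Sum>\<delta> \<in> Poly_Mapping.keys \<alpha>. f \<delta> (Poly_Mapping.lookup \<alpha> \<delta>)) = (\<Sum>\<delta> \<in> K. f \<delta>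
      (Poly_Mapping.lookup \<alpha> \<delta>))"
  by (rule sum.mono_neutral_left) (use assms in \<open>auto simp: in_keys_iff\<close>)

text \<open>Cancellation can make the keys of a sum smaller than the union of the keys, but summing
  over the whole union only adds terms \<open>f \<delta> 0 = 0\<close>. \<open>hat\<close>,
  \<open>conv\<close> and \<open>lin_ext\<close> all have this shape.\<close>

lemma sum_keys_add:
  assumes "\<And>\<delta>. f \<delta> 0 = 0" "\<And>\<delta> a b. f \<delta> (a + b) = f \<delta> a + f \<delta> b"
  shows "(\<Sum>\<delta> \<in> Poly_Mapping.keys (\<alpha> + \<beta>). f \<delta> (Poly_Mapping.lookup (\<alpha> + \<beta>) \<delta>)) =
    (\<Sum>\<delta> \<in> Poly_Mapping.keys \<alpha>. f \<delta> (Poly_Mapping.lookup \<alpha> \<delta>)) +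
    (\<Sum>\<delta> \<in> Poly_Mapping.keys \<beta>. f \<delta> (Poly_Mapping.lookup \<beta> \<delta>))"
proof -
  let ?K = "Poly_Mapping.keys \<alpha> \<union> Poly_Mapping.keys \<beta>"
  have "Poly_Mapping.keys (\<alpha> + \<beta>) \<subseteq> ?K" by (rule Poly_Mapping.keys_add)
  thus ?thesis
    by (subst (1 2 3) sum_keys_superset[where K = ?K]) (auto simp: assms lookup_add sum.distrib)
qed

lemma sum_keys_single:
  assumes "f \<gamma> 0 = 0"
  shows "(\<Sum>\<delta> \<in> Poly_Mapping.keys (Poly_Mapping.single \<gamma> c). f \<delta> (Poly_Mapping.lookup
      (Poly_Mapping.single \<gamma> c) \<delta>)) = f \<gamma> c"
  using assms by (cases "c = 0") auto

lemma hat_zero [simp]: "hat 0 \<gamma> = 0"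
  by (simp add: hat_def)

lemma hat_add: "hat (\<alpha> + \<beta>) \<gamma> = hat \<alpha> \<gamma> + hat \<beta> \<gamma>"
  unfolding hat_def by (rule sum_keys_add[where f = "\<lambda>\<delta> x. if sub \<gamma> \<delta> then x else 0"]) auto

lemma hat_single: "hat (Poly_Mapping.single \<delta> c) \<gamma> = (if sub \<gamma> \<delta> then c else 0)"
  unfolding hat_def by (rule sum_keys_single[where f = "\<lambda>\<delta> x. if sub \<gamma> \<delta> then x else 0"]) auto

lemma hat_smult: "hat (Poly_Mapping.map ((*) c) \<alpha>) \<gamma> = c * hat \<alpha> \<gamma>"
  by (induction \<alpha> rule: poly_mapping_single_induct)
    (auto simp: map_times_add hat_add map_times_single hat_single distrib_left)

lemma hat_diff: "hat (\<alpha> - \<beta>) \<gamma> = hat \<alpha> \<gamma> - hat \<beta> \<gamma>"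
  using hat_add[of "\<alpha> - \<beta>" \<beta> \<gamma>] by simp

lemma hat_sum: "hat (\<Sum>i\<in>I. f i) \<gamma> = (\<Sum>i\<in>I. hat (f i) \<gamma>)"
  by (induction I rule: infinite_finite_induct) (auto simp: hat_add)

lemma sub_dm: "sub \<gamma> \<delta> \<Longrightarrow> dm \<gamma> \<subseteq> dm \<delta>"
  unfolding sub_def dm_def by blast

lemma sub_dm_eq:
  assumes "\<delta> \<in> Gbar G n" "sub \<gamma> \<delta>" "dm \<delta> \<subseteq> dm \<gamma>"
  shows "\<gamma> = \<delta>"
proof (rule gmat_eqI)
  fix i j x
  show "ent \<gamma> i j x \<longleftrightarrow> ent \<delta> i j x"
  proof
    assume d: "ent \<delta> i j x"
    then obtain i' x' where g: "ent \<gamma> i' j x'" using assms(3) by (blast intro: dmI elim: dmE)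
    hence d': "ent \<delta> i' j x'" using assms(2) unfolding sub_def by blast
    have "i' = i" using Gbar_col[OF assms(1) d' d] .
    thus "ent \<gamma> i j x" using g d d' ent_fun by metis
  qed (use assms(2) in \<open>auto simp: sub_def\<close>)
qed

text \<open>A key of maximal rank contributes the only term to the value of \<^const>\<open>hat\<close> there.\<close>

lemma hat_injective:
  fixes \<alpha> :: "'g gmat \<Rightarrow>\<^sub>0 'f::field"
  assumes "Poly_Mapping.keys \<alpha> \<subseteq> Gbar G n" "\<And>\<gamma>. \<gamma> \<in> Poly_Mapping.keys \<alpha> \<Longrightarrow> hat \<alpha> \<gamma> = 0"
  shows "\<alpha> = 0"
proof (rule ccontr)
  assume "\<alpha> \<noteq> 0"
  hence K: "Poly_Mapping.keys \<alpha> \<noteq> {}" by simp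
  let ?C = "(\<lambda>\<gamma>. card (dm \<gamma>)) ` Poly_Mapping.keys \<alpha>"
  have "Max ?C \<in> ?C" using K by (intro Max_in) auto
  then obtain \<gamma> where g: "\<gamma> \<in> Poly_Mapping.keys \<alpha>" and "Max ?C = card (dm \<gamma>)" by blast
  hence max: "card (dm \<delta>) \<le> card (dm \<gamma>)" if "\<delta> \<in> Poly_Mapping.keys \<alpha>" for \<delta>
    using Max_ge[of ?C "card (dm \<delta>)"] that by simp
  have eq: "\<delta> = \<gamma>" if "\<delta> \<in> Poly_Mapping.keys \<alpha>" "sub \<gamma> \<delta>" for \<delta>
  proof -
    have d: "\<delta> \<in> Gbar G n" using assms(1) that(1) by blast
    hence "dm \<delta> = dm \<gamma>"
      using max[OF that(1)] sub_dm[OF that(2)] dm_Gbar[OF d]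
      by (intro card_seteq[symmetric]) (auto intro: finite_subset)
    thus ?thesis using sub_dm_eq[OF d that(2)] by simp
  qed
  have "hat \<alpha> \<gamma> = (\<Sum>\<delta> \<in> Poly_Mapping.keys \<alpha>. if \<delta> = \<gamma> then Poly_Mapping.lookup \<alpha> \<gamma> else 0)"
    unfolding hat_def by (intro sum.cong refl) (use eq in auto)
  also have "\<dots> = Poly_Mapping.lookup \<alpha> \<gamma>" using g by (simp add: sum.delta)
  finally show False using assms(2)[OF g] g by (simp add: in_keys_iff)
qed

text \<open>\<open>X\<close> may be smaller than \<open>Gbar G n\<close>: identities in the algebra
  of \<open>Gbar' G m n\<close> are then tested on that subsemigroup alone.\<close>

lemma hat_eqI:
  fixes \<alpha> \<beta> :: "'g gmat \<Rightarrow>\<^sub>0 'f::field"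
  assumes "X \<subseteq> Gbar G n" "Poly_Mapping.keys \<alpha> \<subseteq> X" "Poly_Mapping.keys \<beta> \<subseteq> X"
    and "\<And>\<gamma>. \<gamma> \<in> X \<Longrightarrow> hat \<alpha> \<gamma> = hat \<beta> \<gamma>"
  shows "\<alpha> = \<beta>"
proof -
  have k: "Poly_Mapping.keys (\<alpha> - \<beta>) \<subseteq> X"
    using keys_diff[of \<alpha> \<beta>] assms(2,3) by blast
  hence "\<alpha> - \<beta> = 0"
    using assms(1,4) by (intro hat_injective[of _ G n]) (auto simp: hat_diff)
  thus ?thesis by simp
qed

text \<open>The system is triangular. Let \<gamma> have least rank in \<open>X\<close>. A multiple
  of \<gamma> changes coordinates only at restrictions of \<gamma>, and the only one of these in
  \<open>X\<close> is \<gamma> itself. So a solution on the rest of \<open>X\<close> can be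
  corrected at \<gamma> without being disturbed elsewhere.\<close>

lemma hat_surjective:
  fixes f :: "'g gmat \<Rightarrow> 'f::field"
  assumes "finite X" "X \<subseteq> Gbar G n"
  shows "\<exists>\<alpha> :: 'g gmat \<Rightarrow>\<^sub>0 'f::field. Poly_Mapping.keys \<alpha> \<subseteq> X \<and> (\<forall>\<gamma> \<in> X. hat \<alpha> \<gamma> = f \<gamma>)"
  using assms
proof (induction X rule: measure_induct_rule[where f = card])
  case (less X)
  show ?case
  proof (cases "X = {}")
    case False
    then obtain \<gamma>0 where "\<gamma>0 \<in> X" by blast
    from ex_has_least_nat[of "\<lambda>\<gamma>. \<gamma> \<in> X", OF this, of "\<lambda>\<gamma>. card (dm \<gamma>)"]
    obtain \<gamma> where g: "\<gamma> \<in> X" and least: "\<And>\<delta>. \<delta> \<in> X \<Longrightarrow> card (dm \<gamma>) \<le> card (dm \<delta>)"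
      by auto
    have min: "\<delta> = \<gamma>" if d: "\<delta> \<in> X" and sub: "sub \<delta> \<gamma>" for \<delta>
    proof -
      have G: "\<gamma> \<in> Gbar G n" using g less.prems by blast
      have "finite (dm \<gamma>)" using finite_subset[OF dm_Gbar[OF G]] by simp
      hence "dm \<delta> = dm \<gamma>" by (rule card_seteq) (use sub_dm[OF sub] least[OF d] in auto)
      thus ?thesis using sub_dm_eq[OF G sub] by simp
    qed
    have "card (X - {\<gamma>}) < card X"
      using less.prems(1) g by (rule card_Diff1_less)
    moreover have "finite (X - {\<gamma>})" "X - {\<gamma>} \<subseteq> Gbar G n"
      using less.prems by auto
    ultimately obtain \<alpha> :: "'g gmat \<Rightarrow>\<^sub>0 'f"
      where a: "Poly_Mapping.keys \<alpha> \<subseteq> X - {\<gamma>}" "\<And>\<delta>. \<delta> \<in> X - {\<gamma>} \<Longrightarrow> hat \<alpha> \<delta> = f \<delta>"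
      using less.IH[of "X - {\<gamma>}"] by auto
    let ?a = "Poly_Mapping.single \<gamma> (f \<gamma> - hat \<alpha> \<gamma>) + \<alpha>"
    have "Poly_Mapping.keys (Poly_Mapping.single \<gamma> (f \<gamma> - hat \<alpha> \<gamma>)) \<subseteq> X"
      using g by simp
    hence "Poly_Mapping.keys ?a \<subseteq> X"
      using Poly_Mapping.keys_add[of "Poly_Mapping.single \<gamma> (f \<gamma> - hat \<alpha> \<gamma>)" \<alpha>] a(1)
      by blast
    moreover have "\<forall>\<delta> \<in> X. hat ?a \<delta> = f \<delta>"
    proof
      fix \<delta> assume that: "\<delta> \<in> X"
      show "hat ?a \<delta> = f \<delta>"
      using a(2)[of \<delta>] min[OF that] that g by (cases "\<delta> = \<gamma>") (auto simp: hat_add hat_single)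
    qed
    ultimately show ?thesis by (intro exI conjI)
  next
    case True
    thus ?thesis by (intro exI[where x = 0]) simp
  qed
qed

text \<open>The outer sum is brought into the shape
  \<open>f \<gamma> (lookup \<alpha> \<gamma>)\<close> with which \<open>sum_keys_add\<close>
  unifies.\<close>

lemma conv_alt: "conv G \<alpha> \<beta> = (\<Sum>\<gamma> \<in> Poly_Mapping.keys \<alpha>. (\<lambda>\<gamma> a. \<Sum>\<delta> \<in> Poly_Mapping.keys \<beta>.
    Poly_Mapping.single (gmat_mult G \<gamma> \<delta>) (a * Poly_Mapping.lookup \<beta> \<delta>)) \<gamma> (Poly_Mapping.lookup \<alpha> \<gamma>))"
  by (simp add: conv_def)

lemma conv_add_left: "conv G (\<alpha> + \<beta>) \<delta> = conv G \<alpha> \<delta> + conv G \<beta> \<delta>"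
  unfolding conv_alt by (rule sum_keys_add) (auto simp: algebra_simps single_add sum.distrib)

lemma conv_add_right: "conv G \<delta> (\<alpha> + \<beta>) = conv G \<delta> \<alpha> + conv G \<delta> \<beta>"
  unfolding conv_def sum.distrib[symmetric]
  by (intro sum.cong refl sum_keys_add) (auto simp: algebra_simps single_add)

lemma conv_zero_left [simp]: "conv G 0 \<beta> = 0" and conv_zero_right [simp]: "conv G \<beta> 0 = 0"
  by (auto simp: conv_def)

lemma conv_single: "conv G (Poly_Mapping.single \<gamma> a) (Poly_Mapping.single \<delta> b) =
    Poly_Mapping.single (gmat_mult G \<gamma> \<delta>) (a * b)"
  by (cases "a = 0"; cases "b = 0") (auto simp: conv_def)

lemma conv_minus_left: "conv G (\<alpha> - \<beta>) \<delta> = conv G \<alpha> \<delta> - conv G \<beta> \<delta>"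
  using conv_add_left[of G "\<alpha> - \<beta>" \<beta> \<delta>] by simp

lemma conv_sum_left: "conv G (\<Sum>i\<in>I. f i) \<delta> = (\<Sum>i\<in>I. conv G (f i) \<delta>)"
  by (induction I rule: infinite_finite_induct) (auto simp: conv_add_left)

lemma conv_smult_left: "conv G (Poly_Mapping.map ((*) c) \<alpha>) \<beta> = Poly_Mapping.map ((*) c) (conv G \<alpha> \<beta>)"
proof (induction \<alpha> rule: poly_mapping_single_induct)
  case (add \<gamma> d \<alpha>)
  have "conv G (Poly_Mapping.single \<gamma> (c * d)) \<beta> = Poly_Mapping.map ((*) c) (conv G
      (Poly_Mapping.single \<gamma> d) \<beta>)"
    by (induction \<beta> rule: poly_mapping_single_induct)
      (auto simp: conv_add_right map_times_add conv_single map_times_single mult.assoc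
          mult.left_commute)
  thus ?case using add by (simp add: conv_add_left map_times_add map_times_single)
qed auto

lemma conv_smult_right: "conv G \<beta> (Poly_Mapping.map ((*) c) \<alpha>) = Poly_Mapping.map ((*) c) (conv G \<beta> \<alpha>)"
proof (induction \<alpha> rule: poly_mapping_single_induct)
  case (add \<gamma> d \<alpha>)
  have "conv G \<beta> (Poly_Mapping.single \<gamma> (c * d)) = Poly_Mapping.map ((*) c) (conv G \<beta>
      (Poly_Mapping.single \<gamma> d))"
    by (induction \<beta> rule: poly_mapping_single_induct)
      (auto simp: conv_add_left map_times_add conv_single map_times_single mult.assoc mult.left_commute)
  thus ?case using add by (simp add: conv_add_right map_times_add map_times_single)
qed auto

lemma keys_conv:
  assumes "Poly_Mapping.keys \<alpha> \<subseteq> X" "Poly_Mapping.keys \<beta> \<subseteq> Y"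
    and "\<And>\<gamma> \<delta>. \<gamma> \<in> X \<Longrightarrow> \<delta> \<in> Y \<Longrightarrow> gmat_mult G \<gamma> \<delta> \<in> Z"
  shows "Poly_Mapping.keys (conv G \<alpha> \<beta>) \<subseteq> Z"
proof -
  have "Poly_Mapping.keys (conv G \<alpha> \<beta>) \<subseteq> (\<Union>\<gamma> \<in> Poly_Mapping.keys \<alpha>. \<Union>\<delta> \<in> Poly_Mapping.keys \<beta>.
      {gmat_mult G \<gamma> \<delta>})"
    unfolding conv_def
    by (intro order_trans[OF Poly_Mapping.keys_sum] UN_mono order_refl) auto
  thus ?thesis using assms by blast
qed

lemma lin_ext_add: "lin_ext f (\<alpha> + \<beta>) = lin_ext f \<alpha> + lin_ext f \<beta>"
  unfolding lin_ext_def by (rule sum_keys_add) (auto simp: single_add)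

lemma lin_ext_zero [simp]: "lin_ext f 0 = 0"
  by (simp add: lin_ext_def)

lemma lin_ext_single [simp]: "lin_ext f (Poly_Mapping.single \<gamma> c) = Poly_Mapping.single (f \<gamma>) c"
  unfolding lin_ext_def by (rule sum_keys_single) auto

lemma keys_lin_ext: "Poly_Mapping.keys (lin_ext f \<alpha>) \<subseteq> f ` Poly_Mapping.keys \<alpha>"
  unfolding lin_ext_def by (rule order_trans[OF Poly_Mapping.keys_sum]) auto

context monomial
begin

abbreviation cm (infixl "\<star>" 70) where "\<alpha> \<star> \<beta> \<equiv> conv G \<alpha> \<beta>"

definition FM :: "('g gmat \<Rightarrow>\<^sub>0 'f::field) set" where "FM = {\<alpha>. Poly_Mapping.keys \<alpha> \<subseteq> Mon}"

lemma conv_assoc: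
  assumes "\<alpha> \<in> FM" "\<beta> \<in> FM" "\<delta> \<in> FM"
  shows "\<alpha> \<star> \<beta> \<star> \<delta> = \<alpha> \<star> (\<beta> \<star> \<delta>)"
proof -
  have 1: "Poly_Mapping.single a p \<star> Poly_Mapping.single b q \<star> \<delta> = Poly_Mapping.single a p \<star>
      (Poly_Mapping.single b q \<star> \<delta>)"
    if "a \<in> Mon" "b \<in> Mon" for a b p q
    using assms(3) unfolding FM_def mem_Collect_eq
    by (induction \<delta> rule: keys_subset_induct) (auto simp: conv_add_right conv_single mult_assoc
        that algebra_simps)
  have 2: "Poly_Mapping.single a p \<star> \<beta> \<star> \<delta> = Poly_Mapping.single a p \<star> (\<beta> \<star> \<delta>)" if "a \<in> Mon" for a p
    using assms(2) unfolding FM_def mem_Collect_eq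
    by (induction \<beta> rule: keys_subset_induct) (auto simp: conv_add_left conv_add_right 1 that)
  show ?thesis
    using assms(1) unfolding FM_def mem_Collect_eq
    by (induction \<alpha> rule: keys_subset_induct) (auto simp: conv_add_left 2)
qed

lemma conv_closed [intro]: "\<alpha> \<in> FM \<Longrightarrow> \<beta> \<in> FM \<Longrightarrow> \<alpha> \<star> \<beta> \<in> FM"
  using keys_conv[of \<alpha> Mon \<beta> Mon G Mon] by (simp add: FM_def)

lemma FM_single [simp, intro]: "\<gamma> \<in> Mon \<Longrightarrow> Poly_Mapping.single \<gamma> c \<in> FM"
  by (simp add: FM_def)

lemma FM_zero [simp, intro]: "0 \<in> FM"
  by (simp add: FM_def)

lemma FM_add: "\<alpha> \<in> FM \<Longrightarrow> \<beta> \<in> FM \<Longrightarrow> \<alpha> + \<beta> \<in> FM"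
  using Poly_Mapping.keys_add[of \<alpha> \<beta>] by (auto simp: FM_def)

lemma FM_diff: "\<alpha> \<in> FM \<Longrightarrow> \<beta> \<in> FM \<Longrightarrow> \<alpha> - \<beta> \<in> FM"
  using keys_diff[of \<alpha> \<beta>] by (auto simp: FM_def)

lemma FM_smult: "\<alpha> \<in> FM \<Longrightarrow> Poly_Mapping.map ((*) c) \<alpha> \<in> FM"
  using keys_map_times[of c \<alpha>] by (auto simp: FM_def)

lemma FM_sum: "(\<And>i. i \<in> I \<Longrightarrow> f i \<in> FM) \<Longrightarrow> sum f I \<in> FM"
  by (induction I rule: infinite_finite_induct) (auto intro: FM_add)

text \<open>This is \<open>sub_mult_left\<close> for each key of \<beta>: a translation along
  \<open>star a\<close>, with value 0 where the rows of \<tau> are not covered by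
  \<open>a\<close>.\<close>

lemma hat_mult_left:
  assumes "\<beta> \<in> FM" "a \<in> Mon" "\<tau> \<in> Mon"
  shows "hat (basis a \<star> \<beta>) \<tau> = (if rn \<tau> \<subseteq> rn a then hat \<beta> (star a \<cdot> \<tau>) else 0)"
  using assms(1) unfolding FM_def mem_Collect_eq
  by (induction \<beta> rule: keys_subset_induct)
    (auto simp: conv_add_right conv_single hat_add hat_single sub_mult_left assms)

lemma hat_mult_right:
  assumes "\<beta> \<in> FM" "a \<in> Mon" "\<tau> \<in> Mon"
  shows "hat (\<beta> \<star> basis a) \<tau> = (if dm \<tau> \<subseteq> dm a then hat \<beta> (\<tau> \<cdot> star a) else 0)"
  using assms(1) unfolding FM_def mem_Collect_eq
  by (induction \<beta> rule: keys_subset_induct)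
    (auto simp: conv_add_left conv_single hat_add hat_single sub_mult_right assms)

text \<open>Multiplication by \<epsilon>_i keeps exactly the coordinates without row
  \<open>i\<close>, so the complementary idempotent keeps the others. This is the effect of the last
  two factors in \<open>u_elem\<close>.\<close>

lemma hat_one_minus_left:
  assumes "\<beta> \<in> FM" "i \<in> {1..n}" "\<tau> \<in> Mon"
  shows "hat ((basis (one_gmat G n) - basis (eps_gmat G n i)) \<star> \<beta>) \<tau> = (if i \<in> rn \<tau> then hat \<beta> \<tau>
      else 0)"
proof -
  have r: "rn \<tau> \<subseteq> {1..n}" using rn_Gbar[OF assms(3)] .
  have "rn \<tau> \<subseteq> {1..n} - {i} \<longleftrightarrow> i \<notin> rn \<tau>" using r by blast
  thus ?thesis
    using assms r idm_mult[of "{1..n} - {i}" \<tau>] idm_mult[of "{1..n}" \<tau>]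
    by (simp add: conv_minus_left hat_diff hat_mult_left one_gmat_idm eps_gmat_idm)
qed

lemma basis_one [simp]: "\<beta> \<in> FM \<Longrightarrow> basis (one_gmat G n) \<star> \<beta> = \<beta>"
  unfolding FM_def mem_Collect_eq
  by (induction \<beta> rule: keys_subset_induct)
    (auto simp: conv_add_right conv_single one_gmat_idm idm_mult dest: rn_Gbar)

lemma basis_one_right [simp]: "\<beta> \<in> FM \<Longrightarrow> \<beta> \<star> basis (one_gmat G n) = \<beta>"
  unfolding FM_def mem_Collect_eq
  by (induction \<beta> rule: keys_subset_induct)
    (auto simp: conv_add_left conv_single one_gmat_idm mult_idm dest: dm_Gbar)

lemma FM_one_minus: "basis (one_gmat G n) - basis (eps_gmat G n i) \<in> FM"
  by (rule FM_diff) (auto simp: one_gmat_idm eps_gmat_idm)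

section \<open>The elements $u_k$\<close>

text \<open>\<open>swp k i h\<close> is $h^{(k)} (h^{-1})^{(i)} (k\,i)$.\<close>

definition swp :: "nat \<Rightarrow> nat \<Rightarrow> 'g \<Rightarrow> 'g gmat" where
  "swp k i h = (\<lambda>r c. if r = k \<and> c = i then Some h else if r = i \<and> c = k then Some (inv h)
     else if r = c \<and> r \<in> {1..n} - {k, i} then Some \<one> else None)"

lemma ent_swp: "k \<noteq> i \<Longrightarrow> ent (swp k i h) r c x \<longleftrightarrow>
    r = k \<and> c = i \<and> x = h \<or> r = i \<and> c = k \<and> x = inv h \<or> r = c \<and> r \<in> {1..n} - {k, i} \<and> x = \<one>"
  by (auto simp: ent_def swp_def)

context
  fixes k i h
  assumes ki: "k \<noteq> i" "k \<in> {1..n}" "i \<in> {1..n}" and h: "h \<in> carrier G"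
begin

lemma swp_closed [simp, intro]: "swp k i h \<in> Mon"
  by (rule GbarI) (use ki h in \<open>auto simp: ent_swp\<close>)

lemma star_swp [simp]: "star (swp k i h) = swp k i h"
  by (rule gmat_eqI) (use ki h in \<open>auto simp: ent_swp ent_star\<close>)

lemma dm_swp [simp]: "dm (swp k i h) = {1..n}" and rn_swp [simp]: "rn (swp k i h) = {1..n}"
proof -
  show d: "dm (swp k i h) = {1..n}"
  proof (intro equalityI subsetI)
    fix c assume c: "c \<in> {1..n}"
    have "ent (swp k i h) (if c = i then k else if c = k then i else c) c (if c = i then h else if
        c = k then inv h else \<one>)"
      using ki c by (auto simp: ent_swp)
    thus "c \<in> dm (swp k i h)" by (rule dmI)
  next
    fix c assume "c \<in> dm (swp k i h)"
    thus "c \<in> {1..n}" by (rule dmE) (use ki in \<open>auto simp: ent_swp\<close>)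
  qed
  show "rn (swp k i h) = {1..n}"
    using dm_star[of "swp k i h"] d by simp
qed

lemma swp_mult_swp: "\<tau> \<in> Mon \<Longrightarrow> swp k i h \<cdot> (swp k i h \<cdot> \<tau>) = \<tau>"
  using mult_star[OF swp_closed] by (simp add: mult_assoc[symmetric])

lemma rn_swp_mult: 
  assumes "\<tau> \<in> Mon"
  shows "k \<in> rn (swp k i h \<cdot> \<tau>) \<longleftrightarrow> i \<in> rn \<tau>" "i \<in> rn (swp k i h \<cdot> \<tau>) \<longleftrightarrow> k \<in> rn \<tau>"
  using ki by (auto simp: rn_def ent_mult[OF swp_closed] ent_swp)

lemma swp_product: 
  "pos_gmat G n k h \<cdot> pos_gmat G n i (inv h) \<cdot> perm_gmat G n (transpose k i) = swp k i h"
proof -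
  have e: "ent (pos_gmat G n k h) r c x \<longleftrightarrow> r = c \<and> r \<in> {1..n} \<and> x = (if r = k then h else \<one>)" for k
      h r c x
    by (auto simp: ent_def pos_gmat_def diag_gmat_def)
  have p: "ent (perm_gmat G n (transpose k i)) r c x \<longleftrightarrow> r \<in> {1..n} \<and> c \<in> {1..n} \<and> transpose k i c =
      r \<and> x = \<one>" for r c x
    by (auto simp: ent_def perm_gmat_def)
  have c: "pos_gmat G n k h \<in> Mon" if "h \<in> carrier G" for k h
    by (rule GbarI) (use that in \<open>auto simp: e\<close>)
  have pp: "ent (pos_gmat G n k h \<cdot> pos_gmat G n i (inv h)) r c x \<longleftrightarrow>
      r = c \<and> r \<in> {1..n} \<and> x = (if r = k then h else if r = i then inv h else \<one>)" for r c x
    using ki h by (auto simp: ent_mult c e)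
  show ?thesis
    by (rule gmat_eqI)
      (use ki h in \<open>auto simp: ent_mult c mult_closed pp p ent_swp transpose_def split: if_splits\<close>)
qed

end

lemma u_elem_eq:
  assumes "k \<in> {1..n}"
  shows "(u_elem G n k :: 'g gmat \<Rightarrow>\<^sub>0 'f::field) = (\<Sum>i = k+1..n. \<Sum>h \<in> carrier G.
    basis (swp k i h) \<star> (basis (one_gmat G n) - basis (eps_gmat G n k)) \<star> (basis (one_gmat G n) -
        basis (eps_gmat G n i)))"
  unfolding u_elem_def t_elem_def conv_sum_left
  by (intro sum.cong refl) (use assms in \<open>simp add: conv_single swp_product\<close>)

lemma u_elem_FM:
  assumes "k \<in> {1..n}"
  shows "(u_elem G n k :: 'g gmat \<Rightarrow>\<^sub>0 'f::field) \<in> FM"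
  unfolding u_elem_eq[OF assms]
  by (intro FM_sum conv_closed FM_one_minus) (use assms in auto)

text \<open>The two idempotents demand that rows \<open>k\<close> and \<open>i\<close> of
  \<open>swp k i h \<cdot> \<tau>\<close> be nonzero. Since \<open>swp k i h\<close> exchanges these
  two rows, the same demand can be made of \<tau>.\<close>

lemma hat_u_mult:
  assumes k: "k \<in> {1..n}" and b: "\<beta> \<in> FM" and t: "\<tau> \<in> Mon"
  shows "hat (u_elem G n k \<star> \<beta>) \<tau> = (\<Sum>i = k+1..n. \<Sum>h \<in> carrier G.
    if k \<in> rn \<tau> \<and> i \<in> rn \<tau> then hat (\<beta> :: 'g gmat \<Rightarrow>\<^sub>0 'f::field) (swp k i h \<cdot> \<tau>) else 0)"
proof -
  let ?o = "\<lambda>i. basis (one_gmat G n) - basis (eps_gmat G n i) :: 'g gmat \<Rightarrow>\<^sub>0 'f"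
  have *: "hat (basis (swp k i h) \<star> ?o k \<star> ?o i \<star> \<beta>) \<tau> =
    (if k \<in> rn \<tau> \<and> i \<in> rn \<tau> then hat \<beta> (swp k i h \<cdot> \<tau>) else 0)"
    if i: "i \<in> {k+1..n}" and h: "h \<in> carrier G" for i h
  proof -
    have ki: "k \<noteq> i" "k \<in> {1..n}" "i \<in> {1..n}" using i k by auto
    note S = swp_closed[OF ki h]
    have s: "basis (swp k i h) \<in> FM" using S by simp
    note c2 = conv_closed[OF FM_one_minus[of i] b]
    note c1 = conv_closed[OF FM_one_minus[of k] c2]
    have "basis (swp k i h) \<star> ?o k \<star> ?o i \<star> \<beta> = basis (swp k i h) \<star> ?o k \<star> (?o i \<star> \<beta>)"
      by (rule conv_assoc[OF conv_closed[OF s FM_one_minus] FM_one_minus b])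
    also have "\<dots> = basis (swp k i h) \<star> (?o k \<star> (?o i \<star> \<beta>))"
      by (rule conv_assoc[OF s FM_one_minus c2])
    finally have "hat (basis (swp k i h) \<star> ?o k \<star> ?o i \<star> \<beta>) \<tau> =
        hat (basis (swp k i h) \<star> (?o k \<star> (?o i \<star> \<beta>))) \<tau>"
      by (rule arg_cong)
    also have "\<dots> = hat (?o k \<star> (?o i \<star> \<beta>)) (swp k i h \<cdot> \<tau>)"
      unfolding hat_mult_left[OF c1 S t] star_swp[OF ki h] rn_swp[OF ki h] using rn_Gbar[OF t]
          by (rule if_P)
    also have "\<dots> = (if k \<in> rn \<tau> \<and> i \<in> rn \<tau> then hat \<beta> (swp k i h \<cdot> \<tau>) else 0)"
      unfolding hat_one_minus_left[OF c2 k mult_closed[OF S t]] hat_one_minus_left[OF b ki(3)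
          mult_closed[OF S t]]
        rn_swp_mult[OF ki h t] by (cases "k \<in> rn \<tau>"; cases "i \<in> rn \<tau>") simp_all
    finally show ?thesis .
  qed
  show ?thesis
    unfolding u_elem_eq[OF k] conv_sum_left hat_sum by (intro sum.cong refl *)
qed

section \<open>Generation of the monomial matrices\<close>

lemma ent_diag: "ent (diag_gmat n g) r c x \<longleftrightarrow> r = c \<and> r \<in> {1..n} \<and> x = g r"
  by (auto simp: ent_def diag_gmat_def)

lemma ent_perm: "ent (perm_gmat G n \<sigma>) r c x \<longleftrightarrow> r \<in> {1..n} \<and> c \<in> {1..n} \<and> \<sigma> c = r \<and> x = \<one>"
  by (auto simp: ent_def perm_gmat_def)

lemma diag_closed: "g \<in> {1..n} \<rightarrow> carrier G \<Longrightarrow> diag_gmat n g \<in> Mon"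
  by (rule GbarI) (auto simp: ent_diag)

lemma perm_closed: "inj \<sigma> \<Longrightarrow> perm_gmat G n \<sigma> \<in> Mon"
  by (rule GbarI) (auto simp: ent_perm dest: injD)

lemma perm_mult:
  assumes "inj \<sigma>" "\<rho> ` {1..n} \<subseteq> {1..n}"
  shows "perm_gmat G n \<sigma> \<cdot> perm_gmat G n \<rho> = perm_gmat G n (\<sigma> \<circ> \<rho>)"
proof (rule gmat_eqI)
  fix r c x
  have "\<rho> c \<in> {1..n}" if "c \<in> {1..n}" using assms(2) that by blast
  thus "ent (perm_gmat G n \<sigma> \<cdot> perm_gmat G n \<rho>) r c x \<longleftrightarrow> ent (perm_gmat G n (\<sigma> \<circ> \<rho>)) r c x"
    unfolding ent_mult[OF perm_closed[OF assms(1)]] ent_perm by auto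
qed

lemma ent_transpose_mult:
  assumes "i \<in> {1..n}" "j \<in> {1..n}" "\<gamma> \<in> Mon"
  shows "ent (perm_gmat G n (transpose i j) \<cdot> \<gamma>) r c x \<longleftrightarrow> ent \<gamma> (transpose i j r) c x"
proof -
  have "ent (perm_gmat G n (transpose i j) \<cdot> \<gamma>) r c x \<longleftrightarrow>
      (\<exists>k h. r \<in> {1..n} \<and> k \<in> {1..n} \<and> transpose i j k = r \<and> ent \<gamma> k c h \<and> x = \<one> \<otimes> h)"
    unfolding ent_mult[OF perm_closed[OF inj_transpose]] ent_perm by blast
  also have "\<dots> \<longleftrightarrow> (\<exists>h. r \<in> {1..n} \<and> ent \<gamma> (transpose i j r) c h \<and> x = \<one> \<otimes> h)"
  proof -
    have t: "transpose i j k = r \<longleftrightarrow> k = transpose i j r" for k by (metis transpose_involutory)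
    show ?thesis unfolding t using Gbar_entry(1)[OF assms(3)] by blast
  qed
  also have "\<dots> \<longleftrightarrow> ent \<gamma> (transpose i j r) c x"
  proof -
    have "r \<in> {1..n} \<and> h \<in> carrier G" if "ent \<gamma> (transpose i j r) c h" for h
      using Gbar_entry(1,3)[OF assms(3) that] assms(1,2) by (auto simp: transpose_def split: if_splits)
    thus ?thesis by fastforce
  qed
  finally show ?thesis .
qed

text \<open>
  Multiplying by a transposition moves one more entry onto the diagonal, until a partial diagonal
  matrix is left.
\<close>

lemma Gbar_generators_induct [consumes 1, case_names diag swap eps mult]:
  assumes g: "\<gamma> \<in> Mon"
    and diag: "\<And>g. g \<in> {1..n} \<rightarrow> carrier G \<Longrightarrow> P (diag_gmat n g)"
    and swap: "\<And>l. l \<in> {1..<n} \<Longrightarrow> P (perm_gmat G n (transpose l (l + 1)))"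
    and eps: "\<And>k. k \<in> {1..n} \<Longrightarrow> P (eps_gmat G n k)"
    and mult: "\<And>a b. a \<in> Mon \<Longrightarrow> b \<in> Mon \<Longrightarrow> P a \<Longrightarrow> P b \<Longrightarrow> P (a \<cdot> b)"
  shows "P \<gamma>"
proof -
  \<comment> \<open>Each factor \<epsilon>_k deletes one more diagonal entry.\<close>
  have pdiag: "P (idm ({1..n} - F) \<cdot> diag_gmat n g)"
    if "finite F" "F \<subseteq> {1..n}" "g \<in> {1..n} \<rightarrow> carrier G" for F g
    using that(1,2)
  proof (induction F rule: finite_induct)
    case empty
    thus ?case using diag[OF that(3)] diag_closed[OF that(3)] by simp
  next
    case (insert k F)
    have D: "diag_gmat n g \<in> Mon" by (rule diag_closed[OF that(3)])
    have I: "idm ({1..n} - F) \<in> Mon" "idm ({1..n} - {k}) \<in> Mon" by auto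
    have "P (eps_gmat G n k \<cdot> (idm ({1..n} - F) \<cdot> diag_gmat n g))"
    proof (rule mult)
      show "P (eps_gmat G n k)" using insert.prems by (intro eps) simp
      show "P (idm ({1..n} - F) \<cdot> diag_gmat n g)" using insert by simp
    qed (use D I in \<open>simp_all add: eps_gmat_idm\<close>)
    moreover have "eps_gmat G n k \<cdot> (idm ({1..n} - F) \<cdot> diag_gmat n g) = idm ({1..n} - insert k F)
        \<cdot> diag_gmat n g"
      unfolding eps_gmat_idm
    proof (rule gmat_eqI)
      fix i j x
      have s: "{1..n} - {k} \<subseteq> {1..n}" "{1..n} - F \<subseteq> {1..n}" "{1..n} - insert k F \<subseteq> {1..n}" by auto
      show "ent (idm ({1..n} - {k}) \<cdot> (idm ({1..n} - F) \<cdot> diag_gmat n g)) i j x \<longleftrightarrow>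
          ent (idm ({1..n} - insert k F) \<cdot> diag_gmat n g) i j x"
        unfolding ent_idm_mult[OF s(1) mult_closed[OF I(1) D]] ent_idm_mult[OF s(2) D]
            ent_idm_mult[OF s(3) D] by auto
    qed
    ultimately show ?case by simp
  qed
  have tr: "P (perm_gmat G n (transpose i j))" if "1 \<le> i" "Suc i \<le> j" "j \<le> n" for i j
    using that(2,3)
  proof (induction j rule: dec_induct)
    case base
    thus ?case using swap[of i] that(1) by simp
  next
    case (step j)
    let ?t = "perm_gmat G n (transpose j (Suc j))" and ?s = "perm_gmat G n (transpose i j)"
    have im: "transpose a b ` {1..n} \<subseteq> {1..n}" if "a \<in> {1..n}" "b \<in> {1..n}" for a b
      using that by (auto simp: transpose_def)
    \<comment> \<open>Conjugating (i j) by the adjacent transposition (j j+1) gives (i j+1).\<close>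
    have "P (?t \<cdot> ?s \<cdot> ?t)"
      using step swap[of j] that(1) by (intro mult mult_closed perm_closed inj_transpose) auto
    also have "?t \<cdot> ?s \<cdot> ?t = perm_gmat G n (transpose j (Suc j) \<circ> transpose i j \<circ> transpose j (Suc j))"
      using step that(1) by (simp add: perm_mult im inj_compose)
    also have "transpose j (Suc j) \<circ> transpose i j \<circ> transpose j (Suc j) = transpose i (Suc j)"
      using step(1) by (auto simp: fun_eq_iff transpose_def)
    finally show ?case .
  qed
  have tr': "P (perm_gmat G n (transpose i j))" if "i \<in> {1..n}" "j \<in> {1..n}" "i \<noteq> j" for i j
  proof (cases "i < j")
    case True
    thus ?thesis using tr[of i j] that by simp
  next
    case False
    thus ?thesis using tr[of j i] that by (simp add: transpose_commute)
  qed
  \<comment> \<open>The columns whose nonzero entry is off the diagonal; their number decreases in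
    the induction.\<close>
  define D where "D \<gamma> = {j \<in> dm \<gamma>. \<forall>x. \<not> ent \<gamma> j j x}" for \<gamma> :: "'g gmat"
  show ?thesis
    using g
  proof (induction \<gamma> rule: measure_induct_rule[where f = "\<lambda>\<gamma>. card (D \<gamma>)"])
    case (less \<gamma>)
    show ?case
    proof (cases "D \<gamma> = {}")
      case True
      \<comment> \<open>The default value \<open>\<one>\<close> keeps \<open>g\<close> in the
        carrier at zero columns; these columns are erased afterwards by
        \<open>idm (dm \<gamma>)\<close>.\<close>
      define g where "g j = (if \<gamma> j j = None then \<one> else the (\<gamma> j j))" for j
      have gj: "ent \<gamma> j j x \<longleftrightarrow> j \<in> dm \<gamma> \<and> x = g j" for j x
      proof
        assume "ent \<gamma> j j x"
        thus "j \<in> dm \<gamma> \<and> x = g j" using dmI[of \<gamma> j j x] by (simp add: g_def ent_def)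
      next
        assume "j \<in> dm \<gamma> \<and> x = g j"
        moreover from this True obtain y where "ent \<gamma> j j y" by (auto simp: D_def)
        ultimately show "ent \<gamma> j j x" by (simp add: g_def ent_def)
      qed
      have gc: "g \<in> {1..n} \<rightarrow> carrier G"
      proof
        fix j show "g j \<in> carrier G"
          using gj[of j "g j"] Gbar_entry(3)[OF less.prems, of j j "g j"]
          by (cases "\<gamma> j j") (auto simp: g_def ent_def)
      qed
      have d: "dm \<gamma> \<subseteq> {1..n}" by (rule dm_Gbar[OF less.prems])
      have "idm (dm \<gamma>) \<cdot> diag_gmat n g = \<gamma>"
      proof (rule gmat_eqI)
        fix i j x
        have "i = j" if x: "ent \<gamma> i j x"
        proof -
          have "j \<in> dm \<gamma>" by (rule dmI[OF x])
          hence "ent \<gamma> j j (g j)" by (simp add: gj)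
          with x show "i = j" by (rule Gbar_col[OF less.prems])
        qed
        hence "ent \<gamma> i j x \<longleftrightarrow> i = j \<and> i \<in> dm \<gamma> \<and> x = g i" using gj by metis
        thus "ent (idm (dm \<gamma>) \<cdot> diag_gmat n g) i j x \<longleftrightarrow> ent \<gamma> i j x"
          unfolding ent_idm_mult[OF d diag_closed[OF gc]] ent_diag using d by auto
      qed
      moreover have "{1..n} - ({1..n} - dm \<gamma>) = dm \<gamma>" using d by auto
      ultimately show ?thesis using pdiag[of "{1..n} - dm \<gamma>" g] gc by simp
    next
      case False
      then obtain j where j: "j \<in> D \<gamma>" by blast
      then obtain i x where x: "ent \<gamma> i j x" by (auto simp: D_def elim: dmE)
      have ij: "i \<in> {1..n}" "j \<in> {1..n}" using Gbar_entry[OF less.prems x] by auto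
      have "i \<noteq> j" using j x by (auto simp: D_def)
      let ?s = "perm_gmat G n (transpose i j)"
      have s: "?s \<in> Mon" by (intro perm_closed inj_transpose)
      note e = ent_transpose_mult[OF ij]
      have "dm (?s \<cdot> \<gamma>) = dm \<gamma>"
      proof
        show "dm (?s \<cdot> \<gamma>) \<subseteq> dm \<gamma>" by (rule dm_mult[OF s])
        show "dm \<gamma> \<subseteq> dm (?s \<cdot> \<gamma>)"
        proof
          fix c assume "c \<in> dm \<gamma>"
          then obtain r y where "ent \<gamma> r c y" by (rule dmE)
          hence "ent (?s \<cdot> \<gamma>) (transpose i j r) c y" by (simp add: e[OF less.prems])
          thus "c \<in> dm (?s \<cdot> \<gamma>)" by (rule dmI)
        qed
      qed
      moreover have "j \<notin> D (?s \<cdot> \<gamma>)" using x by (auto simp: D_def e[OF less.prems])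
      \<comment> \<open>Exchanging rows \<open>i\<close> and \<open>j\<close> spares the entries
        already on the diagonal: column \<open>j\<close> has none there, and the only entry of row
        \<open>i\<close> lies in column \<open>j\<close>, not in column \<open>i\<close>.\<close>
      moreover have "ent (?s \<cdot> \<gamma>) c c y" if y: "ent \<gamma> c c y" for c y
      proof -
        have "c \<noteq> j" using j y by (auto simp: D_def)
        moreover have "c \<noteq> i" using Gbar_row[OF less.prems x] y \<open>i \<noteq> j\<close> by blast
        ultimately show ?thesis using y by (simp add: e[OF less.prems])
      qed
      ultimately have "D (?s \<cdot> \<gamma>) \<subseteq> D \<gamma> - {j}" unfolding D_def by blast
      moreover have "finite (D \<gamma>)"
        using finite_subset[OF dm_Gbar[OF less.prems]] by (simp add: D_def)
      ultimately have "card (D (?s \<cdot> \<gamma>)) < card (D \<gamma>)"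
        using j by (intro psubset_card_mono) auto
      hence "P (?s \<cdot> \<gamma>)" using s less.prems by (intro less.IH) auto
      hence "P (?s \<cdot> (?s \<cdot> \<gamma>))"
        using s less.prems tr'[OF ij \<open>i \<noteq> j\<close>] by (intro mult[of ?s "?s \<cdot> \<gamma>"]) auto
      moreover have "?s \<cdot> (?s \<cdot> \<gamma>) = \<gamma>"
        by (rule gmat_eqI) (simp add: e s less.prems)
      ultimately show ?thesis by simp
    qed
  qed
qed

end

section \<open>The centralizer in coordinates\<close>

locale monomial_pair = monomial G n for G :: "('g, 'x) monoid_scheme" (structure) and n +
  fixes m :: nat
  assumes m_le: "m \<le> n" and m_pos: "1 \<le> m"
begin

abbreviation Mon' where "Mon' \<equiv> Gbar' G m n"

lemma Mon'_iff: "v \<in> Mon' \<longleftrightarrow> v \<in> Mon \<and> (\<forall>k \<in> {1..m}. ent v k k \<one>)"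
  by (auto simp: Gbar'_def ent_def)

lemma Mon'_Mon [simp]: "v \<in> Mon' \<Longrightarrow> v \<in> Mon"
  by (simp add: Mon'_iff)

text \<open>A nonzero diagonal entry uses up its row and its column, so a matrix in
  \<open>Mon'\<close> is the identity on the first \<open>m\<close> indices and has no entry linking
  them to the others.\<close>

lemma Mon'_fixed:
  assumes "v \<in> Mon'" "ent v i j x" "i \<le> m \<or> j \<le> m"
  shows "i = j" "x = \<one>"
proof -
  have v: "v \<in> Mon" using assms(1) by simp
  have r: "i \<in> {1..n}" "j \<in> {1..n}" using Gbar_entry[OF v assms(2)] by auto
  show "i = j"
  proof (cases "i \<le> m")
    case True
    hence "ent v i i \<one>" using assms(1) r by (auto simp: Mon'_iff)
    thus ?thesis using Gbar_row[OF v _ assms(2)] by metis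
  next
    case False
    hence "ent v j j \<one>" using assms r by (auto simp: Mon'_iff)
    thus ?thesis using Gbar_col[OF v assms(2)] by metis
  qed
  with assms r have "ent v i i \<one>" by (auto simp: Mon'_iff)
  thus "x = \<one>" using assms(2) \<open>i = j\<close> ent_fun by metis
qed

lemma Mon'_mult [simp, intro]: "v \<in> Mon' \<Longrightarrow> w \<in> Mon' \<Longrightarrow> v \<cdot> w \<in> Mon'"
  unfolding Mon'_iff by (auto intro!: ent_multI)

lemma Mon'_star [simp, intro]: "v \<in> Mon' \<Longrightarrow> star v \<in> Mon'"
  unfolding Mon'_iff by (auto intro!: ent_starI)

lemma Mon'_idm [simp, intro]: "{1..m} \<subseteq> S \<Longrightarrow> S \<subseteq> {1..n} \<Longrightarrow> idm S \<in> Mon'"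
  unfolding Mon'_iff by (auto simp: ent_idm)

lemma Mon'_dm: "v \<in> Mon' \<Longrightarrow> {1..m} \<subseteq> dm v" and Mon'_rn: "v \<in> Mon' \<Longrightarrow> {1..m} \<subseteq> rn v"
  by (auto simp: Mon'_iff dm_def rn_def)

text \<open>\<open>v\<close> fixes \<open>k\<close> and carries \<open>i\<close> to
  \<open>i'\<close> with label \<open>g\<close>, hence carries the labelled exchange of
  \<open>k\<close> and \<open>i\<close> to one of \<open>k\<close> and \<open>i'\<close>. The label
  \<open>h \<otimes> inv g\<close> compensates for \<open>g\<close>. The rule holds for partial
  \<open>v\<close>, as only column \<open>i\<close> has to be nonzero; it drives both the centrality
  of u_k and the reinsertion argument.\<close>

lemma Mon'_swp:
  assumes "v \<in> Mon'" "ent v i' i g" "k \<in> {1..m}" "i \<noteq> k" "h \<in> carrier G"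
  shows "v \<cdot> swp k i h = swp k i' (h \<otimes> inv g) \<cdot> v"
proof (rule gmat_eqI)
  fix r c x
  have v: "v \<in> Mon" using assms(1) by simp
  have g: "g \<in> carrier G" "i \<in> {1..n}" "i' \<in> {1..n}" using Gbar_entry[OF v assms(2)] by auto
  have k: "k \<in> {1..n}" using assms(3) m_le by auto
  have i': "i' \<noteq> k" using Mon'_fixed[OF assms(1,2)] assms(3,4) by auto
  have vk: "ent v k k \<one>" using assms(1,3) by (simp add: Mon'_iff)
  have s: "swp k i' (h \<otimes> inv g) \<in> Mon" using g k i' assms(5) by auto
  have vi: "ent v r i y \<longleftrightarrow> r = i' \<and> y = g" for r y
    using assms(2) Gbar_col[OF v _ assms(2)] ent_fun by metis
  have vi': "ent v i' r y \<longleftrightarrow> r = i \<and> y = g" for r y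
    using assms(2) Gbar_row[OF v _ assms(2)] ent_fun by metis
  have vk1: "ent v r k y \<longleftrightarrow> r = k \<and> y = \<one>" for r y
    using vk Gbar_col[OF v _ vk] ent_fun by metis
  have vk2: "ent v k r y \<longleftrightarrow> r = k \<and> y = \<one>" for r y
    using vk Gbar_row[OF v _ vk] ent_fun by metis
  have 1: "h \<otimes> inv g \<otimes> g = h" using g assms(5) by (simp add: m_assoc)
  have 2: "inv (h \<otimes> inv g) = g \<otimes> inv h" using g assms(5) by (simp add: inv_mult_group)
  have x: "ent v r c y \<Longrightarrow> y \<in> carrier G \<and> r \<in> {1..n} \<and> c \<in> {1..n}" for r c y
    using Gbar_entry[OF v] by blast
  have xe: "ent v r c y \<and> x = y \<otimes> \<one> \<longleftrightarrow> ent v r c y \<and> x = y" "ent v r c y \<and> x = \<one> \<otimes> y \<longleftrightarrow> ent v r c y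
      \<and> x = y" for r c y
    using x[of r c y] by auto
  have "ent (v \<cdot> swp k i h) r c x \<longleftrightarrow> c = i \<and> r = k \<and> x = h \<or> c = k \<and> r = i' \<and> x = g \<otimes> inv h \<or> c \<notin>
      {k, i} \<and> ent v r c x"
  proof -
    have "ent (v \<cdot> swp k i h) r c x \<longleftrightarrow> (\<exists>y. c = i \<and> ent v r k y \<and> x = y \<otimes> h) \<or>
      (\<exists>y. c = k \<and> ent v r i y \<and> x = y \<otimes> inv h) \<or> (\<exists>y. c \<notin> {k, i} \<and> c \<in> {1..n} \<and> ent v r c y \<and> x =
          y \<otimes> \<one>)"
      unfolding ent_mult[OF v] ent_swp[OF assms(4)[symmetric]] by blast
    also have "\<dots> \<longleftrightarrow> c = i \<and> r = k \<and> x = h \<or> c = k \<and> r = i' \<and> x = g \<otimes> inv h \<or> c \<notin> {k, i} \<and> ent v r c x"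
      unfolding vi vk1 xe using x[of r c x] assms(5) by auto
    finally show ?thesis .
  qed
  moreover have "ent (swp k i' (h \<otimes> inv g) \<cdot> v) r c x \<longleftrightarrow> r = k \<and> c = i \<and> x = h \<or> r = i' \<and> c = k \<and> x
      = g \<otimes> inv h \<or> r \<notin> {k, i'} \<and> ent v r c x"
  proof -
    have "ent (swp k i' (h \<otimes> inv g) \<cdot> v) r c x \<longleftrightarrow> (\<exists>y. r = k \<and> ent v i' c y \<and> x = h \<otimes> inv g \<otimes> y) \<or>
      (\<exists>y. r = i' \<and> ent v k c y \<and> x = inv (h \<otimes> inv g) \<otimes> y) \<or> (\<exists>y. r \<notin> {k, i'} \<and> r \<in> {1..n} \<and> ent v
          r c y \<and> x = \<one> \<otimes> y)"
      unfolding ent_mult[OF s] ent_swp[OF i'[symmetric]] by blast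
    also have "\<dots> \<longleftrightarrow> r = k \<and> c = i \<and> x = h \<or> r = i' \<and> c = k \<and> x = g \<otimes> inv h \<or> r \<notin> {k, i'} \<and> ent v r c x"
      unfolding vi' vk2 xe using x[of r c x] assms(5) g 1 2 by auto
    finally show ?thesis .
  qed
  \<comment> \<open>An entry of \<open>v\<close> avoids the two exceptional columns iff it avoids
    the two exceptional rows, so the two descriptions agree.\<close>
  moreover have "ent v r c x \<Longrightarrow> c \<notin> {k, i} \<longleftrightarrow> r \<notin> {k, i'}"
    using vi vi' vk1 vk2 by auto
  ultimately show "ent (v \<cdot> swp k i h) r c x \<longleftrightarrow> ent (swp k i' (h \<otimes> inv g) \<cdot> v) r c x"
    by blast
qed

text \<open>
  Conjugation by the partial bijections defined on all of the support of \<open>\<gamma>\<close>; allowing these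
  besides the units avoids extending partial bijections to permutations.
\<close>

definition orb :: "'g gmat \<Rightarrow> 'g gmat set" where
  "orb \<gamma> = {v \<cdot> \<gamma> \<cdot> star v |v. v \<in> Mon' \<and> dm \<gamma> \<union> rn \<gamma> \<subseteq> dm v}"

definition bal :: "'g gmat \<Rightarrow> bool" where
  "bal \<gamma> \<longleftrightarrow> dm \<gamma> \<inter> {m<..} = rn \<gamma> \<inter> {m<..}"

text \<open>Zero columns do not count here, in contrast to \<open>gmat_deg\<close>.\<close>

definition moved :: "'g gmat \<Rightarrow> nat set" where
  "moved \<gamma> = {j \<in> dm \<gamma>. m < j \<and> \<not> ent \<gamma> j j \<one>}"

lemma orbE:
  assumes "\<tau> \<in> orb \<gamma>"
  obtains v where "v \<in> Mon'" "dm \<gamma> \<subseteq> dm v" "rn \<gamma> \<subseteq> dm v" "\<tau> = v \<cdot> \<gamma> \<cdot> star v"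
  using assms by (auto simp: orb_def)

lemma orbI: "v \<in> Mon' \<Longrightarrow> dm \<gamma> \<subseteq> dm v \<Longrightarrow> rn \<gamma> \<subseteq> dm v \<Longrightarrow> \<tau> = v \<cdot> \<gamma> \<cdot> star v \<Longrightarrow> \<tau> \<in> orb \<gamma>"
  by (auto simp: orb_def)

lemma orb_self: "\<gamma> \<in> Mon \<Longrightarrow> \<gamma> \<in> orb \<gamma>"
  by (rule orbI[of "idm {1..n}"]) (use m_le dm_Gbar[of \<gamma> G n] rn_Gbar[of \<gamma> G n] in auto)

lemma ent_conj:
  assumes "v \<in> Mon" "\<gamma> \<in> Mon" "ent \<gamma> i j x" "ent v i' i a" "ent v j' j b"
  shows "ent (v \<cdot> \<gamma> \<cdot> star v) i' j' (a \<otimes> x \<otimes> inv b)"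
  using assms by (intro ent_multI[OF _ ent_multI] ent_starI) auto

lemma ent_conjE:
  assumes "ent (v \<cdot> \<gamma> \<cdot> star v) i' j' y" "v \<in> Mon" "\<gamma> \<in> Mon"
  obtains i j x a b where "ent \<gamma> i j x" "ent v i' i a" "ent v j' j b" "y = a \<otimes> x \<otimes> inv b"
  using assms by (auto simp: ent_mult ent_star)

text \<open>The conjugating matrix is \<open>b \<cdot> v\<close>. It is defined on the support of
  \<gamma> because \<open>v\<close> carries that support into the support of \<tau>, where
  \<open>b\<close> is defined.\<close>

lemma orb_trans:
  assumes "\<gamma> \<in> Mon" "\<tau> \<in> orb \<gamma>" "b \<in> Mon'" "dm \<tau> \<subseteq> dm b" "rn \<tau> \<subseteq> dm b"
  shows "b \<cdot> \<tau> \<cdot> star b \<in> orb \<gamma>"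
proof -
  obtain v where v: "v \<in> Mon'" "dm \<gamma> \<subseteq> dm v" "rn \<gamma> \<subseteq> dm v" "\<tau> = v \<cdot> \<gamma> \<cdot> star v"
    using assms(2) by (rule orbE)
  have M: "v \<in> Mon" "b \<in> Mon" using v assms by auto
  have *: "j \<in> dm (b \<cdot> v)" if j: "j \<in> dm \<gamma> \<union> rn \<gamma>" for j
  proof -
    from j v obtain r y where r: "ent v r j y" by (blast elim: dmE)
    have "r \<in> dm \<tau> \<union> rn \<tau>"
      using j
    proof
      assume "j \<in> dm \<gamma>"
      then obtain i x where g: "ent \<gamma> i j x" by (blast elim: dmE)
      then obtain i' a where "ent v i' i a" using v by (blast elim: dmE intro: rnI)
      from ent_conj[OF M(1) assms(1) g this r] v(4) show ?thesis by (auto intro: dmI)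
    next
      assume "j \<in> rn \<gamma>"
      then obtain i x where g: "ent \<gamma> j i x" by (blast elim: rnE)
      then obtain i' a where "ent v i' i a" using v by (blast elim: dmE intro: dmI)
      from ent_conj[OF M(1) assms(1) g r this] v(4) show ?thesis by (auto intro: rnI)
    qed
    then obtain q z where "ent b q r z" using assms(4,5) by (blast elim: dmE)
    from ent_multI[OF M(2) this r refl] show ?thesis by (rule dmI)
  qed
  have "b \<cdot> \<tau> \<cdot> star b = (b \<cdot> v) \<cdot> \<gamma> \<cdot> star (b \<cdot> v)"
    using M assms(1) v(4) by (simp add: mult_assoc star_mult)
  thus ?thesis
    by (intro orbI[of "b \<cdot> v"]) (use * v(1) assms(3) in auto)
qed

text \<open>A moved index of \<tau> comes through \<open>v\<close> from an index of \<gamma> beyond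
  \<open>m\<close>, as \<open>v\<close> fixes the first \<open>m\<close>. That index is moved too: a
  diagonal entry \<open>\<one>\<close> stays \<open>\<one>\<close> under conjugation. Injectivity of
  \<open>v\<close> gives the inequality.\<close>

lemma card_moved_orb:
  assumes "\<gamma> \<in> Mon" "\<tau> \<in> orb \<gamma>"
  shows "card (moved \<tau>) \<le> card (moved \<gamma>)"
proof -
  obtain v where v: "v \<in> Mon'" "\<tau> = v \<cdot> \<gamma> \<cdot> star v"
    using assms(2) by (rule orbE)
  have M: "v \<in> Mon" using v by auto
  have "\<exists>j \<in> moved \<gamma>. \<exists>y. ent v r j y" if r: "r \<in> moved \<tau>" for r
  proof -
    from r obtain q x where "ent \<tau> q r x" and rm: "m < r" "\<not> ent \<tau> r r \<one>"
      by (auto simp: moved_def elim: dmE)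
    then obtain i j y a b where *: "ent \<gamma> i j y" "ent v q i a" "ent v r j b"
      using v(2) M assms(1) by (blast elim: ent_conjE)
    have "m < j" using Mon'_fixed[OF v(1) *(3)] rm(1) by (metis not_less)
    moreover have "\<not> ent \<gamma> j j \<one>"
    proof
      assume "ent \<gamma> j j \<one>"
      from ent_conj[OF M assms(1) this *(3,3)] have "ent \<tau> r r \<one>"
        using v(2) Gbar_entry(3)[OF M *(3)] by simp
      thus False using rm by simp
    qed
    ultimately show ?thesis using * by (auto simp: moved_def intro: dmI)
  qed
  then obtain f where f: "\<And>r. r \<in> moved \<tau> \<Longrightarrow> f r \<in> moved \<gamma> \<and> (\<exists>y. ent v r (f r) y)" by metis
  show ?thesis
  proof (rule card_inj_on_le)
    show "inj_on f (moved \<tau>)"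
      by (rule inj_onI) (metis f Gbar_col[OF M])
    show "f ` moved \<tau> \<subseteq> moved \<gamma>" using f by blast
    show "finite (moved \<gamma>)"
      by (rule finite_subset[of _ "{1..n}"]) (use dm_Gbar[OF assms(1)] in \<open>auto simp: moved_def\<close>)
  qed
qed

section \<open>Coordinates of centralizing elements\<close>

abbreviation Zb :: "('g gmat \<Rightarrow>\<^sub>0 'f::field) set" where
  "Zb \<equiv> {\<alpha> \<in> FM. \<forall>\<gamma> \<in> Mon'. \<alpha> \<star> basis \<gamma> = basis \<gamma> \<star> \<alpha>}"

text \<open>Both sides of the equation between \<alpha> times \<open>v\<close> and \<open>v\<close>
  times \<alpha> are evaluated at \<open>v \<cdot> \<gamma>\<close>: one translates this to the
  conjugate \<tau>, the other back to \<gamma>.\<close>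

lemma hat_invariant:
  assumes "\<alpha> \<in> Zb" "\<gamma> \<in> Mon" "\<tau> \<in> orb \<gamma>"
  shows "hat \<alpha> \<tau> = hat \<alpha> \<gamma>"
proof -
  obtain v where v: "v \<in> Mon'" "dm \<gamma> \<subseteq> dm v" "rn \<gamma> \<subseteq> dm v" "\<tau> = v \<cdot> \<gamma> \<cdot> star v"
    using assms(3) by (rule orbE)
  have M: "v \<in> Mon" using v by auto
  have a: "\<alpha> \<in> FM" using assms(1) by simp
  have "hat (basis v \<star> \<alpha>) (v \<cdot> \<gamma>) = hat \<alpha> (star v \<cdot> (v \<cdot> \<gamma>))"
    using hat_mult_left[OF a M mult_closed[OF M assms(2)]] rn_mult[OF M, of \<gamma>] by simp
  also have "star v \<cdot> (v \<cdot> \<gamma>) = \<gamma>"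
    using M assms(2) v(3) dm_Gbar[OF M] by (simp add: mult_assoc[symmetric] star_mult_self idm_mult)
  finally have 1: "hat (basis v \<star> \<alpha>) (v \<cdot> \<gamma>) = hat \<alpha> \<gamma>" .
  have "hat (\<alpha> \<star> basis v) (v \<cdot> \<gamma>) = hat \<alpha> \<tau>"
    using hat_mult_right[OF a M mult_closed[OF M assms(2)]] dm_mult[OF M, of \<gamma>] v by auto
  moreover have "\<alpha> \<star> basis v = basis v \<star> \<alpha>" using assms(1) v(1) by blast
  ultimately show ?thesis using 1 by simp
qed

text \<open>For \<open>i > m\<close> the idempotent \<epsilon>_i lies in \<open>Mon'\<close>. From
  the left it kills the coordinate at \<gamma> if row \<open>i\<close> is nonzero, from the right if
  column \<open>i\<close> is; commutation makes the two conditions equivalent.\<close>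

lemma hat_balanced:
  assumes "\<alpha> \<in> Zb" "\<gamma> \<in> Mon" "hat \<alpha> \<gamma> \<noteq> 0"
  shows "bal \<gamma>"
proof -
  have a: "\<alpha> \<in> FM" using assms(1) by simp
  have d: "dm \<gamma> \<subseteq> {1..n}" "rn \<gamma> \<subseteq> {1..n}" using dm_Gbar[OF assms(2)] rn_Gbar[OF assms(2)] by auto
  have "i \<in> dm \<gamma> \<longleftrightarrow> i \<in> rn \<gamma>" if i: "m < i" for i
  proof -
    define e where "e = idm ({1..n} - {i})"
    have e: "e \<in> Mon'" unfolding e_def using i m_le by (intro Mon'_idm) auto
    have "hat (basis e \<star> \<alpha>) \<gamma> = (if i \<in> rn \<gamma> then 0 else hat \<alpha> \<gamma>)"
      using hat_mult_left[OF a Mon'_Mon[OF e] assms(2)] idm_mult[OF _ assms(2), of "{1..n} - {i}"] d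
      by (auto simp: e_def)
    moreover have "hat (\<alpha> \<star> basis e) \<gamma> = (if i \<in> dm \<gamma> then 0 else hat \<alpha> \<gamma>)"
      using hat_mult_right[OF a Mon'_Mon[OF e] assms(2)] mult_idm[OF assms(2), of "{1..n} - {i}"] d
      by (auto simp: e_def)
    moreover have "\<alpha> \<star> basis e = basis e \<star> \<alpha>" using assms(1) e by blast
    ultimately show ?thesis using assms(3) by (auto split: if_splits)
  qed
  thus ?thesis by (auto simp: bal_def)
qed

lemma ZbI: "\<alpha> \<in> FM \<Longrightarrow> (\<And>\<gamma>. \<gamma> \<in> Mon' \<Longrightarrow> \<alpha> \<star> basis \<gamma> = basis \<gamma> \<star> \<alpha>) \<Longrightarrow> \<alpha> \<in> Zb"
  by simp

text \<open>The two sides count the terms of u_k \<gamma> and of \<gamma> u_k at the coordinate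
  \<tau>. By \<open>Mon'_swp\<close> the pair (i, h) on the right corresponds to (i', h g^-1) on the
  left, where \<gamma> carries i to i' with label g.\<close>

lemma u_elem_commutes:
  fixes k
  assumes k: "k \<in> {1..m}" and g: "\<gamma> \<in> Mon'" and t: "\<tau> \<in> Mon"
  defines "I \<equiv> {k+1..n}"
  shows "card {p \<in> I \<times> carrier G. k \<in> rn \<tau> \<and> fst p \<in> rn \<tau> \<and> sub (swp k (fst p) (snd p) \<cdot> \<tau>) \<gamma>} =
    card {p \<in> I \<times> carrier G. rn \<tau> \<subseteq> rn \<gamma> \<and> k \<in> rn (star \<gamma> \<cdot> \<tau>) \<and> fst p \<in> rn (star \<gamma> \<cdot> \<tau>) \<and>
      sub (swp k (fst p) (snd p) \<cdot> (star \<gamma> \<cdot> \<tau>)) (one_gmat G n)}"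
    (is "card ?L = card ?R")
proof -
  have M: "\<gamma> \<in> Mon" using g by simp
  have kn: "k \<in> {1..n}" using k m_le by auto
  have swp: "swp k i h \<in> Mon" "star (swp k i h) = swp k i h" "rn (swp k i h) = {1..n}"
    if "i \<in> I" "h \<in> carrier G" for i h
    using that kn by (auto simp: I_def)
  have kI: "k \<noteq> i" if "i \<in> I" for i using that by (auto simp: I_def)
  \<comment> \<open>\<open>L\<close> and \<open>R\<close> bring the two counting conditions to the
    form of \<tau> lying below \<open>swp k i h \<cdot> \<gamma>\<close> and below
    \<open>\<gamma> \<cdot> swp k i h\<close>.\<close>
  have L: "sub (swp k i h \<cdot> \<tau>) \<gamma> \<longleftrightarrow> sub \<tau> (swp k i h \<cdot> \<gamma>)" if "i \<in> I" "h \<in> carrier G" for i h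
    unfolding sub_mult_left[OF swp(1)[OF that] M t] swp(2,3)[OF that] using rn_Gbar[OF t] by simp
  have R: "rn \<tau> \<subseteq> rn \<gamma> \<and> sub (swp k i h \<cdot> (star \<gamma> \<cdot> \<tau>)) (one_gmat G n) \<longleftrightarrow> sub \<tau> (\<gamma> \<cdot> swp k i h)"
    if "i \<in> I" "h \<in> carrier G" for i h
  proof -
    have "sub (star \<gamma> \<cdot> \<tau>) (swp k i h \<cdot> one_gmat G n) \<longleftrightarrow> sub (swp k i h \<cdot> (star \<gamma> \<cdot> \<tau>)) (one_gmat G n)"
      using sub_mult_left[OF swp(1)[OF that], of "one_gmat G n" "star \<gamma> \<cdot> \<tau>"] swp(2,3)[OF that]
        rn_Gbar[of "star \<gamma> \<cdot> \<tau>" G n] M t by (simp add: one_gmat_idm)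
    thus ?thesis
      using sub_mult_left[OF M swp(1)[OF that] t] swp(1)[OF that] by (simp add: one_gmat_idm)
  qed
  have k1: "k \<in> rn (star \<gamma> \<cdot> \<tau>) \<longleftrightarrow> k \<in> rn \<tau>"
  proof
    assume "k \<in> rn (star \<gamma> \<cdot> \<tau>)"
    then obtain j x where "ent (star \<gamma> \<cdot> \<tau>) k j x" by (rule rnE)
    then obtain r y z where "ent (star \<gamma>) k r y" "ent \<tau> r j z"
      using star_closed[OF M] by (blast elim: ent_multE)
    thus "k \<in> rn \<tau>" using Mon'_fixed(1)[OF Mon'_star[OF g], of k r y] k by (auto intro: rnI)
  next
    assume "k \<in> rn \<tau>"
    then obtain j x where "ent \<tau> k j x" by (rule rnE)
    moreover have "ent (star \<gamma>) k k \<one>" using Mon'_star[OF g] k by (auto simp: Mon'_iff)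
    ultimately show "k \<in> rn (star \<gamma> \<cdot> \<tau>)" using M by (blast intro: rnI ent_multI)
  qed
  have i1: "i \<in> rn (star \<gamma> \<cdot> \<tau>) \<longleftrightarrow> (\<exists>i' g. ent \<gamma> i' i g \<and> i' \<in> rn \<tau>)" for i
  proof
    assume "i \<in> rn (star \<gamma> \<cdot> \<tau>)"
    then obtain j x where "ent (star \<gamma> \<cdot> \<tau>) i j x" by (rule rnE)
    then obtain r y z where "ent (star \<gamma>) i r y" "ent \<tau> r j z"
      using star_closed[OF M] by (blast elim: ent_multE)
    thus "\<exists>i' g. ent \<gamma> i' i g \<and> i' \<in> rn \<tau>" unfolding ent_star by (blast intro: rnI)
  next
    assume "\<exists>i' g. ent \<gamma> i' i g \<and> i' \<in> rn \<tau>"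
    then obtain i' g j x where "ent \<gamma> i' i g" "ent \<tau> i' j x" by (blast elim: rnE)
    thus "i \<in> rn (star \<gamma> \<cdot> \<tau>)" using star_closed[OF M] by (blast intro: rnI ent_multI ent_starI)
  qed
  \<comment> \<open>The summation range is preserved: \<gamma> either fixes an index or moves it
    from beyond \<open>m\<close> to beyond \<open>m\<close>, and \<open>k \<le> m\<close>.\<close>
  have I: "i \<in> I \<longleftrightarrow> i' \<in> I" "i \<noteq> k" if "i \<in> I \<or> i' \<in> I" "ent \<gamma> i' i g" for i i' g
  proof -
    from that(2) have n: "i \<in> {1..n}" "i' \<in> {1..n}" using Gbar_entry[OF M] by blast+
    have "i = i' \<or> m < i \<and> m < i'" using Mon'_fixed(1)[OF g that(2)] by (metis not_less)
    hence *: "k < i \<longleftrightarrow> k < i'" using k by auto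
    show "i \<in> I \<longleftrightarrow> i' \<in> I" using n * unfolding I_def by (simp add: Suc_le_eq)
    thus "i \<noteq> k" using that(1) unfolding I_def by auto
  qed
  define rel where "rel p q \<longleftrightarrow> (\<exists>g. ent \<gamma> (fst q) (fst p) g \<and> snd q = snd p \<otimes> inv g \<and> snd p \<in> carrier G)"
    for p q :: "nat \<times> 'g"
  have "card ?R = card ?L"
  proof (rule card_eq_of_relation[where R = rel])
    fix p assume p: "p \<in> ?R"
    obtain i h where ph: "p = (i, h)" by (cases p)
    from p have i: "i \<in> I" "h \<in> carrier G" "k \<in> rn \<tau>" "i \<in> rn (star \<gamma> \<cdot> \<tau>)" "sub \<tau> (\<gamma> \<cdot> swp k i h)"
      by (auto simp: ph k1 R[symmetric])
    from i(4) obtain i' y where y: "ent \<gamma> i' i y" "i' \<in> rn \<tau>" by (auto simp: i1)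
    have yc: "y \<in> carrier G" using Gbar_entry(3)[OF M y(1)] .
    have i': "i' \<in> I" "i \<noteq> k" using I[OF _ y(1)] i by auto
    have hc: "h \<otimes> inv y \<in> carrier G" using yc i by simp
    have "sub \<tau> (swp k i' (h \<otimes> inv y) \<cdot> \<gamma>)"
      using i(5) unfolding Mon'_swp[OF g y(1) k i'(2) i(2)] .
    hence "(i', h \<otimes> inv y) \<in> ?L" using i' i y hc by (simp add: L)
    moreover have "rel p (i', h \<otimes> inv y)" using y i by (auto simp: rel_def ph)
    ultimately show "\<exists>q \<in> ?L. rel p q" by blast
  next
    fix q assume q: "q \<in> ?L"
    obtain i' h' where qh: "q = (i', h')" by (cases q)
    from q have i': "i' \<in> I" "h' \<in> carrier G" "k \<in> rn \<tau>" "i' \<in> rn \<tau>" "sub \<tau> (swp k i' h' \<cdot> \<gamma>)"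
      by (auto simp: qh L[symmetric])
    \<comment> \<open>That row \<open>i'\<close> of \<gamma> is nonzero has to be extracted from row
      \<open>k\<close> of \<tau>: there \<tau> agrees with
      \<open>swp k i' h' \<cdot> \<gamma>\<close>, whose row \<open>k\<close> is row
      \<open>i'\<close> of \<gamma> up to a label.\<close>
    from i'(3) obtain i z where z: "ent \<tau> k i z" by (rule rnE)
    hence "ent (swp k i' h' \<cdot> \<gamma>) k i z" using i'(5) unfolding sub_def by blast
    then obtain y where y: "ent \<gamma> i' i y"
      using swp(1)[OF i'(1,2)] kI[OF i'(1)] by (auto simp: ent_mult ent_swp)
    have yc: "y \<in> carrier G" using Gbar_entry(3)[OF M y(1)] .
    have i: "i \<in> I" "i \<noteq> k" using I[OF _ y] i'(1) by auto
    have hy: "h' \<otimes> y \<in> carrier G" "(h' \<otimes> y) \<otimes> inv y = h'" using yc i'(2) by (auto simp: m_assoc)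
    have "sub \<tau> (\<gamma> \<cdot> swp k i (h' \<otimes> y))"
      unfolding Mon'_swp[OF g y k i(2) hy(1)] hy(2) using i'(5) .
    moreover have "k \<in> rn (star \<gamma> \<cdot> \<tau>)" using i'(3) k1 by blast
    moreover have "i \<in> rn (star \<gamma> \<cdot> \<tau>)" using i'(4) y i1 by blast
    ultimately have "(i, h' \<otimes> y) \<in> ?R"
      using i(1) hy(1) R[OF i(1) hy(1)] by simp
    moreover have "rel (i, h' \<otimes> y) q" using y hy by (auto simp: rel_def qh)
    ultimately show "\<exists>p \<in> ?R. rel p q" by blast
  next
    fix p q q' assume "rel p q" "rel p q'"
    then obtain y y' where y: "ent \<gamma> (fst q) (fst p) y" "snd q = snd p \<otimes> inv y"
      "ent \<gamma> (fst q') (fst p) y'" "snd q' = snd p \<otimes> inv y'" by (auto simp: rel_def)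
    have "fst q = fst q'" using Gbar_col[OF M y(1,3)] .
    thus "q = q'" using y ent_fun by (metis prod_eqI)
  next
    fix p p' q assume "rel p q" "rel p' q"
    then obtain y y' where y: "ent \<gamma> (fst q) (fst p) y" "snd q = snd p \<otimes> inv y" "snd p \<in> carrier G"
      "ent \<gamma> (fst q) (fst p') y'" "snd q = snd p' \<otimes> inv y'" "snd p' \<in> carrier G" by (auto simp: rel_def)
    have f: "fst p = fst p'" using Gbar_row[OF M y(1,4)] .
    hence "y = y'" using y ent_fun by metis
    hence "snd p = snd p'" using y Gbar_entry(3)[OF M y(1)] by (metis inv_closed right_cancel)
    thus "p = p'" using f by (simp add: prod_eqI)
  qed
  thus ?thesis by simp
qed

lemma u_elem_Zb:
  assumes k: "k \<in> {1..m}"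
  shows "(u_elem G n k :: 'g gmat \<Rightarrow>\<^sub>0 'f::field) \<in> Zb"
proof (rule ZbI)
  have kn: "k \<in> {1..n}" using k m_le by auto
  let ?u = "u_elem G n k :: 'g gmat \<Rightarrow>\<^sub>0 'f"
  show u: "?u \<in> FM" by (rule u_elem_FM[OF kn])
  fix \<gamma> assume g: "\<gamma> \<in> Mon'"
  hence M: "\<gamma> \<in> Mon" by simp
  have b: "basis \<gamma> \<in> FM" using M by simp
  show "?u \<star> basis \<gamma> = basis \<gamma> \<star> ?u"
  proof (rule hat_eqI[OF order_refl])
    show "Poly_Mapping.keys (?u \<star> basis \<gamma>) \<subseteq> Mon" "Poly_Mapping.keys (basis \<gamma> \<star> ?u) \<subseteq> Mon"
      using conv_closed[OF u b] conv_closed[OF b u] by (auto simp: FM_def)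
    fix \<tau> assume t: "\<tau> \<in> Mon"
    have "hat (?u \<star> basis \<gamma>) \<tau> = (\<Sum>i = k+1..n. \<Sum>h \<in> carrier G.
        if k \<in> rn \<tau> \<and> i \<in> rn \<tau> \<and> sub (swp k i h \<cdot> \<tau>) \<gamma> then 1 else 0)"
      unfolding hat_u_mult[OF kn b t] hat_single by (intro sum.cong refl) auto
    also have "\<dots> = of_nat (card {p \<in> {k+1..n} \<times> carrier G. k \<in> rn \<tau> \<and> fst p \<in> rn \<tau> \<and> sub (swp k
        (fst p) (snd p) \<cdot> \<tau>) \<gamma>})"
      using finite_G by (intro sum_sum_indicator) auto
    also have "\<dots> = of_nat (card {p \<in> {k+1..n} \<times> carrier G. rn \<tau> \<subseteq> rn \<gamma> \<and> k \<in> rn (star \<gamma> \<cdot> \<tau>) \<and> fst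
        p \<in> rn (star \<gamma> \<cdot> \<tau>) \<and>
      sub (swp k (fst p) (snd p) \<cdot> (star \<gamma> \<cdot> \<tau>)) (one_gmat G n)})"
      by (rule arg_cong[OF u_elem_commutes[OF k g t]])
    also have "\<dots> = (\<Sum>i = k+1..n. \<Sum>h \<in> carrier G. if rn \<tau> \<subseteq> rn \<gamma> \<and> k \<in> rn (star \<gamma> \<cdot> \<tau>) \<and> i \<in> rn
        (star \<gamma> \<cdot> \<tau>) \<and>
      sub (swp k i h \<cdot> (star \<gamma> \<cdot> \<tau>)) (one_gmat G n) then 1 else 0)"
      using finite_G by (intro sum_sum_indicator[symmetric]) auto
    \<comment> \<open>\<open>hat_u_mult\<close> speaks of products, so u_k is read as its product
      with the identity.\<close>
    also have "\<dots> = (if rn \<tau> \<subseteq> rn \<gamma> then hat (?u \<star> basis (one_gmat G n)) (star \<gamma> \<cdot> \<tau>) else 0)"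
    proof -
      have o: "basis (one_gmat G n) \<in> FM" "star \<gamma> \<cdot> \<tau> \<in> Mon" using M t by (auto simp: one_gmat_idm)
      show ?thesis
        unfolding hat_u_mult[OF kn o] hat_single
        by (cases "rn \<tau> \<subseteq> rn \<gamma>") (auto intro!: sum.cong)
    qed
    also have "\<dots> = hat (basis \<gamma> \<star> ?u) \<tau>"
      unfolding hat_mult_left[OF u M t] basis_one_right[OF u] ..
    finally show "hat (?u \<star> basis \<gamma>) \<tau> = hat (basis \<gamma> \<star> ?u) \<tau>" .
  qed
qed

section \<open>Block-diagonal matrices\<close>

abbreviation emb :: "'g gmat \<Rightarrow> 'g gmat" where "emb \<equiv> embed_gmat G m n"

text \<open>The first block is overwritten by an identity and entries linking the two blocks are
  dropped, so that the result lies in \<open>Mon'\<close> for every \<gamma> in \<open>Mon\<close>,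
  block diagonal or not.\<close>

definition low :: "'g gmat \<Rightarrow> 'g gmat" where
  "low \<gamma> = (\<lambda>i j. if i \<le> m \<or> j \<le> m then (if i = j \<and> i \<in> {1..m} then Some \<one> else None) else \<gamma> i j)"

definition blk :: "'g gmat \<Rightarrow> bool" where
  "blk \<gamma> \<longleftrightarrow> (\<forall>i j x. ent \<gamma> i j x \<longrightarrow> (i \<le> m \<longleftrightarrow> j \<le> m))"

lemma ent_low: "ent (low \<gamma>) i j x \<longleftrightarrow> i = j \<and> i \<in> {1..m} \<and> x = \<one> \<or> m < i \<and> m < j \<and> ent \<gamma> i j x"
  by (auto simp: ent_def low_def)

lemma ent_corner: "ent (corner m \<gamma>) i j x \<longleftrightarrow> i \<in> {1..m} \<and> j \<in> {1..m} \<and> ent \<gamma> i j x"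
  by (auto simp: ent_def corner_def)

lemma ent_emb:
  assumes "\<delta> \<in> Gbar G m"
  shows "ent (emb \<delta>) i j x \<longleftrightarrow> i = j \<and> i \<in> {m+1..n} \<and> x = \<one> \<or> ent \<delta> i j x"
proof -
  have "\<not> ent \<delta> i i y" if "i \<in> {m+1..n}" for y
    using Gbar_entry(1)[OF assms, of i i y] that by auto
  thus ?thesis
    by (auto simp: ent_def embed_gmat_def)
qed

lemma low_Mon': "\<gamma> \<in> Mon \<Longrightarrow> low \<gamma> \<in> Mon'"
  unfolding Mon'_iff
  by (intro conjI GbarI) (use m_le in \<open>auto simp: ent_low dest: Gbar_entry Gbar_row Gbar_col\<close>)

lemma corner_Gbar: "\<gamma> \<in> Mon \<Longrightarrow> corner m \<gamma> \<in> Gbar G m"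
  by (rule GbarI) (auto simp: ent_corner dest: Gbar_entry(3) Gbar_row Gbar_col)

lemma emb_Mon: 
  assumes "\<delta> \<in> Gbar G m"
  shows "emb \<delta> \<in> Mon"
proof (rule GbarI)
  fix i j x assume "ent (emb \<delta>) i j x"
  thus "i \<in> {1..n} \<and> j \<in> {1..n} \<and> x \<in> carrier G"
    using m_le Gbar_entry[OF assms, of i j x] by (auto simp: ent_emb[OF assms])
next
  fix i j k x y assume "ent (emb \<delta>) i j x" "ent (emb \<delta>) i k y"
  thus "j = k"
    using Gbar_entry[OF assms, of i j x] Gbar_entry[OF assms, of i k y] Gbar_row[OF assms, of i j x k y]
    by (auto simp: ent_emb[OF assms])
next
  fix i j k x y assume "ent (emb \<delta>) i k x" "ent (emb \<delta>) j k y"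
  thus "i = j"
    using Gbar_entry[OF assms, of i k x] Gbar_entry[OF assms, of j k y] Gbar_col[OF assms, of i k x j y]
    by (auto simp: ent_emb[OF assms])
qed

text \<open>\<open>emb \<delta>\<close> is the identity beyond \<open>m\<close> and \<epsilon> is
  the identity up to \<open>m\<close>, so their product is a block sum. The reverse order yields the
  same entries, hence \<open>emb_commute\<close>.\<close>

lemma ent_emb_mult:
  assumes d: "\<delta> \<in> Gbar G m" and e: "\<epsilon> \<in> Mon'"
  shows "ent (emb \<delta> \<cdot> \<epsilon>) i j x \<longleftrightarrow> ent \<delta> i j x \<or> m < i \<and> m < j \<and> ent \<epsilon> i j x"
proof
  assume "ent (emb \<delta> \<cdot> \<epsilon>) i j x"
  then obtain k g h where *: "ent (emb \<delta>) i k g" "ent \<epsilon> k j h" "x = g \<otimes> h"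
    using emb_Mon[OF d] by (blast elim: ent_multE)
  from *(1) consider "ent \<delta> i k g" | "i = k" "i \<in> {m+1..n}" "g = \<one>" by (auto simp: ent_emb[OF d])
  thus "ent \<delta> i j x \<or> m < i \<and> m < j \<and> ent \<epsilon> i j x"
  proof cases
    case 1
    hence "k \<le> m" using Gbar_entry(2)[OF d] by auto
    hence "j = k" "h = \<one>" using Mon'_fixed[OF e *(2)] by auto
    thus ?thesis using 1 *(3) Gbar_entry(3)[OF d 1] by simp
  next
    case 2
    hence "x = h" using * Gbar_entry(3)[OF Mon'_Mon[OF e] *(2)] by simp
    moreover have "m < j" using Mon'_fixed[OF e *(2)] 2 by force
    ultimately show ?thesis using 2 * by auto
  qed
next
  assume "ent \<delta> i j x \<or> m < i \<and> m < j \<and> ent \<epsilon> i j x"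
  thus "ent (emb \<delta> \<cdot> \<epsilon>) i j x"
  proof
    assume x: "ent \<delta> i j x"
    hence "ent \<epsilon> j j \<one>" using Gbar_entry(2)[OF d x] e by (auto simp: Mon'_iff)
    thus ?thesis
      using x Gbar_entry(3)[OF d x] by (intro ent_multI[OF emb_Mon[OF d], of i j x]) (auto simp:
          ent_emb[OF d])
  next
    assume x: "m < i \<and> m < j \<and> ent \<epsilon> i j x"
    hence "i \<le> n" "x \<in> carrier G" using Gbar_entry[OF Mon'_Mon[OF e], of i j x] by auto
    thus ?thesis
      using x by (intro ent_multI[OF emb_Mon[OF d], of i i \<one>]) (auto simp: ent_emb[OF d])
  qed
qed

lemma ent_mult_emb:
  assumes d: "\<delta> \<in> Gbar G m" and e: "\<epsilon> \<in> Mon'"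
  shows "ent (\<epsilon> \<cdot> emb \<delta>) i j x \<longleftrightarrow> ent \<delta> i j x \<or> m < i \<and> m < j \<and> ent \<epsilon> i j x"
proof
  assume "ent (\<epsilon> \<cdot> emb \<delta>) i j x"
  then obtain k g h where *: "ent \<epsilon> i k g" "ent (emb \<delta>) k j h" "x = g \<otimes> h"
    using e by (blast elim: ent_multE dest: Mon'_Mon)
  from *(2) consider "ent \<delta> k j h" | "k = j" "j \<in> {m+1..n}" "h = \<one>" by (auto simp: ent_emb[OF d])
  thus "ent \<delta> i j x \<or> m < i \<and> m < j \<and> ent \<epsilon> i j x"
  proof cases
    case 1
    hence "k \<le> m" using Gbar_entry(1)[OF d] by auto
    hence "i = k" "g = \<one>" using Mon'_fixed[OF e *(1)] by auto
    thus ?thesis using 1 *(3) Gbar_entry(3)[OF d 1] by simp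
  next
    case 2
    hence "x = g" using * Gbar_entry(3)[OF Mon'_Mon[OF e] *(1)] by simp
    moreover have "m < i" using Mon'_fixed[OF e *(1)] 2 by force
    ultimately show ?thesis using 2 * by auto
  qed
next
  assume "ent \<delta> i j x \<or> m < i \<and> m < j \<and> ent \<epsilon> i j x"
  thus "ent (\<epsilon> \<cdot> emb \<delta>) i j x"
  proof
    assume x: "ent \<delta> i j x"
    hence "ent \<epsilon> i i \<one>" using Gbar_entry(1)[OF d x] e by (auto simp: Mon'_iff)
    thus ?thesis
      using x Gbar_entry(3)[OF d x] by (intro ent_multI[OF Mon'_Mon[OF e], of i i \<one>]) (auto simp:
          ent_emb[OF d])
  next
    assume x: "m < i \<and> m < j \<and> ent \<epsilon> i j x"
    hence "j \<le> n" "x \<in> carrier G" using Gbar_entry[OF Mon'_Mon[OF e], of i j x] by auto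
    thus ?thesis
      using x by (intro ent_multI[OF Mon'_Mon[OF e], of i j x]) (auto simp: ent_emb[OF d])
  qed
qed

lemma emb_commute: "\<delta> \<in> Gbar G m \<Longrightarrow> v \<in> Mon' \<Longrightarrow> emb \<delta> \<cdot> v = v \<cdot> emb \<delta>"
  by (rule gmat_eqI) (simp add: ent_mult_emb ent_emb_mult)

lemma lin_ext_emb_FM: "Poly_Mapping.keys x \<subseteq> Gbar G m \<Longrightarrow> lin_ext emb x \<in> FM"
  using keys_lin_ext[of emb x] emb_Mon by (auto simp: FM_def)

lemma lin_ext_emb_Zb:
  assumes "Poly_Mapping.keys x \<subseteq> Gbar G m"
  shows "lin_ext emb x \<in> Zb"
proof (rule ZbI[OF lin_ext_emb_FM[OF assms]])
  fix \<gamma> assume "\<gamma> \<in> Mon'"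
  with assms show "lin_ext emb x \<star> basis \<gamma> = basis \<gamma> \<star> lin_ext emb x"
    by (induction x rule: keys_subset_induct)
      (auto simp: lin_ext_add conv_add_left conv_add_right conv_single emb_commute)
qed

lemma blk_decomp:
  assumes g: "\<gamma> \<in> Mon" and b: "blk \<gamma>"
  shows "emb (corner m \<gamma>) \<cdot> low \<gamma> = \<gamma>"
proof (rule gmat_eqI)
  fix i j x
  have "i \<in> {1..n} \<and> j \<in> {1..n} \<and> (i \<le> m \<longleftrightarrow> j \<le> m)" if "ent \<gamma> i j x"
    using Gbar_entry(1,2)[OF g that] b that unfolding blk_def by blast
  thus "ent (emb (corner m \<gamma>) \<cdot> low \<gamma>) i j x \<longleftrightarrow> ent \<gamma> i j x"
    unfolding ent_emb_mult[OF corner_Gbar[OF g] low_Mon'[OF g]] ent_corner ent_low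
    by (cases "ent \<gamma> i j x") auto
qed

lemma emb_mult_parts:
  assumes "\<delta> \<in> Gbar G m" "\<epsilon> \<in> Mon'"
  shows "blk (emb \<delta> \<cdot> \<epsilon>)" "corner m (emb \<delta> \<cdot> \<epsilon>) = \<delta>" "low (emb \<delta> \<cdot> \<epsilon>) = \<epsilon>"
proof -
  have d: "1 \<le> i \<and> i \<le> m \<and> 1 \<le> j \<and> j \<le> m" if "ent \<delta> i j x" for i j x
    using Gbar_entry(1,2)[OF assms(1) that] by auto
  show "blk (emb \<delta> \<cdot> \<epsilon>)"
    unfolding blk_def ent_emb_mult[OF assms] by (auto dest: d)
  show "corner m (emb \<delta> \<cdot> \<epsilon>) = \<delta>"
    by (rule gmat_eqI) (auto simp: ent_corner ent_emb_mult[OF assms] dest: d)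
  show "low (emb \<delta> \<cdot> \<epsilon>) = \<epsilon>"
  proof (rule gmat_eqI)
    fix i j x
    have 1: "i = j \<and> x = \<one>" if "ent \<epsilon> i j x" "i \<le> m \<or> j \<le> m"
      using Mon'_fixed[OF assms(2) that] by blast
    have 2: "i \<in> {1..n} \<and> j \<in> {1..n}" if "ent \<epsilon> i j x"
      using Gbar_entry(1,2)[OF Mon'_Mon[OF assms(2)] that] by simp
    have 3: "ent \<epsilon> i i \<one>" if "i \<in> {1..m}"
      using that assms(2) by (simp add: Mon'_iff)
    have 4: "\<not> ent \<delta> i j x" if "m < i"
      using d[of i j x] that by auto
    show "ent (low (emb \<delta> \<cdot> \<epsilon>)) i j x \<longleftrightarrow> ent \<epsilon> i j x"
      unfolding ent_low ent_emb_mult[OF assms] using 1 2 3 4 by (cases "m < i \<and> m < j") auto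
  qed
qed

lemma sub_emb_mult:
  assumes "\<delta> \<in> Gbar G m" "\<epsilon> \<in> Mon'" "\<tau> \<in> Mon"
  shows "sub \<tau> (emb \<delta> \<cdot> \<epsilon>) \<longleftrightarrow> blk \<tau> \<and> sub (corner m \<tau>) \<delta> \<and> sub (low \<tau>) \<epsilon>"
proof (intro iffI conjI; (elim conjE)?)
  assume s: "sub \<tau> (emb \<delta> \<cdot> \<epsilon>)"
  show "blk \<tau>" using emb_mult_parts(1)[OF assms(1,2)] s unfolding blk_def sub_def by blast
  have "sub (corner m \<tau>) (corner m (emb \<delta> \<cdot> \<epsilon>))" "sub (low \<tau>) (low (emb \<delta> \<cdot> \<epsilon>))"
    using s by (auto simp: sub_def ent_corner ent_low)
  thus "sub (corner m \<tau>) \<delta>" "sub (low \<tau>) \<epsilon>" by (simp_all add: emb_mult_parts[OF assms(1,2)])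
next
  assume s: "blk \<tau>" "sub (corner m \<tau>) \<delta>" "sub (low \<tau>) \<epsilon>"
  have "sub (emb (corner m \<tau>) \<cdot> low \<tau>) (emb \<delta> \<cdot> \<epsilon>)"
    using s(2,3) by (auto simp: sub_def ent_emb_mult assms corner_Gbar low_Mon')
  thus "sub \<tau> (emb \<delta> \<cdot> \<epsilon>)" by (simp add: blk_decomp assms s)
qed

text \<open>The extension order on block sums is componentwise, so coordinates multiply as in a
  tensor product and vanish off block-diagonal matrices.\<close>

lemma hat_emb_mult:
  assumes x: "Poly_Mapping.keys x \<subseteq> Gbar G m" and z: "Poly_Mapping.keys z \<subseteq> Mon'" and t: "\<tau> \<in> Mon"
  shows "hat (lin_ext emb x \<star> z) \<tau> = (if blk \<tau> then hat x (corner m \<tau>) * hat z (low \<tau>) else 0)"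
proof -
  have "hat (Poly_Mapping.single (emb \<delta>) c \<star> z) \<tau> =
      (if blk \<tau> then (if sub (corner m \<tau>) \<delta> then c else 0) * hat z (low \<tau>) else 0)"
    if "\<delta> \<in> Gbar G m" for \<delta> c
    using z by (induction z rule: keys_subset_induct)
      (auto simp: conv_add_right conv_single hat_add hat_single sub_emb_mult that t algebra_simps)
  with x show ?thesis
    by (induction x rule: keys_subset_induct)
      (auto simp: lin_ext_add conv_add_left hat_add hat_single algebra_simps)
qed

section \<open>Orbit sums\<close>

lemma dm_low: "dm (low \<gamma>) \<subseteq> {1..m} \<union> dm \<gamma>" and rn_low: "rn (low \<gamma>) \<subseteq> {1..m} \<union> rn \<gamma>"
  by (auto simp: ent_low elim!: dmE rnE intro: dmI rnI)

lemma dm_sub_low: "blk \<gamma> \<Longrightarrow> \<gamma> \<in> Mon \<Longrightarrow> dm \<gamma> \<subseteq> dm (low \<gamma>)"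
proof
  fix j assume b: "blk \<gamma>" and g: "\<gamma> \<in> Mon" and "j \<in> dm \<gamma>"
  from this(3) obtain i x where x: "ent \<gamma> i j x" by (rule dmE)
  show "j \<in> dm (low \<gamma>)"
  proof (cases "j \<le> m")
    case True
    hence "ent (low \<gamma>) j j \<one>" using Gbar_entry(2)[OF g x] by (simp add: ent_low)
    thus ?thesis by (rule dmI)
  next
    case False
    hence "\<not> i \<le> m" using b x unfolding blk_def by blast
    hence "ent (low \<gamma>) i j x" using x False by (simp add: ent_low)
    thus ?thesis by (rule dmI)
  qed
qed

lemma rn_sub_low: "blk \<gamma> \<Longrightarrow> \<gamma> \<in> Mon \<Longrightarrow> rn \<gamma> \<subseteq> rn (low \<gamma>)"
proof
  fix i assume b: "blk \<gamma>" and g: "\<gamma> \<in> Mon" and "i \<in> rn \<gamma>"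
  from this(3) obtain j x where x: "ent \<gamma> i j x" by (rule rnE)
  show "i \<in> rn (low \<gamma>)"
  proof (cases "i \<le> m")
    case True
    hence "ent (low \<gamma>) i i \<one>" using Gbar_entry(1)[OF g x] by (simp add: ent_low)
    thus ?thesis by (rule rnI)
  next
    case False
    hence "\<not> j \<le> m" using b x unfolding blk_def by blast
    hence "ent (low \<gamma>) i j x" using x False by (simp add: ent_low)
    thus ?thesis by (rule rnI)
  qed
qed

lemma conj_emb_mult:
  assumes "\<delta> \<in> Gbar G m" "\<epsilon> \<in> Mon'" "v \<in> Mon'"
  shows "v \<cdot> (emb \<delta> \<cdot> \<epsilon>) \<cdot> star v = emb \<delta> \<cdot> (v \<cdot> \<epsilon> \<cdot> star v)"
proof -
  have M: "emb \<delta> \<in> Mon" "\<epsilon> \<in> Mon" "v \<in> Mon" "star v \<in> Mon" using assms emb_Mon by auto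
  have "v \<cdot> (emb \<delta> \<cdot> \<epsilon>) \<cdot> star v = (v \<cdot> emb \<delta>) \<cdot> (\<epsilon> \<cdot> star v)"
    using M by (simp add: mult_assoc)
  also have "v \<cdot> emb \<delta> = emb \<delta> \<cdot> v" using emb_commute assms by simp
  also have "emb \<delta> \<cdot> v \<cdot> (\<epsilon> \<cdot> star v) = emb \<delta> \<cdot> (v \<cdot> \<epsilon> \<cdot> star v)"
    using M by (simp add: mult_assoc)
  finally show ?thesis .
qed

text \<open>Conjugation by \<open>Mon'\<close> commutes with the first block and acts only on the
  second. Passing to \<open>low\<close> enlarges supports only by indices up to \<open>m\<close>, on
  which every \<open>v\<close> in \<open>Mon'\<close> is defined.\<close>

lemma orb_blk:
  assumes g: "\<gamma> \<in> Mon" "blk \<gamma>" and t: "\<tau> \<in> Mon"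
  shows "\<tau> \<in> orb \<gamma> \<longleftrightarrow> blk \<tau> \<and> corner m \<tau> = corner m \<gamma> \<and> low \<tau> \<in> orb (low \<gamma>)"
proof
  assume "\<tau> \<in> orb \<gamma>"
  then obtain v where v: "v \<in> Mon'" "dm \<gamma> \<subseteq> dm v" "rn \<gamma> \<subseteq> dm v" "\<tau> = v \<cdot> \<gamma> \<cdot> star v" by (rule orbE)
  let ?c = "low \<gamma>"
  have eq: "\<tau> = emb (corner m \<gamma>) \<cdot> (v \<cdot> ?c \<cdot> star v)"
    using conj_emb_mult[OF corner_Gbar[OF g(1)] low_Mon'[OF g(1)] v(1)] blk_decomp[OF g] v(4) by simp
  have M: "v \<cdot> ?c \<cdot> star v \<in> Mon'" using v low_Mon'[OF g(1)] by blast
  have "v \<cdot> ?c \<cdot> star v \<in> orb ?c"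
    using v dm_low[of \<gamma>] rn_low[of \<gamma>] Mon'_dm[OF v(1)] by (intro orbI[OF v(1) _ _ refl]) blast+
  thus "blk \<tau> \<and> corner m \<tau> = corner m \<gamma> \<and> low \<tau> \<in> orb (low \<gamma>)"
    unfolding eq using emb_mult_parts[OF corner_Gbar[OF g(1)] M] by simp
next
  assume a: "blk \<tau> \<and> corner m \<tau> = corner m \<gamma> \<and> low \<tau> \<in> orb (low \<gamma>)"
  hence "low \<tau> \<in> orb (low \<gamma>)" by blast
  then obtain v where v: "v \<in> Mon'" "dm (low \<gamma>) \<subseteq> dm v" "rn (low \<gamma>) \<subseteq> dm v"
      "low \<tau> = v \<cdot> low \<gamma> \<cdot> star v" by (rule orbE)
  have "\<tau> = emb (corner m \<tau>) \<cdot> low \<tau>" using blk_decomp[OF t] a by simp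
  also have "\<dots> = emb (corner m \<gamma>) \<cdot> (v \<cdot> low \<gamma> \<cdot> star v)" using a v(4) by simp
  also have "\<dots> = v \<cdot> \<gamma> \<cdot> star v"
    using conj_emb_mult[OF corner_Gbar[OF g(1)] low_Mon'[OF g(1)] v(1)] blk_decomp[OF g] by simp
  finally have "\<tau> = v \<cdot> \<gamma> \<cdot> star v" .
  thus "\<tau> \<in> orb \<gamma>"
    using v dm_sub_low[OF g(2,1)] rn_sub_low[OF g(2,1)] by (intro orbI[OF v(1)]) blast+
qed

text \<open>Domain and range of \<tau> are the images under \<open>v\<close> of the domain and the
  range of \<open>c\<close>, which coincide.\<close>

lemma dm_orb_full:
  assumes c: "c \<in> Mon'" "dm c = rn c" and t: "\<tau> \<in> orb c"
  shows "dm \<tau> = rn \<tau>"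
proof -
  obtain v where v: "v \<in> Mon'" "dm c \<subseteq> dm v" "rn c \<subseteq> dm v" "\<tau> = v \<cdot> c \<cdot> star v"
    using t by (rule orbE)
  have M: "v \<in> Mon" "c \<in> Mon" using v c by auto
  have "r \<in> dm \<tau> \<longleftrightarrow> (\<exists>j y. j \<in> dm c \<and> ent v r j y)" for r
  proof
    assume "r \<in> dm \<tau>"
    then obtain q x where "ent \<tau> q r x" by (rule dmE)
    thus "\<exists>j y. j \<in> dm c \<and> ent v r j y" unfolding v(4) using M by (elim ent_conjE) (blast intro: dmI)+
  next
    assume "\<exists>j y. j \<in> dm c \<and> ent v r j y"
    then obtain i j x y where 1: "ent c i j x" "ent v r j y" by (blast elim: dmE)
    then obtain q z where "ent v q i z" using v(3) by (blast elim: dmE intro: rnI)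
    from ent_conj[OF M 1(1) this 1(2)] show "r \<in> dm \<tau>" unfolding v(4) by (rule dmI)
  qed
  moreover have "r \<in> rn \<tau> \<longleftrightarrow> (\<exists>i y. i \<in> rn c \<and> ent v r i y)" for r
  proof
    assume "r \<in> rn \<tau>"
    then obtain q x where "ent \<tau> r q x" by (rule rnE)
    thus "\<exists>i y. i \<in> rn c \<and> ent v r i y" unfolding v(4) using M by (elim ent_conjE) (blast intro: rnI)+
  next
    assume "\<exists>i y. i \<in> rn c \<and> ent v r i y"
    then obtain i j x y where 1: "ent c i j x" "ent v r i y" by (blast elim: rnE)
    then obtain q z where "ent v q j z" using v(2) by (blast elim: dmE intro: dmI)
    from ent_conj[OF M 1(1) 1(2) this] show "r \<in> rn \<tau>" unfolding v(4) by (rule rnI)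
  qed
  ultimately show ?thesis using c(2) by blast
qed

text \<open>The two translates of \<tau> are conjugate:
  \<open>b \<cdot> (star b \<cdot> \<tau>) \<cdot> star b\<close> is
  \<open>\<tau> \<cdot> star b\<close> once \<open>b\<close> covers the rows of \<tau>, and
  symmetrically. Each translate has equal domain and range by \<open>dm_orb_full\<close>, so
  controlling one of them is enough for the conjugation to be defined on all of it.\<close>

lemma orb_shift:
  assumes c: "c \<in> Mon'" "dm c = rn c" and b: "b \<in> Mon'" and t: "\<tau> \<in> Mon'"
  shows "rn \<tau> \<subseteq> rn b \<and> star b \<cdot> \<tau> \<in> orb c \<longleftrightarrow> dm \<tau> \<subseteq> dm b \<and> \<tau> \<cdot> star b \<in> orb c"
proof
  have M: "b \<in> Mon" "\<tau> \<in> Mon" "star b \<in> Mon" "c \<in> Mon" using b t c by auto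
  {
    assume a: "rn \<tau> \<subseteq> rn b \<and> star b \<cdot> \<tau> \<in> orb c"
    let ?c = "star b \<cdot> \<tau>"
    have t: "\<tau> = b \<cdot> ?c"
      using a M rn_Gbar[OF M(1)] by (simp add: mult_assoc[symmetric] mult_star idm_mult)
    have d: "dm ?c = rn ?c" using dm_orb_full[OF c] a by blast
    have r: "rn ?c \<subseteq> dm b" using rn_mult[OF M(3), of \<tau>] by simp
    have "dm \<tau> \<subseteq> dm ?c" using dm_mult[OF M(1), of ?c] t by simp
    moreover have "b \<cdot> ?c \<cdot> star b \<in> orb c"
      using orb_trans[OF M(4) _ b] a d r by blast
    ultimately show "dm \<tau> \<subseteq> dm b \<and> \<tau> \<cdot> star b \<in> orb c" using t d r by auto
  next
    assume a: "dm \<tau> \<subseteq> dm b \<and> \<tau> \<cdot> star b \<in> orb c"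
    let ?c = "\<tau> \<cdot> star b"
    have t: "\<tau> = ?c \<cdot> b"
      using a M by (simp add: mult_assoc star_mult_self mult_idm)
    have d: "dm ?c = rn ?c" using dm_orb_full[OF c] a by blast
    have r: "dm ?c \<subseteq> rn b" using dm_mult[OF M(2), of "star b"] by simp
    have "rn \<tau> \<subseteq> rn ?c" using rn_mult[OF mult_closed[OF M(2,3)], of b] t by simp
    moreover have "star b \<cdot> ?c \<cdot> star (star b) \<in> orb c"
      using orb_trans[OF M(4) _ Mon'_star[OF b], of ?c] a d r by simp
    moreover have "star b \<cdot> ?c \<cdot> star (star b) = star b \<cdot> \<tau>"
      using t M by (simp add: mult_assoc)
    ultimately show "rn \<tau> \<subseteq> rn b \<and> star b \<cdot> \<tau> \<in> orb c" using d r by auto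
  }
qed

text \<open>The analogue of a class sum. Coordinates can be prescribed freely on
  \<open>Mon'\<close>, and commuting with a basis element is, coordinate by coordinate, the
  statement of \<open>orb_shift\<close>.\<close>

lemma central_orbit_element:
  assumes c: "c \<in> Mon'" "dm c = rn c"
  shows "\<exists>z :: 'g gmat \<Rightarrow>\<^sub>0 'f::field. z \<in> alg_center (FGbar' G m n) \<and> Poly_Mapping.keys z \<subseteq> Mon' \<and>
    (\<forall>\<tau> \<in> Mon'. hat z \<tau> = (if \<tau> \<in> orb c then 1 else 0))"
proof -
  have sub: "Mon' \<subseteq> Mon" by auto
  have "finite Mon'" by (rule finite_subset[OF sub finite_Gbar[OF finite_G]])
  from hat_surjective[OF this sub, of "\<lambda>\<tau>. if \<tau> \<in> orb c then 1 else 0"]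
  obtain z :: "'g gmat \<Rightarrow>\<^sub>0 'f" where z: "Poly_Mapping.keys z \<subseteq> Mon'"
    and hz: "\<And>\<tau>. \<tau> \<in> Mon' \<Longrightarrow> hat z \<tau> = (if \<tau> \<in> orb c then 1 else 0)" by auto
  have zF: "z \<in> FM" using z sub by (auto simp: FM_def)
  have comm: "z \<star> basis b = basis b \<star> z" if b: "b \<in> Mon'" for b
  proof (rule hat_eqI[OF sub])
    show "Poly_Mapping.keys (z \<star> basis b) \<subseteq> Mon'" "Poly_Mapping.keys (basis b \<star> z) \<subseteq> Mon'"
      by (rule keys_conv[of _ Mon' _ Mon']; use z b in auto)+
    fix \<tau> assume t: "\<tau> \<in> Mon'"
    have M: "\<tau> \<in> Mon" "b \<in> Mon" using t b by auto
    have "\<tau> \<cdot> star b \<in> Mon'" "star b \<cdot> \<tau> \<in> Mon'" using t b by auto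
    thus "hat (z \<star> basis b) \<tau> = hat (basis b \<star> z) \<tau>"
      unfolding hat_mult_right[OF zF M(2,1)] hat_mult_left[OF zF M(2,1)]
      using orb_shift[OF c b t] by (auto simp: hz)
  qed
  have "z \<star> x = x \<star> z" if "Poly_Mapping.keys x \<subseteq> Mon'" for x
    using that
  proof (induction x rule: keys_subset_induct)
    case (add \<gamma> d x)
    have e: "Poly_Mapping.single \<gamma> d = Poly_Mapping.map ((*) d) (basis \<gamma>)"
        by (simp add: map_times_single)
    show ?case
      unfolding conv_add_left conv_add_right e conv_smult_left conv_smult_right comm[OF
          add.hyps(1)] add.IH ..
  qed simp
  hence "z \<in> alg_center (FGbar' G m n)"
    using z by (simp add: alg_center_def FGbar'_def FGbar_def)
  thus ?thesis using z hz by auto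
qed

lemma moved_subset: "moved \<gamma> \<subseteq> dm \<gamma>" by (auto simp: moved_def)

lemma finite_moved: "\<gamma> \<in> Mon \<Longrightarrow> finite (moved \<gamma>)"
  using finite_subset[OF order_trans[OF moved_subset dm_Gbar]] by auto

text \<open>By balance, \<gamma> maps the finite set \<open>A\<close> of its nonzero columns beyond
  \<open>m\<close> injectively into itself, hence onto itself. All nonzero rows beyond
  \<open>m\<close> are thus used up by \<open>A\<close> and none is left for a column up to
  \<open>m\<close>.\<close>

lemma bal_blk:
  assumes g: "\<gamma> \<in> Mon" "bal \<gamma>" and n: "\<And>i j x. ent \<gamma> i j x \<Longrightarrow> m < j \<Longrightarrow> m < i"
  shows "blk \<gamma>"
proof -
  define A where "A = dm \<gamma> \<inter> {m<..}"
  have Arn: "A = rn \<gamma> \<inter> {m<..}" using g(2) by (simp add: A_def bal_def)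
  have "finite A" using finite_subset[OF dm_Gbar[OF g(1)]] by (simp add: A_def)
  have "\<forall>j \<in> A. \<exists>i. \<exists>x. ent \<gamma> i j x" by (auto simp: A_def dm_def)
  from bchoice[OF this] obtain f where f: "\<forall>j \<in> A. \<exists>x. ent \<gamma> (f j) j x" by (rule exE)
  have fA: "f ` A \<subseteq> A"
  proof
    fix i assume "i \<in> f ` A"
    then obtain j x where j: "j \<in> A" "i = f j" "ent \<gamma> i j x" using f by blast
    have "m < i" using n[OF j(3)] j(1) by (simp add: A_def)
    thus "i \<in> A" using rnI[OF j(3)] by (simp add: Arn)
  qed
  have "inj_on f A"
  proof (rule inj_onI)
    fix i j assume ij: "i \<in> A" "j \<in> A" "f i = f j"
    obtain x y where "ent \<gamma> (f i) i x" "ent \<gamma> (f j) j y" using f ij by blast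
    thus "i = j" unfolding ij(3) by (rule Gbar_row[OF g(1)])
  qed
  hence surj: "f ` A = A" by (intro endo_inj_surj \<open>finite A\<close> fA)
  have "m < j" if x: "ent \<gamma> i j x" and i: "m < i" for i j x
  proof -
    have "i \<in> A" using rnI[OF x] i by (simp add: Arn)
    then obtain j' where j': "j' \<in> A" "i = f j'" using surj by blast
    then obtain y where "ent \<gamma> i j' y" using f by blast
    hence "j' = j" using Gbar_row[OF g(1) _ x] by blast
    thus ?thesis using j' by (simp add: A_def)
  qed
  thus ?thesis unfolding blk_def using n by (meson not_less)
qed

text \<open>\<open>x\<close> carries the indicator of the first block of \<gamma> and
  \<open>z\<close> that of the orbit of the second; \<open>hat_emb_mult\<close> and
  \<open>orb_blk\<close> combine them.\<close>

lemma block_orbit_element: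
  assumes g: "\<gamma> \<in> Mon" "bal \<gamma>" "blk \<gamma>"
  shows "\<exists>x z :: 'g gmat \<Rightarrow>\<^sub>0 'f::field. Poly_Mapping.keys x \<subseteq> Gbar G m \<and> z \<in> alg_center (FGbar' G m n) \<and>
    (\<forall>\<tau> \<in> Mon. hat (lin_ext emb x \<star> z) \<tau> = (if \<tau> \<in> orb \<gamma> then 1 else 0))"
proof -
  have c: "low \<gamma> \<in> Mon'" by (rule low_Mon'[OF g(1)])
  have dr: "dm (low \<gamma>) = {1..m} \<union> (dm \<gamma> \<inter> {m<..})" "rn (low \<gamma>) = {1..m} \<union> (rn \<gamma> \<inter> {m<..})"
  proof -
    have b: "m < i \<longleftrightarrow> m < j" if "ent \<gamma> i j x" for i j x
      using g(3) that unfolding blk_def not_le[symmetric] by blast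
    show "dm (low \<gamma>) = {1..m} \<union> (dm \<gamma> \<inter> {m<..})"
    proof (rule Set.set_eqI)
      fix j show "j \<in> dm (low \<gamma>) \<longleftrightarrow> j \<in> {1..m} \<union> (dm \<gamma> \<inter> {m<..})"
        unfolding dm_def ent_low Un_iff Int_iff mem_Collect_eq greaterThan_iff using b by blast
    qed
    show "rn (low \<gamma>) = {1..m} \<union> (rn \<gamma> \<inter> {m<..})"
    proof (rule Set.set_eqI)
      fix j show "j \<in> rn (low \<gamma>) \<longleftrightarrow> j \<in> {1..m} \<union> (rn \<gamma> \<inter> {m<..})"
        unfolding rn_def ent_low Un_iff Int_iff mem_Collect_eq greaterThan_iff using b by blast
    qed
  qed
  \<comment> \<open>Balance of \<gamma> is what makes the second block admissible for a central
    element.\<close>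
  have "dm (low \<gamma>) = rn (low \<gamma>)" using g(2) unfolding dr bal_def by simp
  from central_orbit_element[OF c this] obtain z :: "'g gmat \<Rightarrow>\<^sub>0 'f"
    where z: "z \<in> alg_center (FGbar' G m n)" "Poly_Mapping.keys z \<subseteq> Mon'"
      and hz: "\<And>\<tau>. \<tau> \<in> Mon' \<Longrightarrow> hat z \<tau> = (if \<tau> \<in> orb (low \<gamma>) then 1 else 0)" by auto
  have sub: "Gbar G m \<subseteq> Mon" by (rule Gbar_mono[OF m_le])
  have "finite (Gbar G m)" by (rule finite_Gbar[OF finite_G])
  from hat_surjective[OF this sub, of "\<lambda>\<tau>. if \<tau> = corner m \<gamma> then 1 else 0"]
  obtain x :: "'g gmat \<Rightarrow>\<^sub>0 'f" where x: "Poly_Mapping.keys x \<subseteq> Gbar G m"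
    and hx: "\<And>\<tau>. \<tau> \<in> Gbar G m \<Longrightarrow> hat x \<tau> = (if \<tau> = corner m \<gamma> then 1 else 0)" by auto
  have "\<forall>\<tau> \<in> Mon. hat (lin_ext emb x \<star> z) \<tau> = (if \<tau> \<in> orb \<gamma> then 1 else 0)"
  proof
    fix \<tau> assume t: "\<tau> \<in> Mon"
    show "hat (lin_ext emb x \<star> z) \<tau> = (if \<tau> \<in> orb \<gamma> then 1 else 0)"
      unfolding hat_emb_mult[OF x z(2) t] hx[OF corner_Gbar[OF t]] hz[OF low_Mon'[OF t]]
          orb_blk[OF g(1,3) t]
      by auto
  qed
  thus ?thesis using x z by (intro exI conjI)
qed

text \<open>The exchange of \<open>a\<close> and \<open>j\<close> with a label on one of its two
  entries only. The branches are ordered so that \<open>j = a\<close> is allowed and gives the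
  diagonal matrix with \<open>y\<close> at \<open>a\<close>.\<close>

definition scaled_swp :: "nat \<Rightarrow> nat \<Rightarrow> 'g \<Rightarrow> 'g gmat" where
  "scaled_swp j a y = (\<lambda>r c. if c = a then (if r = j then Some y else None)
     else if c = j then (if r = a then Some \<one> else None)
     else if r = c \<and> c \<in> {1..n} then Some \<one> else None)"

lemma ent_scaled_swp: "ent (scaled_swp j a y) r c x \<longleftrightarrow>
    c = a \<and> r = j \<and> x = y \<or> c \<noteq> a \<and> c = j \<and> r = a \<and> x = \<one> \<or> c \<noteq> a \<and> c \<noteq> j \<and> r = c \<and> c \<in> {1..n} \<and> x = \<one>"
  by (auto simp: ent_def scaled_swp_def)

lemma scaled_swp_Mon':
  assumes "a \<in> {m+1..n}" "j \<in> {m+1..n}" "y \<in> carrier G"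
  shows "scaled_swp j a y \<in> Mon'"
  unfolding Mon'_iff
proof
  show "scaled_swp j a y \<in> Mon"
    by (rule GbarI) (use assms in \<open>auto simp: ent_scaled_swp\<close>)
  show "\<forall>k\<in>{1..m}. ent (scaled_swp j a y) k k \<one>"
    using assms m_le by (auto simp: ent_scaled_swp)
qed

lemma rn_scaled_swp: 
  assumes "a \<in> {1..n}" "j \<in> {1..n}"
  shows "rn (scaled_swp j a y) = {1..n}"
proof (intro equalityI subsetI)
  fix r assume r: "r \<in> {1..n}"
  have "ent (scaled_swp j a y) r (if r = j then a else if r = a then j else r) (if r = j then y else \<one>)"
    using r by (auto simp: ent_scaled_swp)
  thus "r \<in> rn (scaled_swp j a y)" by (rule rnI)
next
  fix r assume "r \<in> rn (scaled_swp j a y)"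
  thus "r \<in> {1..n}" by (rule rnE) (use assms in \<open>auto simp: ent_scaled_swp\<close>)
qed

text \<open>\<gamma> acts as the identity, label included, on the only indices that
  \<open>scaled_swp\<close> alters.\<close>

lemma scaled_swp_commute:
  assumes p: "a \<in> {m+1..n}" "j \<in> {m+1..n}" "y \<in> carrier G"
    and g: "\<gamma> \<in> Mon" "ent \<gamma> a a \<one>" "ent \<gamma> j j \<one>"
  shows "scaled_swp j a y \<cdot> \<gamma> = \<gamma> \<cdot> scaled_swp j a y"
proof (rule gmat_eqI)
  fix r c x
  have M: "scaled_swp j a y \<in> Mon" using scaled_swp_Mon'[OF p] by simp
  have 1: "ent \<gamma> a c z \<longleftrightarrow> c = a \<and> z = \<one>" "ent \<gamma> c a z \<longleftrightarrow> c = a \<and> z = \<one>" for c z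
    using g(2) Gbar_row[OF g(1,2)] Gbar_col[OF g(1,2)] ent_fun by metis+
  have 2: "ent \<gamma> j c z \<longleftrightarrow> c = j \<and> z = \<one>" "ent \<gamma> c j z \<longleftrightarrow> c = j \<and> z = \<one>" for c z
    using g(3) Gbar_row[OF g(1,3)] Gbar_col[OF g(1,3)] ent_fun by metis+
  have 3: "z \<in> carrier G \<and> c \<in> {1..n} \<and> r \<in> {1..n}" if "ent \<gamma> r c z" for r c z
    using Gbar_entry[OF g(1) that] by simp
  have 4: "ent \<gamma> r c z \<and> x = z \<otimes> \<one> \<longleftrightarrow> ent \<gamma> r c z \<and> x = z" "ent \<gamma> r c z \<and> x = \<one> \<otimes> z \<longleftrightarrow> ent \<gamma> r c z \<and>
      x = z" for r c z
    using 3[of r c z] by auto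
  have 5: "ent \<gamma> r c x \<Longrightarrow> r \<in> {a, j} \<longleftrightarrow> c \<in> {a, j}" using 1 2 by auto
  let ?E = "c = a \<and> r = j \<and> x = y \<or> c \<noteq> a \<and> c = j \<and> r = a \<and> x = \<one> \<or> c \<notin> {a, j} \<and> ent \<gamma> r c x"
  have "ent (scaled_swp j a y \<cdot> \<gamma>) r c x \<longleftrightarrow> (\<exists>z. r = j \<and> ent \<gamma> a c z \<and> x = y \<otimes> z) \<or>
      (\<exists>z. j \<noteq> a \<and> r = a \<and> ent \<gamma> j c z \<and> x = \<one> \<otimes> z) \<or> (\<exists>z. r \<notin> {a, j} \<and> r \<in> {1..n} \<and> ent \<gamma> r c z \<and>
          x = \<one> \<otimes> z)"
    unfolding ent_mult[OF M] ent_scaled_swp by blast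
  also have "\<dots> \<longleftrightarrow> ?E"
    unfolding 4 1 2 using p(3) 3[of r c x] 5 by auto
  finally have e1: "ent (scaled_swp j a y \<cdot> \<gamma>) r c x \<longleftrightarrow> ?E" .
  have "ent (\<gamma> \<cdot> scaled_swp j a y) r c x \<longleftrightarrow> (\<exists>z. c = a \<and> ent \<gamma> r j z \<and> x = z \<otimes> y) \<or>
      (\<exists>z. c \<noteq> a \<and> c = j \<and> ent \<gamma> r a z \<and> x = z \<otimes> \<one>) \<or> (\<exists>z. c \<notin> {a, j} \<and> c \<in> {1..n} \<and> ent \<gamma> r c z \<and>
          x = z \<otimes> \<one>)"
    unfolding ent_mult[OF g(1)] ent_scaled_swp by blast
  also have "\<dots> \<longleftrightarrow> ?E"
    unfolding 4 1 2 using p(3) 3[of r c x] 5 by auto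
  finally have e2: "ent (\<gamma> \<cdot> scaled_swp j a y) r c x \<longleftrightarrow> ?E" .
  show "ent (scaled_swp j a y \<cdot> \<gamma>) r c x \<longleftrightarrow> ent (\<gamma> \<cdot> scaled_swp j a y) r c x"
    unfolding e1 e2 ..
qed

text \<open>
  A path of \<open>\<gamma>\<close> through the indices above \<open>m\<close> that ends in \<open>l \<le> m\<close> is shortened by its last point
  \<open>a\<close>, which becomes a fixed point of \<open>\<gamma>'\<close>; multiplication by \<open>u_l\<close> reinserts a fixed point.
\<close>

context
  fixes \<gamma> :: "'g gmat" and l a g
  assumes \<gamma>: "\<gamma> \<in> Mon" "bal \<gamma>" and la: "l \<in> {1..m}" "m < a" "ent \<gamma> l a g"
begin

text \<open>The label \<open>g\<close> is chosen so that the entry of column \<open>a\<close>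
  arrives on the diagonal as \<open>inv g \<otimes> g = \<one>\<close>; the former row
  \<open>a\<close> passes to row \<open>l\<close>.\<close>

definition shortened :: "'g gmat" where
  "shortened = swp l a g \<cdot> \<gamma>"

lemma la_facts: "l \<noteq> a" "l \<in> {1..n}" "a \<in> {1..n}" "a \<in> {m+1..n}" "g \<in> carrier G"
  using la Gbar_entry[OF \<gamma>(1) la(3)] by auto

lemmas swp_la = swp_closed[OF la_facts(1-3,5)] dm_swp[OF la_facts(1-3,5)] rn_swp[OF la_facts(1-3,5)]

lemma shortened_Mon: "shortened \<in> Mon"
  unfolding shortened_def using swp_la \<gamma> by simp

lemma swp_shortened: "swp l a g \<cdot> shortened = \<gamma>"
  unfolding shortened_def by (rule swp_mult_swp[OF la_facts(1-3,5) \<gamma>(1)])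

lemma ent_swp_mult:
  assumes "k \<noteq> i" "k \<in> {1..n}" "i \<in> {1..n}" "h \<in> carrier G" "\<tau> \<in> Mon" "r \<noteq> k" "r \<noteq> i"
  shows "ent (swp k i h \<cdot> \<tau>) r c x \<longleftrightarrow> ent \<tau> r c x"
proof -
  have "ent (swp k i h \<cdot> \<tau>) r c x \<longleftrightarrow> (\<exists>z. r \<in> {1..n} \<and> ent \<tau> r c z \<and> x = \<one> \<otimes> z)"
    unfolding ent_mult[OF swp_closed[OF assms(1-4)]] ent_swp[OF assms(1)] using assms(6,7) by auto
  thus ?thesis using Gbar_entry[OF assms(5), of r c] by fastforce
qed

lemma dm_shortened: "dm shortened = dm \<gamma>"
  unfolding shortened_def by (rule dm_mult_eq) (use swp_la rn_Gbar[OF \<gamma>(1)] in auto)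

text \<open>Rows \<open>l\<close> and \<open>a\<close> are exchanged up to labels and both are
  nonzero in \<gamma>: row \<open>l\<close> by its entry in column \<open>a\<close>, row
  \<open>a\<close> by balance.\<close>

lemma rn_shortened: "rn shortened = rn \<gamma>"
proof -
  have "a \<in> dm \<gamma>" "l \<in> rn \<gamma>" using la(3) by (auto intro: dmI rnI)
  hence "a \<in> rn \<gamma>" using \<gamma>(2) la(2) unfolding bal_def by blast
  have "i \<in> rn shortened \<longleftrightarrow> i \<in> rn \<gamma>" for i
  proof -
    consider "i = l" | "i = a" | "i \<noteq> l" "i \<noteq> a" by blast
    thus ?thesis
    proof cases
      case 1
      thus ?thesis using rn_swp_mult(1)[OF la_facts(1-3,5) \<gamma>(1)] \<open>a \<in> rn \<gamma>\<close> \<open>l \<in> rn \<gamma>\<close>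
        by (simp add: shortened_def)
    next
      case 2
      thus ?thesis using rn_swp_mult(2)[OF la_facts(1-3,5) \<gamma>(1)] \<open>a \<in> rn \<gamma>\<close> \<open>l \<in> rn \<gamma>\<close>
        by (simp add: shortened_def)
    next
      case 3
      show ?thesis
        unfolding shortened_def rn_def mem_Collect_eq ent_swp_mult[OF la_facts(1-3,5) \<gamma>(1) 3] ..
    qed
  qed
  thus ?thesis by blast
qed

lemma bal_shortened: "bal shortened"
  using \<gamma>(2) by (simp add: bal_def dm_shortened rn_shortened)

lemma shortened_fixed: "ent shortened a a \<one>"
  unfolding shortened_def
  by (rule ent_multI[OF swp_la(1) _ la(3)]) (use la_facts in \<open>auto simp: ent_swp\<close>)

lemma moved_shortened: "moved \<gamma> = insert a (moved shortened)" "a \<notin> moved shortened"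
proof -
  have e: "ent shortened j j \<one> \<longleftrightarrow> ent \<gamma> j j \<one>" if "m < j" "j \<noteq> a" for j
    unfolding shortened_def using that la by (intro ent_swp_mult[OF la_facts(1-3,5) \<gamma>(1)]) auto
  have "a \<in> moved \<gamma>"
    using la la_facts(1) dmI[OF la(3)] Gbar_col[OF \<gamma>(1) la(3), of a \<one>] by (auto simp: moved_def)
  moreover show "a \<notin> moved shortened" using shortened_fixed by (simp add: moved_def)
  ultimately show "moved \<gamma> = insert a (moved shortened)"
    using e unfolding moved_def dm_shortened by blast
qed

lemma card_moved_shortened: "card (moved \<gamma>) = Suc (card (moved shortened))"
  using moved_shortened finite_moved[OF shortened_Mon] by simp

text \<open>If \<tau> is the conjugate of \<gamma> by \<open>v\<close>, then \<open>i\<close> is the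
  image of \<open>a\<close> under \<open>v\<close>, with label \<open>b\<close>, and
  \<open>h = g \<otimes> inv b\<close>. By \<open>Mon'_swp\<close>, the exchange for \<tau> is then
  the conjugate of the one for \<gamma>.\<close>

lemma reinsert_exists:
  assumes "\<tau> \<in> orb \<gamma>"
  shows "\<exists>i h. i \<in> {l+1..n} \<and> h \<in> carrier G \<and> l \<in> rn \<tau> \<and> i \<in> rn \<tau> \<and> swp l i h \<cdot> \<tau> \<in> orb shortened"
proof -
  obtain v where v: "v \<in> Mon'" "dm \<gamma> \<subseteq> dm v" "rn \<gamma> \<subseteq> dm v" "\<tau> = v \<cdot> \<gamma> \<cdot> star v"
    using assms by (rule orbE)
  have M: "v \<in> Mon" using v by simp
  have ad: "a \<in> dm \<gamma>" by (rule dmI[OF la(3)])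
  hence "a \<in> dm v" using v(2) by blast
  then obtain i b where b: "ent v i a b" by (rule dmE)
  have bc: "b \<in> carrier G" "i \<in> {1..n}" using Gbar_entry[OF M b] by auto
  have "m < i" using Mon'_fixed(1)[OF v(1) b] la(2) by (metis not_less)
  hence i: "i \<in> {l+1..n}" "i \<noteq> l" using bc la(1) by auto
  have vl: "ent v l l \<one>" using v(1) la(1) by (simp add: Mon'_iff)
  have hc: "g \<otimes> inv b \<in> carrier G" using bc la_facts by simp
  have "l \<in> rn \<tau>" unfolding v(4) by (rule rnI[OF ent_conj[OF M \<gamma>(1) la(3) vl b]])
  moreover have "i \<in> rn \<tau>"
  proof -
    have "a \<in> rn \<gamma>" using \<gamma>(2) la(2) ad unfolding bal_def by blast
    then obtain c x where c: "ent \<gamma> a c x" by (rule rnE)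
    hence "c \<in> dm v" using v(2) dmI[OF c] by blast
    then obtain q z where "ent v q c z" by (rule dmE)
    from ent_conj[OF M \<gamma>(1) c b this] show ?thesis unfolding v(4) by (rule rnI)
  qed
  moreover have "swp l i (g \<otimes> inv b) \<cdot> \<tau> \<in> orb shortened"
  proof (rule orbI[OF v(1)])
    have S: "swp l i (g \<otimes> inv b) \<in> Mon" using i bc la_facts hc by (intro swp_closed) auto
    have "swp l i (g \<otimes> inv b) \<cdot> \<tau> = (swp l i (g \<otimes> inv b) \<cdot> v) \<cdot> (\<gamma> \<cdot> star v)"
      unfolding v(4) using S M \<gamma> by (simp add: mult_assoc)
    also have "swp l i (g \<otimes> inv b) \<cdot> v = v \<cdot> swp l a g"
      using Mon'_swp[OF v(1) b la(1)] la_facts by simp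
    also have "v \<cdot> swp l a g \<cdot> (\<gamma> \<cdot> star v) = v \<cdot> shortened \<cdot> star v"
      unfolding shortened_def using swp_la M \<gamma> by (simp add: mult_assoc)
    finally show "swp l i (g \<otimes> inv b) \<cdot> \<tau> = v \<cdot> shortened \<cdot> star v" .
  qed (use v dm_shortened rn_shortened in auto)
  ultimately show ?thesis using i hc by blast
qed

text \<open>Beyond \<open>m\<close>, the exchange can alter only the diagonal entry at
  \<open>i\<close>, yet it lowers the number of moved indices. So \<open>i\<close> lies beyond
  \<open>m\<close>, is moved in \<tau> and becomes a fixed point with label \<open>\<one>\<close>,
  which determines the entry of \<tau> in row \<open>l\<close>.\<close>

lemma reinsert_unique:
  assumes t: "\<tau> \<in> Mon" "card (moved \<gamma>) \<le> card (moved \<tau>)"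
    and i: "i \<in> {l+1..n}" "h \<in> carrier G" "swp l i h \<cdot> \<tau> \<in> orb shortened"
  shows "m < i" "ent \<tau> l i h" "ent (swp l i h \<cdot> \<tau>) i i \<one>"
proof -
  let ?s = "swp l i h \<cdot> \<tau>"
  have li: "l \<noteq> i" "l \<in> {1..n}" "i \<in> {1..n}" using i la_facts by auto
  note S = swp_closed[OF li i(2)]
  have dms: "dm ?s = dm \<tau>"
    by (rule dm_mult_eq[OF S]) (use dm_swp[OF li i(2)] rn_Gbar[OF t(1)] in simp)
  have "card (moved ?s) \<le> card (moved shortened)" by (rule card_moved_orb[OF shortened_Mon i(3)])
  also have "\<dots> < card (moved \<tau>)" using t(2) card_moved_shortened by simp
  finally have lt: "card (moved ?s) < card (moved \<tau>)" .
  have e: "ent ?s j j \<one> \<longleftrightarrow> ent \<tau> j j \<one>" if "m < j" "j \<noteq> i" for j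
    using that la by (intro ent_swp_mult[OF li i(2) t(1)]) auto
  have "moved \<tau> - {i} \<subseteq> moved ?s" using e unfolding moved_def dms by blast
  moreover have "\<not> moved \<tau> \<subseteq> moved ?s"
    using card_mono[OF finite_moved[OF mult_closed[OF S t(1)]]] lt by (meson not_less)
  ultimately have m: "i \<in> moved \<tau>" "i \<notin> moved ?s" by blast+
  thus mi: "m < i" and e1: "ent ?s i i \<one>" unfolding moved_def dms by blast+
  from e1 obtain y where y: "ent \<tau> l i y" "\<one> = inv h \<otimes> y"
    using li by (auto simp: ent_mult[OF S] ent_swp)
  have "y = h \<otimes> (inv h \<otimes> y)" using i(2) Gbar_entry(3)[OF t(1) y(1)] by (simp add: m_assoc[symmetric])
  also have "\<dots> = h" unfolding y(2)[symmetric] using i(2) by simp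
  finally have "y = h" .
  thus "ent \<tau> l i h" using y by simp
qed

text \<open>The fixed point \<open>i\<close> comes through \<open>v\<close> from some fixed point
  \<open>j\<close> of \<open>shortened\<close>, which need not be \<open>a\<close>. Exchanging
  \<open>j\<close> and \<open>a\<close> commutes with \<open>shortened\<close>, so \<open>v\<close>
  can be replaced by a \<open>w\<close> that carries \<open>a\<close> to \<open>i\<close>. With the
  right label, \<open>w\<close> also intertwines the two exchanges and hence carries \<gamma> to
  \<tau>.\<close>

lemma reinsert_orb:
  assumes t: "\<tau> \<in> Mon" and i: "i \<in> {l+1..n}" "h \<in> carrier G" "swp l i h \<cdot> \<tau> \<in> orb shortened"
    and fi: "m < i" "ent (swp l i h \<cdot> \<tau>) i i \<one>"
  shows "\<tau> \<in> orb \<gamma>"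
proof -
  have li: "l \<noteq> i" "l \<in> {1..n}" "i \<in> {1..n}" using i la_facts by auto
  note S = swp_closed[OF li i(2)]
  obtain v where v: "v \<in> Mon'" "dm shortened \<subseteq> dm v" "rn shortened \<subseteq> dm v"
      "swp l i h \<cdot> \<tau> = v \<cdot> shortened \<cdot> star v"
    using i(3) by (rule orbE)
  have M: "v \<in> Mon" using v by simp
  obtain r j x a' b where e: "ent shortened r j x" "ent v i r a'" "ent v i j b" "\<one> = a' \<otimes> x \<otimes> inv b"
    using fi(2) M shortened_Mon unfolding v(4) by (elim ent_conjE) blast
  have rj: "r = j" using Gbar_row[OF M e(2,3)] .
  hence ab: "a' = b" using e ent_fun by metis
  have bc: "b \<in> carrier G" "j \<in> {1..n}" using Gbar_entry[OF M e(3)] by auto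
  have xc: "x \<in> carrier G" using Gbar_entry(3)[OF shortened_Mon e(1)] .
  \<comment> \<open>A label conjugate to \<open>\<one>\<close> is \<open>\<one>\<close>, so
    \<open>j\<close> is fixed with trivial label.\<close>
  have "b \<otimes> x \<otimes> inv b = \<one>" using e(4) ab by simp
  moreover have "b \<otimes> x = (b \<otimes> x \<otimes> inv b) \<otimes> b" using bc xc by (simp add: m_assoc)
  ultimately have "b \<otimes> x = b" using bc by simp
  moreover have "x = inv b \<otimes> (b \<otimes> x)" using bc xc by (simp add: m_assoc[symmetric])
  ultimately have x1: "x = \<one>" using bc by simp
  have jj: "ent shortened j j \<one>" using e(1) rj x1 by simp
  have "m < j" using Mon'_fixed(1)[OF v(1) e(3)] fi(1) by (metis not_less)
  hence j: "j \<in> {m+1..n}" using bc by simp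
  \<comment> \<open>\<open>w\<close> will carry \<open>a\<close> to \<open>i\<close> with label
    \<open>b \<otimes> y\<close>, and \<open>Mon'_swp\<close> requires
    \<open>g \<otimes> inv (b \<otimes> y) = h\<close>; this is solved for \<open>y\<close>.\<close>
  define y where "y = inv b \<otimes> (inv h \<otimes> g)"
  have yc: "y \<in> carrier G" using bc i la_facts by (simp add: y_def)
  have by': "b \<otimes> y = inv h \<otimes> g" using bc i la_facts by (simp add: y_def m_assoc[symmetric])
  let ?p = "scaled_swp j a y"
  have p: "?p \<in> Mon'" by (rule scaled_swp_Mon'[OF la_facts(4) j yc])
  have pM: "?p \<in> Mon" using p by simp
  define w where "w = v \<cdot> ?p"
  have w: "w \<in> Mon'" "w \<in> Mon" unfolding w_def using v(1) p by auto
  have wi: "ent w i a (b \<otimes> y)" unfolding w_def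
    by (rule ent_multI[OF M e(3) _ refl]) (simp add: ent_scaled_swp)
  have pp: "?p \<cdot> star ?p = idm {1..n}"
    using mult_star[OF pM] rn_scaled_swp[OF la_facts(3) bc(2)] by simp
  have "w \<cdot> shortened \<cdot> star w = v \<cdot> (?p \<cdot> shortened) \<cdot> (star ?p \<cdot> star v)"
    unfolding w_def using M pM shortened_Mon by (simp add: mult_assoc star_mult)
  also have "?p \<cdot> shortened = shortened \<cdot> ?p"
    by (rule scaled_swp_commute[OF la_facts(4) j yc shortened_Mon shortened_fixed jj])
  also have "v \<cdot> (shortened \<cdot> ?p) \<cdot> (star ?p \<cdot> star v) = v \<cdot> shortened \<cdot> ((?p \<cdot> star ?p) \<cdot> star v)"
    using M pM shortened_Mon by (simp add: mult_assoc)
  also have "\<dots> = v \<cdot> shortened \<cdot> star v" unfolding pp using M by simp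
  finally have ws: "w \<cdot> shortened \<cdot> star w = swp l i h \<cdot> \<tau>" using v(4) by simp
  \<comment> \<open>The factor \<open>?p\<close> only interchanges \<open>a\<close> and
    \<open>j\<close>, and \<open>v\<close> is defined at both, so no part of the domain is
    lost.\<close>
  have dw: "c \<in> dm w" if "c \<in> dm v" "c \<in> {1..n}" for c
  proof -
    have "\<exists>r z. ent ?p r c z \<and> r \<in> dm v"
    proof -
      have av: "a \<in> dm v" using dmI[OF shortened_fixed] v(2) by blast
      have jv: "j \<in> dm v" by (rule dmI[OF e(3)])
      consider "c = a" | "c \<noteq> a" "c = j" | "c \<noteq> a" "c \<noteq> j" by blast
      thus ?thesis
      proof cases
        case 1 thus ?thesis using jv by (intro exI[of _ j] exI[of _ y]) (simp add: ent_scaled_swp)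
      next
        case 2 thus ?thesis using av by (intro exI[of _ a] exI[of _ \<one>]) (simp add: ent_scaled_swp)
      next
        case 3 thus ?thesis using that by (intro exI[of _ c] exI[of _ \<one>]) (simp add: ent_scaled_swp)
      qed
    qed
    then obtain r z where r: "ent ?p r c z" "r \<in> dm v" by blast
    from r(2) obtain q z' where "ent v q r z'" by (rule dmE)
    from ent_multI[OF M this r(1) refl] show ?thesis unfolding w_def by (rule dmI)
  qed
  have la': "a \<noteq> l" using la_facts by simp
  have "g \<otimes> inv (b \<otimes> y) = h"
    unfolding by' using i la_facts by (simp add: inv_mult_group m_assoc[symmetric])
  hence "w \<cdot> swp l a g = swp l i h \<cdot> w"
    using Mon'_swp[OF w(1) wi la(1) la' la_facts(5)] by simp
  have "\<tau> = swp l i h \<cdot> (swp l i h \<cdot> \<tau>)" using swp_mult_swp[OF li i(2) t] by simp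
  also have "\<dots> = (swp l i h \<cdot> w) \<cdot> (shortened \<cdot> star w)"
    unfolding ws[symmetric] using S w(2) shortened_Mon by (simp add: mult_assoc)
  also have "swp l i h \<cdot> w = w \<cdot> swp l a g" using \<open>w \<cdot> swp l a g = swp l i h \<cdot> w\<close> by simp
  also have "w \<cdot> swp l a g \<cdot> (shortened \<cdot> star w) = w \<cdot> (swp l a g \<cdot> shortened) \<cdot> star w"
    using w(2) swp_la shortened_Mon by (simp add: mult_assoc)
  also have "\<dots> = w \<cdot> \<gamma> \<cdot> star w" unfolding swp_shortened ..
  finally have tw: "\<tau> = w \<cdot> \<gamma> \<cdot> star w" .
  have "dm \<gamma> \<subseteq> dm w" "rn \<gamma> \<subseteq> dm w"
    using dw v(2,3) dm_Gbar[OF \<gamma>(1)] rn_Gbar[OF \<gamma>(1)] unfolding dm_shortened rn_shortened by blast+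
  thus ?thesis using tw by (intro orbI[OF w(1)])
qed

text \<open>A pair contributes iff \<tau> lies in the orbit of \<gamma>, by
  \<open>reinsert_exists\<close> and \<open>reinsert_orb\<close>, and by
  \<open>reinsert_unique\<close> it is read off from row \<open>l\<close> of \<tau>. The sum is
  therefore 0 or 1 in any characteristic.\<close>

lemma hat_u_shortened:
  fixes X :: "'g gmat \<Rightarrow>\<^sub>0 'f::field"
  assumes X: "X \<in> FM" and hX: "\<And>\<tau>. \<tau> \<in> Mon \<Longrightarrow> card (moved shortened) \<le> card (moved \<tau>) \<Longrightarrow>
      hat X \<tau> = (if \<tau> \<in> orb shortened then 1 else 0)"
    and t: "\<tau> \<in> Mon" "card (moved \<gamma>) \<le> card (moved \<tau>)"
  shows "hat (u_elem G n l \<star> X) \<tau> = (if \<tau> \<in> orb \<gamma> then 1 else 0)"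
proof -
  let ?P = "\<lambda>i h. l \<in> rn \<tau> \<and> i \<in> rn \<tau> \<and> swp l i h \<cdot> \<tau> \<in> orb shortened"
  let ?S = "{p \<in> {l+1..n} \<times> carrier G. ?P (fst p) (snd p)}"
  have h: "hat X (swp l i h \<cdot> \<tau>) = (if swp l i h \<cdot> \<tau> \<in> orb shortened then 1 else 0)"
    if i: "i \<in> {l+1..n}" "h \<in> carrier G" for i h
  proof (rule hX)
    have li: "l \<noteq> i" "l \<in> {1..n}" "i \<in> {1..n}" using i la_facts by auto
    note S = swp_closed[OF li i(2)]
    show M: "swp l i h \<cdot> \<tau> \<in> Mon" by (rule mult_closed[OF S t(1)])
    have dms: "dm (swp l i h \<cdot> \<tau>) = dm \<tau>"
      by (rule dm_mult_eq[OF S]) (use dm_swp[OF li i(2)] rn_Gbar[OF t(1)] in simp)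
    have e: "ent (swp l i h \<cdot> \<tau>) j j \<one> \<longleftrightarrow> ent \<tau> j j \<one>" if "m < j" "j \<noteq> i" for j
      using that la by (intro ent_swp_mult[OF li i(2) t(1)]) auto
    \<comment> \<open>The exchange lowers the number of moved indices by at most one, exactly the
      difference between \<gamma> and \<open>shortened\<close>, so the argument stays in the range
      where \<open>X\<close> is known.\<close>
    have "moved \<tau> \<subseteq> insert i (moved (swp l i h \<cdot> \<tau>))" using e unfolding moved_def dms by blast
    hence "card (moved \<tau>) \<le> card (insert i (moved (swp l i h \<cdot> \<tau>)))"
      by (intro card_mono) (use finite_moved[OF M] in auto)
    also have "\<dots> \<le> Suc (card (moved (swp l i h \<cdot> \<tau>)))"
        by (rule card_insert_le_m1[of _ _, simplified]) auto
    finally show "card (moved shortened) \<le> card (moved (swp l i h \<cdot> \<tau>))"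
      using t(2) card_moved_shortened by simp
  qed
  have "hat (u_elem G n l \<star> X) \<tau> = (\<Sum>i = l+1..n. \<Sum>h \<in> carrier G. if ?P i h then 1 else 0)"
    unfolding hat_u_mult[OF la_facts(2) X t(1)] by (intro sum.cong refl) (auto simp: h)
  also have "\<dots> = of_nat (card ?S)"
    using finite_G by (intro sum_sum_indicator) auto
  also have "card ?S = (if \<tau> \<in> orb \<gamma> then 1 else 0)"
  proof (cases "\<tau> \<in> orb \<gamma>")
    case True
    then obtain i h where ih: "i \<in> {l+1..n}" "h \<in> carrier G" "?P i h" using reinsert_exists by blast
    have "?S = {(i, h)}"
    proof (intro equalityI subsetI)
      fix p assume p: "p \<in> ?S"
      hence p': "fst p \<in> {l+1..n}" "snd p \<in> carrier G" "swp l (fst p) (snd p) \<cdot> \<tau> \<in> orb shortened"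
          by auto
      have 1: "ent \<tau> l (fst p) (snd p)" by (rule reinsert_unique(2)[OF t p'])
      have 2: "ent \<tau> l i h" using reinsert_unique(2)[OF t ih(1,2)] ih(3) by blast
      have "fst p = i" using Gbar_row[OF t(1) 1 2] .
      moreover from this have "snd p = h" using 1 2 ent_fun by metis
      ultimately show "p \<in> {(i, h)}" by (simp add: prod_eq_iff)
    qed (use ih in auto)
    thus ?thesis using True by simp
  next
    case False
    have "?S = {}"
    proof (rule ccontr)
      assume "?S \<noteq> {}"
      then obtain i h where ih: "i \<in> {l+1..n}" "h \<in> carrier G" "swp l i h \<cdot> \<tau> \<in> orb shortened" by auto
      show False
        using reinsert_orb[OF t(1) ih reinsert_unique(1,3)[OF t ih]] False by simp
    qed
    thus ?thesis using False by (metis card.empty)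
  qed
  finally show ?thesis by simp
qed

end

text \<open>The orbit sum of \<open>\<gamma>\<close> is only obtained up to terms with fewer moved indices.\<close>

lemma approximate_orbit_element:
  fixes A :: "('g gmat \<Rightarrow>\<^sub>0 'f::field) set"
  assumes A: "A \<subseteq> Zb" "\<And>x y. x \<in> A \<Longrightarrow> y \<in> A \<Longrightarrow> x \<star> y \<in> A"
    and emb: "\<And>x. Poly_Mapping.keys x \<subseteq> Gbar G m \<Longrightarrow> lin_ext emb x \<in> A"
    and u: "\<And>k. k \<in> {1..m} \<Longrightarrow> u_elem G n k \<in> A"
    and cen: "alg_center (FGbar' G m n) \<subseteq> A"
    and g: "\<gamma> \<in> Mon" "bal \<gamma>"
  shows "\<exists>X \<in> A. \<forall>\<tau> \<in> Mon. card (moved \<gamma>) \<le> card (moved \<tau>) \<longrightarrow> hat X \<tau> = (if \<tau> \<in> orb \<gamma> then 1 else 0)"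
  using g
proof (induction \<gamma> rule: measure_induct_rule[where f = "\<lambda>\<gamma>. card (moved \<gamma>)"])
  case (less \<gamma>)
  show ?case
  proof (cases "\<forall>i j x. ent \<gamma> i j x \<longrightarrow> m < j \<longrightarrow> m < i")
    case True
    have "blk \<gamma>" by (rule bal_blk[OF less.prems]) (use True in blast)
    from block_orbit_element[OF less.prems this] obtain x z :: "'g gmat \<Rightarrow>\<^sub>0 'f"
      where xz: "Poly_Mapping.keys x \<subseteq> Gbar G m" "z \<in> alg_center (FGbar' G m n)"
        "\<forall>\<tau> \<in> Mon. hat (lin_ext emb x \<star> z) \<tau> = (if \<tau> \<in> orb \<gamma> then 1 else 0)" by auto
    have "lin_ext emb x \<star> z \<in> A" using A(2) emb xz cen by blast
    thus ?thesis using xz(3) by blast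
  next
    case False
    then obtain l a g where la: "ent \<gamma> l a g" "m < a" "\<not> m < l" by blast
    have l: "l \<in> {1..m}" using la Gbar_entry(1)[OF less.prems(1) la(1)] by simp
    let ?s = "shortened \<gamma> l a g"
    note L = less.prems l la(2,1)
    have "card (moved ?s) < card (moved \<gamma>)" using card_moved_shortened[OF L] by simp
    from less.IH[OF this shortened_Mon[OF L] bal_shortened[OF L]]
    obtain X where X: "X \<in> A" "\<And>\<tau>. \<tau> \<in> Mon \<Longrightarrow> card (moved ?s) \<le> card (moved \<tau>) \<Longrightarrow>
        hat X \<tau> = (if \<tau> \<in> orb ?s then 1 else 0)" by blast
    have XF: "X \<in> FM" using X(1) A(1) by auto
    have "u_elem G n l \<star> X \<in> A" by (rule A(2)[OF u[OF l] X(1)])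
    moreover have "\<forall>\<tau> \<in> Mon. card (moved \<gamma>) \<le> card (moved \<tau>) \<longrightarrow>
        hat (u_elem G n l \<star> X) \<tau> = (if \<tau> \<in> orb \<gamma> then 1 else 0)"
      using hat_u_shortened[OF L XF X(2)] by blast
    ultimately show ?thesis by blast
  qed
qed

section \<open>Generation of the centralizer\<close>

lemma carrier_Zbar: "carrier (Zbar G m n) = (Zb :: ('g gmat \<Rightarrow>\<^sub>0 'f::field) set)"
  by (auto simp: Zbar_def FGbar_def FM_def)

lemma Zbar_simps:
  "mult (Zbar G m n) = conv G" "add (Zbar G m n) = (+)" "one (Zbar G m n) = basis (one_gmat G n)"
  "smult (Zbar G m n) = (\<lambda>c. Poly_Mapping.map ((*) c))"
  by (simp_all add: Zbar_def FGbar_def)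

lemma Zb_closed:
  fixes x y :: "'g gmat \<Rightarrow>\<^sub>0 'f::field"
  shows "basis (one_gmat G n) \<in> (Zb :: ('g gmat \<Rightarrow>\<^sub>0 'f) set)"
    and "x \<in> Zb \<Longrightarrow> y \<in> Zb \<Longrightarrow> x + y \<in> Zb"
    and "x \<in> Zb \<Longrightarrow> y \<in> Zb \<Longrightarrow> x \<star> y \<in> Zb"
    and "x \<in> Zb \<Longrightarrow> Poly_Mapping.map ((*) c) x \<in> Zb"
proof -
  show "basis (one_gmat G n) \<in> (Zb :: ('g gmat \<Rightarrow>\<^sub>0 'f) set)"
    by (rule ZbI) (auto simp: one_gmat_idm conv_single)
  show "x + y \<in> Zb" if "x \<in> Zb" "y \<in> Zb"
    using that by (intro ZbI) (auto simp: FM_add conv_add_left conv_add_right)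
  show "Poly_Mapping.map ((*) c) x \<in> Zb" if "x \<in> Zb"
    using that by (intro ZbI) (auto simp: FM_smult conv_smult_left conv_smult_right)
  show "x \<star> y \<in> Zb" if xy: "x \<in> Zb" "y \<in> Zb"
  proof (rule ZbI)
    have F: "x \<in> FM" "y \<in> FM" using xy by auto
    show "x \<star> y \<in> FM" by (rule conv_closed[OF F])
    fix \<gamma> assume g: "\<gamma> \<in> Mon'"
    have b: "basis \<gamma> \<in> FM" using g by simp
    have c: "x \<star> basis \<gamma> = basis \<gamma> \<star> x" "y \<star> basis \<gamma> = basis \<gamma> \<star> y" using xy g by auto
    have "x \<star> y \<star> basis \<gamma> = x \<star> (basis \<gamma> \<star> y)" unfolding conv_assoc[OF F b] c(2) ..
    also have "\<dots> = basis \<gamma> \<star> x \<star> y" unfolding conv_assoc[OF F(1) b F(2), symmetric] c(1) ..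
    finally show "x \<star> y \<star> basis \<gamma> = basis \<gamma> \<star> (x \<star> y)" unfolding conv_assoc[OF b F] .
  qed
qed

lemma Zb_generated:
  fixes A :: "('g gmat \<Rightarrow>\<^sub>0 'f::field) set"
  assumes A: "A \<subseteq> Zb" "\<And>x y. x \<in> A \<Longrightarrow> y \<in> A \<Longrightarrow> x \<star> y \<in> A"
    and A': "0 \<in> A" "\<And>x y. x \<in> A \<Longrightarrow> y \<in> A \<Longrightarrow> x + y \<in> A" "\<And>c x. x \<in> A \<Longrightarrow> Poly_Mapping.map ((*) c) x \<in> A"
    and emb: "\<And>x. Poly_Mapping.keys x \<subseteq> Gbar G m \<Longrightarrow> lin_ext emb x \<in> A"
    and u: "\<And>k. k \<in> {1..m} \<Longrightarrow> u_elem G n k \<in> A"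
    and cen: "alg_center (FGbar' G m n) \<subseteq> A"
  shows "Zb \<subseteq> A"
proof -
  have fin: "finite Mon" by (rule finite_Gbar[OF finite_G])
  have "Y \<in> A" if "Y \<in> Zb" "\<And>\<gamma>. \<gamma> \<in> Mon \<Longrightarrow> hat Y \<gamma> \<noteq> 0 \<Longrightarrow> card (moved \<gamma>) < d" for d Y
    using that
  proof (induction d arbitrary: Y)
    case 0
    have "Poly_Mapping.keys Y \<subseteq> Mon" using 0(1) by (auto simp: FM_def)
    hence "Y = 0" by (rule hat_injective) (use 0 in \<open>auto simp: FM_def\<close>)
    thus ?case using A'(1) by simp
  next
    case (Suc d)
    \<comment> \<open>The top layer of the support. An inner induction on its size empties it; the
      outer induction then lowers the bound.\<close>
    define T where "T Y = {\<gamma> \<in> Mon. hat Y \<gamma> \<noteq> 0 \<and> card (moved \<gamma>) = d}" for Y :: "'g gmat \<Rightarrow>\<^sub>0 'f"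
    show ?case
      using Suc.prems
    proof (induction Y rule: measure_induct_rule[where f = "\<lambda>Y. card (T Y)"])
      case (less Y)
      show ?case
      proof (cases "T Y = {}")
        case True
        show ?thesis
        proof (rule Suc.IH[OF less.prems(1)])
          fix \<gamma> assume "\<gamma> \<in> Mon" "hat Y \<gamma> \<noteq> 0"
          with less.prems(2)[OF this] True show "card (moved \<gamma>) < d" by (auto simp: T_def less_Suc_eq)
        qed
      next
        case False
        then obtain \<gamma> where g: "\<gamma> \<in> Mon" "hat Y \<gamma> \<noteq> 0" "card (moved \<gamma>) = d" by (auto simp: T_def)
        have "bal \<gamma>" by (rule hat_balanced[OF less.prems(1) g(1,2)])
        from approximate_orbit_element[OF A emb u cen g(1) this]
        obtain X where X: "X \<in> A" and hX: "\<And>\<tau>. \<tau> \<in> Mon \<Longrightarrow> d \<le> card (moved \<tau>) \<Longrightarrow>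
            hat X \<tau> = (if \<tau> \<in> orb \<gamma> then 1 else 0)" unfolding g(3) by blast
        define c where "c = hat Y \<gamma>"
        \<comment> \<open>By invariance the coordinate of \<open>Y\<close> is constant on the orbit
          of \<gamma>, so one multiple of \<open>X\<close> clears the whole orbit. The uncontrolled
          part of \<open>X\<close> has fewer than \<open>d\<close> moved indices and does not touch
          the top layer.\<close>
        define Y' where "Y' = Y + Poly_Mapping.map ((*) (- c)) X"
        have X': "X \<in> Zb" using X A(1) by blast
        have Y': "Y' \<in> Zb" unfolding Y'_def by (rule Zb_closed(2)[OF less.prems(1) Zb_closed(4)[OF X']])
        have hY': "hat Y' \<tau> = (if \<tau> \<in> orb \<gamma> then 0 else hat Y \<tau>)" if "\<tau> \<in> Mon" "d \<le> card (moved
            \<tau>)" for \<tau>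
          using hX[OF that] hat_invariant[OF less.prems(1) g(1), of \<tau>]
          by (simp add: Y'_def hat_add hat_smult c_def)
        have supp: "card (moved \<tau>) < Suc d" if "\<tau> \<in> Mon" "hat Y' \<tau> \<noteq> 0" for \<tau>
        proof (rule ccontr)
          assume n: "\<not> card (moved \<tau>) < Suc d"
          hence "hat Y \<tau> \<noteq> 0" using hY'[OF that(1)] that(2) by (auto split: if_splits)
          thus False using less.prems(2)[OF that(1)] n by simp
        qed
        have "T Y' \<subseteq> T Y - {\<gamma>}"
          using hY' orb_self[OF g(1)] by (auto simp: T_def split: if_splits)
        moreover have "\<gamma> \<in> T Y" using g by (simp add: T_def)
        moreover have "finite (T Y)" using fin by (simp add: T_def)
        ultimately have "card (T Y') < card (T Y)" by (intro psubset_card_mono) auto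
        hence "Y' \<in> A" by (rule less.IH[OF _ Y' supp])
        hence "Y' + Poly_Mapping.map ((*) c) X \<in> A" by (intro A'(2,3) X)
        moreover have "Y' + Poly_Mapping.map ((*) c) X = Y"
          unfolding Y'_def by (rule poly_mapping_eqI) (simp add: lookup_add)
        ultimately show ?thesis by simp
      qed
    qed
  qed
  moreover have "card (moved \<gamma>) < Suc n" if "\<gamma> \<in> Mon" for \<gamma>
    using card_mono[OF _ order_trans[OF moved_subset dm_Gbar[OF that]]] by simp
  ultimately show ?thesis by blast
qed

lemma emb_mult:
  assumes "a \<in> Gbar G m" "b \<in> Gbar G m"
  shows "emb (a \<cdot> b) = emb a \<cdot> emb b"
proof (rule gmat_eqI)
  \<comment> \<open>The locale predicate does not involve the order of the matrices, so its facts
    can be used at order \<open>m\<close> as well.\<close>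
  note S = monomial_axioms
  fix i j x
  have ab: "a \<cdot> b \<in> Gbar G m" using assms by (rule monomial.mult_closed[OF S])
  show "ent (emb (a \<cdot> b)) i j x \<longleftrightarrow> ent (emb a \<cdot> emb b) i j x"
  proof
    assume "ent (emb (a \<cdot> b)) i j x"
    then consider "i = j" "i \<in> {m+1..n}" "x = \<one>" | "ent (a \<cdot> b) i j x" by (auto simp: ent_emb[OF ab])
    thus "ent (emb a \<cdot> emb b) i j x"
    proof cases
      case 1
      thus ?thesis by (intro ent_multI[OF emb_Mon[OF assms(1)], of i i \<one>]) (auto simp: ent_emb assms)
    next
      case 2
      then obtain k g h where "ent a i k g" "ent b k j h" "x = g \<otimes> h"
          by (rule monomial.ent_multE[OF S _ assms(1)])
      thus ?thesis by (intro ent_multI[OF emb_Mon[OF assms(1)], of i k g]) (auto simp: ent_emb assms)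
    qed
  next
    assume "ent (emb a \<cdot> emb b) i j x"
    then obtain k g h where *: "ent (emb a) i k g" "ent (emb b) k j h" "x = g \<otimes> h"
      by (rule ent_multE[OF _ emb_Mon[OF assms(1)]])
    show "ent (emb (a \<cdot> b)) i j x"
    proof (cases "k \<le> m")
      case True
      hence "ent a i k g" "ent b k j h" using *(1,2) by (auto simp: ent_emb assms)
      thus ?thesis using *(3) by (simp add: ent_emb[OF ab] monomial.ent_multI[OF S assms(1)])
    next
      case False
      hence "i = k" "g = \<one>" "k = j" "h = \<one>" "k \<in> {m+1..n}"
        using *(1,2) Gbar_entry(2)[OF assms(1), of i k g] Gbar_entry(1)[OF assms(2), of k j h]
        by (auto simp: ent_emb assms)
      thus ?thesis using *(3) by (simp add: ent_emb[OF ab])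
    qed
  qed
qed

end

section \<open>Evaluation of stable sequences\<close>

lemma Zbar_lim_simps:
  "mult (Zbar_lim G m) = (\<lambda>\<alpha> \<beta>. \<lambda>n \<in> {m..}. conv G (\<alpha> n) (\<beta> n))"
  "add (Zbar_lim G m) = (\<lambda>\<alpha> \<beta>. \<lambda>n \<in> {m..}. \<alpha> n + \<beta> n)"
  "one (Zbar_lim G m) = (\<lambda>n \<in> {m..}. basis (one_gmat G n))"
  "smult (Zbar_lim G m) = (\<lambda>c \<alpha>. \<lambda>n \<in> {m..}. Poly_Mapping.map ((*) c) (\<alpha> n))"
  by (simp_all add: Zbar_lim_def Zbar_def FGbar_def)

lemma Hbar_simps:
  "mult (Hbar G m) = mult (Zbar_lim G m)" "add (Hbar G m) = add (Zbar_lim G m)"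
  "one (Hbar G m) = one (Zbar_lim G m)" "smult (Hbar G m) = smult (Zbar_lim G m)"
  "carrier (Hbar G m) = alg_generated (Zbar_lim G m) (const_seq G m ` carrier (FGbar G m) \<union> u_seq
      G m ` {1..m})"
  by (simp_all add: Hbar_def)

lemma carrier_FGbar: "carrier (FGbar G m) = {\<alpha>. Poly_Mapping.keys \<alpha> \<subseteq> Gbar G m}"
  by (simp add: FGbar_def)

lemma Hbar_const_seq: "Poly_Mapping.keys x \<subseteq> Gbar G m \<Longrightarrow> const_seq G m x \<in> carrier (Hbar G m)"
  unfolding Hbar_simps carrier_FGbar by (intro alg_generated.incl) blast

context monomial_pair
begin

lemma const_seq_eval: "const_seq G m x n = lin_ext emb x"
  using m_le by (simp add: const_seq_def)

lemma Hbar_eval_Zb: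
  assumes "x \<in> carrier (Hbar G m)"
  shows "x n \<in> Zb"
  using assms unfolding Hbar_simps
proof (induction rule: alg_generated.induct)
  case one
  show ?case unfolding Zbar_lim_simps using m_le Zb_closed(1) by simp
next
  case (incl x)
  then consider y where "Poly_Mapping.keys y \<subseteq> Gbar G m" "x = const_seq G m y" | k where "k \<in>
      {1..m}" "x = u_seq G m k"
    unfolding carrier_FGbar by blast
  thus ?case
  proof cases
    case 1
    thus ?thesis using lin_ext_emb_Zb[OF 1(1)] const_seq_eval[of y] by simp
  next
    case 2
    thus ?thesis using u_elem_Zb[OF 2(1)] m_le by (simp add: u_seq_def)
  qed
next
  case (add x y)
  thus ?case unfolding Zbar_lim_simps using m_le Zb_closed(2)[of "x n" "y n"] by simp
next
  case (mult x y)
  thus ?case unfolding Zbar_lim_simps using m_le Zb_closed(3)[of "x n" "y n"] by simp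
next
  case (smult x c)
  thus ?case unfolding Zbar_lim_simps using m_le Zb_closed(4)[of "x n" c] by simp
qed

lemma eval_hom: "(\<lambda>x. x n) \<in> alg_hom (Hbar G m) (Zbar G m n :: ('f::field, 'g gmat \<Rightarrow>\<^sub>0 'f) module)"
  unfolding alg_hom_def ring_hom_def carrier_Zbar mem_Collect_eq
  unfolding Zbar_simps Hbar_simps(1-4) Zbar_lim_simps
  using Hbar_eval_Zb m_le by auto

lemma eval_assignment: "Psi_assignment G m n (\<lambda>x. x n)"
  unfolding Psi_assignment_def const_seq_eval using m_le by (simp add: u_seq_def)

lemma const_seq_mult:
  assumes "a \<in> Gbar G m" "b \<in> Gbar G m"
  shows "const_seq G m (basis (a \<cdot> b)) = const_seq G m (basis a) \<otimes>\<^bsub>Zbar_lim G m\<^esub> const_seq G m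
      (basis b)"
proof
  fix k
  show "const_seq G m (basis (a \<cdot> b)) k = (const_seq G m (basis a) \<otimes>\<^bsub>Zbar_lim G m\<^esub> const_seq G m
      (basis b)) k"
  proof (cases "m \<le> k")
    case True
    \<comment> \<open>Sequences are compared term by term, so multiplicativity of the embedding is
      required at every order \<open>k\<close>.\<close>
    interpret K: monomial_pair G k m
      using True m_pos finite_G by unfold_locales
    show ?thesis using True by (simp add: const_seq_def Zbar_lim_simps conv_single K.emb_mult[OF assms])
  qed (simp add: const_seq_def Zbar_lim_simps)
qed

text \<open>\<open>Psi_assignment\<close> prescribes values only at diagonal matrices, adjacent
  transpositions, the \<epsilon>_k and the u_k. Multiplicativity extends them to
  \<open>Gbar G m\<close>, linearity to constant sequences, and induction over
  \<open>alg_generated\<close> to the whole carrier.\<close>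

lemma hom_unique:
  fixes \<Phi> :: "(nat \<Rightarrow> 'g gmat \<Rightarrow>\<^sub>0 'f::field) \<Rightarrow> 'g gmat \<Rightarrow>\<^sub>0 'f"
  assumes hom: "\<Phi> \<in> alg_hom (Hbar G m) (Zbar G m n)" and asg: "Psi_assignment G m n \<Phi>"
    and x: "x \<in> carrier (Hbar G m)"
  shows "\<Phi> x = x n"
proof -
  have h_mult: "\<Phi> (x \<otimes>\<^bsub>Zbar_lim G m\<^esub> y) = \<Phi> x \<star> \<Phi> y"
    and h_add: "\<Phi> (x \<oplus>\<^bsub>Zbar_lim G m\<^esub> y) = \<Phi> x + \<Phi> y"
    and h_smult: "\<Phi> (c \<odot>\<^bsub>Zbar_lim G m\<^esub> x) = Poly_Mapping.map ((*) c) (\<Phi> x)"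
    if "x \<in> carrier (Hbar G m)" "y \<in> carrier (Hbar G m)" for x y c
    using hom that unfolding alg_hom_def ring_hom_def Zbar_simps Hbar_simps(1-4) by blast+
  have h_one: "\<Phi> (\<one>\<^bsub>Zbar_lim G m\<^esub>) = basis (one_gmat G n)"
    using hom unfolding alg_hom_def ring_hom_def Zbar_simps Hbar_simps(1-4) by blast
  have basis_eq: "\<Phi> (const_seq G m (basis \<gamma>)) = basis (emb \<gamma>)" if "\<gamma> \<in> Gbar G m" for \<gamma>
  proof -
    interpret S: monomial G m
      by unfold_locales (rule finite_G)
    show ?thesis
      using that
    proof (induction \<gamma> rule: S.Gbar_generators_induct)
      case (mult a b)
      have "const_seq G m (basis a :: 'g gmat \<Rightarrow>\<^sub>0 'f) \<in> carrier (Hbar G m)"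
          "const_seq G m (basis b :: 'g gmat \<Rightarrow>\<^sub>0 'f) \<in> carrier (Hbar G m)"
        using mult.hyps by (auto intro: Hbar_const_seq)
      thus ?case using mult by (simp add: const_seq_mult h_mult conv_single emb_mult)
    qed (use asg in \<open>simp_all add: Psi_assignment_def\<close>)
  qed
  have const_eq: "\<Phi> (const_seq G m y) = lin_ext emb y" if "Poly_Mapping.keys y \<subseteq> Gbar G m" for y
    using that
  proof (induction y rule: keys_subset_induct)
    case zero
    \<comment> \<open>Preservation of zero is not among the defining properties of
      \<open>alg_hom\<close>; it follows by writing zero as the scalar 0 times the identity.\<close>
    have "const_seq G m 0 = (0 :: 'f) \<odot>\<^bsub>Zbar_lim G m\<^esub> \<one>\<^bsub>Zbar_lim G m\<^esub>"
      by (rule ext) (simp add: const_seq_def Zbar_lim_simps)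
    moreover have "\<one>\<^bsub>Zbar_lim G m\<^esub> \<in> carrier (Hbar G m :: ('f, nat \<Rightarrow> 'g gmat \<Rightarrow>\<^sub>0 'f) module)"
      unfolding Hbar_simps by (rule alg_generated.one)
    ultimately show ?case using h_smult by simp
  next
    case (add \<gamma> c y)
    let ?b = "const_seq G m (basis \<gamma> :: 'g gmat \<Rightarrow>\<^sub>0 'f)"
    have e: "const_seq G m (Poly_Mapping.single \<gamma> c + y) = (c \<odot>\<^bsub>Zbar_lim G m\<^esub> ?b) \<oplus>\<^bsub>Zbar_lim G m\<^esub>
        const_seq G m y"
      by (rule ext) (simp add: const_seq_def Zbar_lim_simps lin_ext_add map_times_single)
    have b: "?b \<in> carrier (Hbar G m)" "const_seq G m y \<in> carrier (Hbar G m)"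
      using add.hyps by (auto intro: Hbar_const_seq)
    have cb: "c \<odot>\<^bsub>Zbar_lim G m\<^esub> ?b \<in> carrier (Hbar G m)"
      using b(1) unfolding Hbar_simps by (rule alg_generated.smult)
    show ?case
      unfolding e h_add[OF cb b(2)] h_smult[OF b(1,1)] add.IH basis_eq[OF add.hyps(1)]
      by (simp add: lin_ext_add map_times_single)
  qed
  show ?thesis
    using x unfolding Hbar_simps(5)
  proof (induction rule: alg_generated.induct)
    case one
    show ?case unfolding h_one using m_le by (simp add: Zbar_lim_simps(3))
  next
    case (incl x)
    then consider y where "Poly_Mapping.keys y \<subseteq> Gbar G m" "x = const_seq G m y" | k where "k \<in>
        {1..m}" "x = u_seq G m k"
      unfolding carrier_FGbar by blast
    thus ?case
    proof cases
      case 1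
      thus ?thesis using const_eq[OF 1(1)] const_seq_eval[of y] by simp
    next
      case 2
      have "\<Phi> (u_seq G m k) = u_elem G n k" using asg 2(1) unfolding Psi_assignment_def by blast
      moreover have "(u_seq G m k :: nat \<Rightarrow> 'g gmat \<Rightarrow>\<^sub>0 'f) n = u_elem G n k" using m_le
          by (simp add: u_seq_def)
      ultimately show ?thesis unfolding 2(2) by simp
    qed
  next
    case (add x y)
    show ?case
      unfolding h_add[unfolded Hbar_simps(5), OF add.hyps] add.IH using m_le
          by (simp add: Zbar_lim_simps(2))
  next
    case (mult x y)
    show ?case
      unfolding h_mult[unfolded Hbar_simps(5), OF mult.hyps] mult.IH using m_le
          by (simp add: Zbar_lim_simps(1))
  next
    case (smult x c)
    show ?case
      unfolding h_smult[unfolded Hbar_simps(5), OF smult.hyps smult.hyps] smult.IH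
      using m_le by (simp add: Zbar_lim_simps(4))
  qed
qed

lemma center_Zb: "alg_center (FGbar' G m n) \<subseteq> (Zb :: ('g gmat \<Rightarrow>\<^sub>0 'f::field) set)"
proof
  fix z :: "'g gmat \<Rightarrow>\<^sub>0 'f" assume z: "z \<in> alg_center (FGbar' G m n)"
  hence k: "Poly_Mapping.keys z \<subseteq> Mon'" and c: "\<And>x. Poly_Mapping.keys x \<subseteq> Mon' \<Longrightarrow> z \<star> x = x \<star> z"
    by (auto simp: alg_center_def FGbar'_def FGbar_def)
  show "z \<in> Zb"
  proof (rule ZbI)
    show "z \<in> FM" using k Mon'_Mon by (auto simp: FM_def)
    show "z \<star> basis \<gamma> = basis \<gamma> \<star> z" if "\<gamma> \<in> Mon'" for \<gamma> using that by (intro c) simp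
  qed
qed

lemma Zbar_generated:
  "carrier (Zbar G m n :: ('f::field, 'g gmat \<Rightarrow>\<^sub>0 'f) module) =
    alg_generated (Zbar G m n) ((\<lambda>x. x n) ` carrier (Hbar G m) \<union> alg_center (FGbar' G m n))" (is
        "_ = ?A")
  unfolding carrier_Zbar
proof
  show AZ: "?A \<subseteq> Zb"
  proof
    fix x assume "x \<in> ?A"
    thus "x \<in> Zb"
    proof (induction rule: alg_generated.induct)
      case one
      show ?case unfolding Zbar_simps by (rule Zb_closed(1))
    next
      case (incl x)
      thus ?case using Hbar_eval_Zb center_Zb by blast
    next
      case (add x y)
      show ?case unfolding Zbar_simps by (rule Zb_closed(2)[OF add.IH])
    next
      case (mult x y)
      show ?case unfolding Zbar_simps by (rule Zb_closed(3)[OF mult.IH])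
    next
      case (smult x c)
      show ?case unfolding Zbar_simps by (rule Zb_closed(4)[OF smult.IH])
    qed
  qed
  note ops = alg_generated.mult[of _ "Zbar G m n"] alg_generated.add[of _ "Zbar G m n"]
    alg_generated.smult[of _ "Zbar G m n"] alg_generated.one[of "Zbar G m n"]
  note ops = ops[unfolded Zbar_simps]
  show "Zb \<subseteq> ?A"
  proof (rule Zb_generated[OF AZ])
    show "x \<star> y \<in> ?A" "x + y \<in> ?A" "Poly_Mapping.map ((*) c) x \<in> ?A" if "x \<in> ?A" "y \<in> ?A" for x y c
      using that by (intro ops(1-3); simp)+
    \<comment> \<open>\<open>alg_generated\<close> has no rule for zero, which is obtained as 0
      times the identity.\<close>
    show "0 \<in> ?A" using ops(3)[OF ops(4), of 0] by simp
    show "alg_center (FGbar' G m n) \<subseteq> ?A" by (auto intro: alg_generated.incl)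
    show "lin_ext emb x \<in> ?A" if "Poly_Mapping.keys x \<subseteq> Gbar G m" for x
      unfolding const_seq_eval[symmetric]
      using Hbar_const_seq[OF that] by (intro alg_generated.incl) blast
    show "u_elem G n k \<in> ?A" if "k \<in> {1..m}" for k
    proof (rule alg_generated.incl, rule UnI1, rule image_eqI)
      show "u_elem G n k = u_seq G m k n" using m_le by (simp add: u_seq_def)
      show "u_seq G m k \<in> carrier (Hbar G m)" unfolding Hbar_simps using that
          by (intro alg_generated.incl) blast
    qed
  qed
qed

end

text \<open>That the assignment defines a homomorphism is rendered as existence together with
  uniqueness on the carrier of \<open>Hbar G m\<close>.\<close>

theorem lemma5p1:
  fixes G :: "('g, 'x) monoid_scheme" and m n :: nat
  assumes "group G" and "finite (carrier G)" and "1 \<le> m" and "m \<le> n"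
  shows "\<exists>\<Psi> :: (nat \<Rightarrow> 'g gmat \<Rightarrow>\<^sub>0 'f::field) \<Rightarrow> 'g gmat \<Rightarrow>\<^sub>0 'f.
    \<Psi> \<in> alg_hom (Hbar G m) (Zbar G m n) \<and>
    Psi_assignment G m n \<Psi> \<and>
    (\<forall>\<Phi> \<in> alg_hom (Hbar G m) (Zbar G m n).
       Psi_assignment G m n \<Phi> \<longrightarrow> (\<forall>x \<in> carrier (Hbar G m). \<Phi> x = \<Psi> x)) \<and>
    carrier (Zbar G m n) =
      alg_generated (Zbar G m n) (\<Psi> ` carrier (Hbar G m) \<union> alg_center (FGbar' G m n))"
proof -
  interpret monomial_pair G n m
    using assms by (intro monomial_pair.intro monomial.intro monomial_axioms.intro
        monomial_pair_axioms.intro)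
  show ?thesis
    by (intro exI[of _ "\<lambda>x. x n"] conjI ballI impI eval_hom eval_assignment hom_unique Zbar_generated)
qed

end
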